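(* Let $S$ be a unital commutative semigroup with involution and let $f:S\to\mathbb C$ be a positive semidefinite function. Then there exists a unique representing measure $\nu_f$ for $f$ with compact support if and only if $$R_s=\sup_{n\in\mathbb N}\sqrt[2n]{f(s^n(s^* )^n)}<\infty\quad\text{for all }s\in S.$$ Moreover, in this case, the support of $\nu_f$ is a subset of the set $$K_f=\{\alpha\in X(S):|\alpha(s)|\le R_s\text{ for all }s\in S\}.$$
   Context: A unital semigroup with involution is a semigroup $(S,\cdot)$ with neutral element $1$ and a map ${}^*:S\to S$ with $(st)^*=t^*s^*$ and $(s^* )^*=s$ for all $s,t\in S$. $\mathbb N=\{1,2,\dots\}$. A function $f:S\to\mathbb C$ is positive semidefinite if $\sum_{j,k=1}^n c_j\overline{c_k}f(s_j^*s_k)\ge 0$ for all $n\in\mathbb N$, $s_1,\dots,s_n\in S$, $c_1,\dots,c_n\in\mathbb C$. A character of $S$ is a function $\alpha:S\to\mathbb C$ with $\alpha(1)=1$, $\alpha(st)=\alpha(s)\alpha(t)$ and $\alpha(s^* )=\overline{\alpha(s)}$ for all $s,t\in S$; $X(S)$ is the set of characters with the topology of pointwise convergence. A representing measure for $f$ is a positive Radon measure $\mu$ on $X(S)$ such that $f(s)=\int\alpha(s)\,d\mu(\alpha)$ for all $s\in S$. *)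

theory Defs
  imports "HOL-Analysis.Analysis"
begin

definition involution :: "('a::monoid_mult \<Rightarrow> 'a) \<Rightarrow> bool" where
  "involution star \<longleftrightarrow>
     (\<forall>s t. star (s * t) = star t * star s) \<and> (\<forall>s. star (star s) = s)"

definition positive_semidefinite :: "('a::monoid_mult \<Rightarrow> 'a) \<Rightarrow> ('a \<Rightarrow> complex) \<Rightarrow> bool" where
  "positive_semidefinite star f \<longleftrightarrow>
     (\<forall>(n::nat) (s :: nat \<Rightarrow> 'a) (c :: nat \<Rightarrow> complex).
        (\<Sum>j=1..n. \<Sum>k=1..n. c j * cnj (c k) * f (star (s j) * s k)) \<in> \<real>\<^sub>\<ge>\<^sub>0)"

definition characters :: "('a::monoid_mult \<Rightarrow> 'a) \<Rightarrow> ('a \<Rightarrow> complex) set" where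
  "characters star =
     {\<alpha>. \<alpha> 1 = 1 \<and> (\<forall>s t. \<alpha> (s * t) = \<alpha> s * \<alpha> t) \<and> (\<forall>s. \<alpha> (star s) = cnj (\<alpha> s))}"

definition character_space :: "('a::monoid_mult \<Rightarrow> 'a) \<Rightarrow> ('a \<Rightarrow> complex) topology" where
  "character_space star =
     subtopology (product_topology (\<lambda>_. euclidean) UNIV) (characters star)"

text \<open>Intended for Hausdorff spaces, where compact sets are Borel.  No local compactness is
  assumed: the space of characters need not be locally compact.\<close>

definition radon_measure :: "'x topology \<Rightarrow> 'x measure \<Rightarrow> bool" where
  "radon_measure T M \<longleftrightarrow>
     space M = topspace T \<and>
     sets M = sigma_sets (topspace T) {U. openin T U} \<and>
     (\<forall>K. compactin T K \<longrightarrow> emeasure M K < \<infinity>) \<and>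
     (\<forall>B\<in>sets M. emeasure M B = (SUP K\<in>{K. compactin T K \<and> K \<subseteq> B}. emeasure M K))"

definition measure_support :: "'x topology \<Rightarrow> 'x measure \<Rightarrow> 'x set" where
  "measure_support T M =
     {x \<in> topspace T. \<forall>U. openin T U \<and> x \<in> U \<longrightarrow> emeasure M U > 0}"

text \<open>Integrability is demanded explicitly, since the integral of a non-integrable function
  is \<open>0\<close> by convention.\<close>

definition representing_measure ::
    "('a::monoid_mult \<Rightarrow> 'a) \<Rightarrow> ('a \<Rightarrow> complex) \<Rightarrow> ('a \<Rightarrow> complex) measure \<Rightarrow> bool" where
  "representing_measure star f M \<longleftrightarrow>
     radon_measure (character_space star) M \<and>
     (\<forall>s. integrable M (\<lambda>\<alpha>. \<alpha> s) \<and> f s = (LINT \<alpha>|M. \<alpha> s))"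

definition compactly_supported_representing_measure ::
    "('a::monoid_mult \<Rightarrow> 'a) \<Rightarrow> ('a \<Rightarrow> complex) \<Rightarrow> ('a \<Rightarrow> complex) measure \<Rightarrow> bool" where
  "compactly_supported_representing_measure star f M \<longleftrightarrow>
     representing_measure star f M \<and>
     compactin (character_space star) (measure_support (character_space star) M)"

text \<open>For commutative multiplication and positive semidefinite \<open>f\<close> the values under the root
  are nonnegative reals, so \<open>Re\<close> only changes the type; see
  \<open>positive_semidefinite_power\<close> below.  The supremum is taken in the extended reals and
  may be \<open>\<infinity>\<close>.\<close>

definition moment_radius ::
    "('a::monoid_mult \<Rightarrow> 'a) \<Rightarrow> ('a \<Rightarrow> complex) \<Rightarrow> 'a \<Rightarrow> ereal" where
  "moment_radius star f s =
     (SUP n\<in>{1::nat..}. ereal (root (2 * n) (Re (f (s ^ n * star s ^ n)))))"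

definition bounded_characters ::
    "('a::monoid_mult \<Rightarrow> 'a) \<Rightarrow> ('a \<Rightarrow> complex) \<Rightarrow> ('a \<Rightarrow> complex) set" where
  "bounded_characters star f =
     {\<alpha> \<in> characters star. \<forall>s. ereal (cmod (\<alpha> s)) \<le> moment_radius star f s}"

lemma involution_one: "involution star \<Longrightarrow> star 1 = 1"
  unfolding involution_def by (metis mult_1_left mult_1_right)

lemma involution_power:
  assumes "involution star"
  shows "star (s ^ n) = star s ^ n"
proof (induction n)
  case 0
  then show ?case using involution_one[OF assms] by simp
next
  case (Suc n)
  then show ?case using assms by (simp add: involution_def power_commutes)
qed

lemma positive_semidefinite_power:
  fixes star :: "'a::comm_monoid_mult \<Rightarrow> 'a"
  assumes "involution star" "positive_semidefinite star f"
  shows "f (s ^ n * star s ^ n) \<in> \<real>\<^sub>\<ge>\<^sub>0"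
proof -
  have "(\<Sum>j=1..1::nat. \<Sum>k=1..1::nat. 1 * cnj 1 * f (star (s ^ n) * s ^ n)) \<in> \<real>\<^sub>\<ge>\<^sub>0"
    using assms(2)[unfolded positive_semidefinite_def, rule_format,
        of "\<lambda>_. 1" "\<lambda>_. s ^ n" 1] by simp
  then show ?thesis
    by (simp add: involution_power[OF assms(1)] mult.commute)
qed

lemma topspace_character_space: "topspace (character_space star) = characters star"
  by (simp add: character_space_def)

end

theory Submission
  imports Defs
begin

text \<open>
  Only existence is deep. Write \<open>E\<^sub>s \<phi>\<close> for the translate \<open>\<lambda>t. \<phi> (s * t)\<close>. The bound \<open>R\<^sub>s < \<infinity>\<close> together with iterated
  Cauchy-Schwarz inequalities shows that \<open>\<rho>\<^sub>s\<^sup>2 \<phi> - E\<^sub>s\<^sub>s\<^sub>* \<phi>\<close> is again positive semidefinite for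
  \<open>\<rho>\<^sub>s = R\<^sub>s + 1\<close> (\<open>psd_norm_bound\<close>): multiplication by \<open>s\<close> acts as an operator of norm at most
  \<open>\<rho>\<^sub>s\<close>. Hence the self-adjoint element \<open>x = 1/2 + (s + s\<^sup>*)/(4 \<rho>\<^sub>s)\<close> and its complement \<open>1 - x\<close>, and
  likewise those built from the imaginary part of \<open>s\<close>, map the cone of such functions into itself.

  This permits Bernstein's proof of the moment problem on an interval. The function \<open>f\<close> splits into
  the sum of the functions \<open>binom n k x\<^sup>k (1-x)\<^sup>n\<^sup>-\<^sup>k f\<close>, and by the variance of the binomial
  distribution the \<open>k\<close>-th summand is, on average, nearly an eigenvector of \<open>x\<close> with eigenvalue
  \<open>k/n\<close>. Splitting repeatedly, one obtains \<open>f = \<psi>\<^sub>1 + ... + \<psi>\<^sub>N\<close> and points \<open>z\<^sub>i\<close> of a fixed compact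
  box such that \<open>E\<^sub>s \<psi>\<^sub>i\<close> is close to \<open>z\<^sub>i s\<close> times \<open>\<psi>\<^sub>i\<close> for all \<open>s\<close> in a given finite set
  (\<open>approximate_characters\<close>). The discrete measures \<open>\<Sum> \<psi>\<^sub>i(1) \<delta>(z\<^sub>i)\<close> therefore nearly represent \<open>f\<close>
  and nearly live on characters.

  By Tychonoff's theorem the corresponding functionals on bounded functions have a cluster point
  (\<open>positive_functional_compactness\<close>). A positive functional on bounded functions gives a
  finitely additive set function, whose inner approximation by compact sets extends to a Radon
  measure with the same integrals of continuous functions
  (\<open>positive_functional_representation\<close>). Inner regularity turns the vanishing of the integrals
  of all defects from being a character into concentration on the set of characters, although
  uncountably many conditions are involved.

  Uniqueness is the Stone-Weierstrass argument: on the union of the two compact supports the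
  polynomials in the coordinates \<open>\<alpha> s\<close> separate disjoint compact sets, and their integrals are
  determined by \<open>f\<close>. Finiteness of \<open>R\<^sub>s\<close> and the location of the support both follow from
  \<open>f (s\<^sup>n s\<^sup>*\<^sup>n) = \<integral>\<bar>\<alpha> s\<bar>\<^sup>2\<^sup>n\<close>: its \<open>2n\<close>-th root tends to the essential supremum of \<open>\<bar>\<alpha> s\<bar>\<close>.
\<close>

section \<open>Positive semidefinite functions\<close>


text \<open>An arbitrary finite index type makes the substitutions below possible in which a family of points is
  doubled or multiplied by another family.\<close>

lemma psd_finite_index:
  fixes s :: "'i \<Rightarrow> 'a::monoid_mult" and c :: "'i \<Rightarrow> complex"
  assumes "positive_semidefinite star \<phi>" and "finite I"
  shows "(\<Sum>i\<in>I. \<Sum>j\<in>I. c i * cnj (c j) * \<phi> (star (s i) * s j)) \<in> \<real>\<^sub>\<ge>\<^sub>0"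
proof -
  obtain h where h: "bij_betw h {1..card I} I"
    using ex_bij_betw_nat_finite_1[OF assms(2)] by blast
  have "(\<Sum>i\<in>I. \<Sum>j\<in>I. c i * cnj (c j) * \<phi> (star (s i) * s j))
      = (\<Sum>i=1..card I. \<Sum>j=1..card I. c (h i) * cnj (c (h j)) * \<phi> (star (s (h i)) * s (h j)))"
    by (simp add: sum.reindex_bij_betw[OF h, symmetric])
  also have "\<dots> \<in> \<real>\<^sub>\<ge>\<^sub>0"
    using assms(1)[unfolded positive_semidefinite_def, rule_format,
        of "\<lambda>i. c (h i)" "\<lambda>i. s (h i)" "card I"] .
  finally show ?thesis .
qed

lemma psd_add:
  assumes "positive_semidefinite star \<phi>" "positive_semidefinite star \<psi>"
  shows "positive_semidefinite star (\<lambda>t. \<phi> t + \<psi> t)"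
  unfolding positive_semidefinite_def
proof (intro allI)
  fix n :: nat and s :: "nat \<Rightarrow> 'a" and c :: "nat \<Rightarrow> complex"
  have "(\<Sum>j=1..n. \<Sum>k=1..n. c j * cnj (c k) * (\<phi> (star (s j) * s k) + \<psi> (star (s j) * s k)))
     = (\<Sum>j=1..n. \<Sum>k=1..n. c j * cnj (c k) * \<phi> (star (s j) * s k))
     + (\<Sum>j=1..n. \<Sum>k=1..n. c j * cnj (c k) * \<psi> (star (s j) * s k))"
    by (simp add: distrib_left sum.distrib)
  also have "\<dots> \<in> \<real>\<^sub>\<ge>\<^sub>0"
    using assms unfolding positive_semidefinite_def by (intro nonneg_Reals_add_I) blast+
  finally show "(\<Sum>j=1..n. \<Sum>k=1..n. c j * cnj (c k) * (\<phi> (star (s j) * s k) + \<psi> (star (s j) * s k))) \<in> \<real>\<^sub>\<ge>\<^sub>0" .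
qed

lemma psd_scale:
  assumes "positive_semidefinite star \<phi>" "r \<ge> 0"
  shows "positive_semidefinite star (\<lambda>t. complex_of_real r * \<phi> t)"
  unfolding positive_semidefinite_def
proof (intro allI)
  fix n :: nat and s :: "nat \<Rightarrow> 'a" and c :: "nat \<Rightarrow> complex"
  have "(\<Sum>j=1..n. \<Sum>k=1..n. c j * cnj (c k) * (complex_of_real r * \<phi> (star (s j) * s k)))
     = complex_of_real r * (\<Sum>j=1..n. \<Sum>k=1..n. c j * cnj (c k) * \<phi> (star (s j) * s k))"
    by (simp add: sum_distrib_left mult_ac)
  also have "\<dots> \<in> \<real>\<^sub>\<ge>\<^sub>0"
    using assms unfolding positive_semidefinite_def by (intro nonneg_Reals_mult_I) auto
  finally show "(\<Sum>j=1..n. \<Sum>k=1..n. c j * cnj (c k) * (complex_of_real r * \<phi> (star (s j) * s k))) \<in> \<real>\<^sub>\<ge>\<^sub>0" .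
qed

text \<open>Two-point instances of positive semidefiniteness are such forms; they contain Hermitian symmetry
  and the Cauchy-Schwarz inequality.\<close>

lemma hermitian_form2:
  fixes A B B' D :: complex
  assumes "\<And>a b. a * cnj a * A + a * cnj b * B + b * cnj a * B' + b * cnj b * D \<in> \<real>\<^sub>\<ge>\<^sub>0"
  shows "A \<in> \<real>\<^sub>\<ge>\<^sub>0" "D \<in> \<real>\<^sub>\<ge>\<^sub>0" "B' = cnj B" "(cmod B)\<^sup>2 \<le> Re A * Re D"
proof -
  show A: "A \<in> \<real>\<^sub>\<ge>\<^sub>0" using assms[of 1 0] by simp
  show D: "D \<in> \<real>\<^sub>\<ge>\<^sub>0" using assms[of 0 1] by simp
  have "Im B + Im B' = 0"
    using assms[of 1 1] A D by (simp add: complex_nonneg_Reals_iff)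
  moreover have "Re B = Re B'"
    using assms[of \<i> 1] A D by (simp add: complex_nonneg_Reals_iff)
  ultimately show B': "B' = cnj B" by (simp add: complex_eq_iff)
  \<comment> \<open>The coefficient of the second vector is a real multiple of \<open>B\<close>, which makes the mixed terms real.\<close>
  have form: "0 \<le> x\<^sup>2 * Re A - 2 * x * y * (cmod B)\<^sup>2 + y\<^sup>2 * (cmod B)\<^sup>2 * Re D" for x y :: real
  proof -
    have "Re (complex_of_real x * cnj (complex_of_real x) * A
        + complex_of_real x * cnj (complex_of_real (-y) * B) * B
        + complex_of_real (-y) * B * cnj (complex_of_real x) * B'
        + complex_of_real (-y) * B * cnj (complex_of_real (-y) * B) * D)
      = x\<^sup>2 * Re A - 2 * x * y * (cmod B)\<^sup>2 + y\<^sup>2 * (cmod B)\<^sup>2 * Re D"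
      using A D unfolding B' cmod_power2
      by (simp add: complex_nonneg_Reals_iff power2_eq_square algebra_simps)
    then show ?thesis
      using assms[of "complex_of_real x" "complex_of_real (-y) * B"]
      by (auto simp: complex_nonneg_Reals_iff)
  qed
  show "(cmod B)\<^sup>2 \<le> Re A * Re D"
  proof (cases "Re D = 0")
    case True
    show ?thesis
    proof (rule ccontr)
      assume "\<not> ?thesis"
      then have "(cmod B)\<^sup>2 > 0" using True by simp
      then show False
        using form[of 1 "(Re A + 1) / (2 * (cmod B)\<^sup>2)"] True A
        by (simp add: complex_nonneg_Reals_iff)
    qed
  next
    case False
    then have D0: "Re D > 0" using D by (simp add: complex_nonneg_Reals_iff)
    have "0 \<le> Re D * (Re A * Re D - (cmod B)\<^sup>2)"
      using form[of "Re D" 1] by (simp add: power2_eq_square algebra_simps)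
    then show ?thesis using D0 by (simp add: zero_le_mult_iff)
  qed
qed

text \<open>The hypothesis on squares iterates to \<open>(h 1 / h 0) ^ (2 ^ k) \<le> h (2 ^ k) / h 0\<close>, so a ratio \<open>h 1 / h 0\<close>
  exceeding \<open>\<rho>\<close> would force a faster exponential growth than the one assumed. The constant \<open>C\<close>
  disappears in the limit.\<close>

lemma log_convex_bound:
  fixes h :: "nat \<Rightarrow> real"
  assumes nn: "\<And>n. h n \<ge> 0" and conv: "\<And>n. (h n)\<^sup>2 \<le> h 0 * h (2 * n)"
    and growth: "\<And>n. h n \<le> C * \<rho> ^ n" and \<rho>: "\<rho> > 0"
  shows "h 1 \<le> \<rho> * h 0"
proof (cases "h 0 = 0")
  case True
  then show ?thesis using conv[of 1] by simp
next
  case False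
  then have h0: "h 0 > 0" using nn[of 0] by simp
  define q where "q = h 1 / (\<rho> * h 0)"
  have q0: "q \<ge> 0" unfolding q_def using nn[of 1] h0 \<rho> by simp
  have iter: "(h 1 / h 0) ^ (2 ^ k) \<le> h (2 ^ k) / h 0" for k
  proof (induction k)
    case (Suc k)
    have "(h 1 / h 0) ^ (2 ^ Suc k) = ((h 1 / h 0) ^ (2 ^ k))\<^sup>2"
      by (simp add: power_mult[symmetric] mult.commute)
    also have "\<dots> \<le> (h (2 ^ k) / h 0)\<^sup>2"
      using Suc nn h0 by (intro power_mono) auto
    also have "\<dots> \<le> h (2 ^ Suc k) / h 0"
      using conv[of "2 ^ k"] h0 by (simp add: power2_eq_square field_simps)
    finally show ?case .
  qed simp
  have qb: "q ^ (2 ^ k) \<le> C / h 0" for k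
  proof -
    have "q ^ (2 ^ k) = (h 1 / h 0) ^ (2 ^ k) / \<rho> ^ (2 ^ k)"
      by (simp add: q_def power_divide power_mult_distrib field_simps)
    also have "\<dots> \<le> (h (2 ^ k) / h 0) / \<rho> ^ (2 ^ k)"
      using iter \<rho> by (intro divide_right_mono) auto
    also have "\<dots> \<le> C / h 0"
      using growth[of "2 ^ k"] \<rho> h0 by (simp add: field_simps)
    finally show ?thesis .
  qed
  have "q \<le> 1"
  proof (rule ccontr)
    assume "\<not> q \<le> 1"
    then have q1: "q > 1" by simp
    then obtain n where n: "C / h 0 < q ^ n" using real_arch_pow by blast
    have "q ^ n \<le> q ^ (2 ^ n)"
      using q1 by (intro power_increasing) auto
    then show False using n qb[of n] by simp
  qed
  then show ?thesis unfolding q_def using h0 \<rho> by (simp add: field_simps)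
qed

locale commutative_involution =
  fixes star :: "'a::comm_monoid_mult \<Rightarrow> 'a"
  assumes inv: "involution star"
begin

abbreviation psd :: "('a \<Rightarrow> complex) \<Rightarrow> bool" where
  "psd \<equiv> positive_semidefinite star"

lemma star_mult [simp]: "star (s * t) = star s * star t"
  using inv by (simp add: involution_def mult.commute)

lemma star_star [simp]: "star (star s) = s"
  using inv by (simp add: involution_def)

lemma star_one [simp]: "star 1 = 1"
  by (rule involution_one[OF inv])

lemma star_power [simp]: "star (s ^ n) = star s ^ n"
  by (rule involution_power[OF inv])

lemma psd_two_points:
  assumes "psd \<phi>"
  shows "a * cnj a * \<phi> (star s * s) + a * cnj b * \<phi> (star s * t)
       + b * cnj a * \<phi> (star t * s) + b * cnj b * \<phi> (star t * t) \<in> \<real>\<^sub>\<ge>\<^sub>0"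
  using psd_finite_index[OF assms, of UNIV "\<lambda>i. if i then a else b" "\<lambda>i. if i then s else t"]
  by (simp add: UNIV_bool add_ac)

lemma psd_cauchy_schwarz:
  assumes "psd \<phi>"
  shows "(cmod (\<phi> (star s * t)))\<^sup>2 \<le> Re (\<phi> (star s * s)) * Re (\<phi> (star t * t))"
  using hermitian_form2(4)[OF psd_two_points[OF assms]] .

lemma psd_hermitian:
  assumes "psd \<phi>"
  shows "\<phi> (star s) = cnj (\<phi> s)"
  using hermitian_form2(3)[OF psd_two_points[OF assms], of 1 s] by simp

lemma psd_diagonal:
  assumes "psd \<phi>"
  shows "\<phi> (s * star s) \<in> \<real>\<^sub>\<ge>\<^sub>0"
  using hermitian_form2(1)[OF psd_two_points[OF assms], of s] by (simp add: mult.commute)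

lemma psd_one:
  assumes "psd \<phi>"
  shows "\<phi> 1 \<in> \<real>\<^sub>\<ge>\<^sub>0"
  using psd_diagonal[OF assms, of 1] by simp

text \<open>In the semigroup algebra this is multiplication of the functional \<open>\<phi>\<close> by the positive element
  \<open>v v\<^sup>*\<close>, where \<open>v\<close> is a combination of \<open>1\<close> and \<open>s\<close>; it comes from adding to each point \<open>p\<close> the
  point \<open>s * p\<close>.\<close>

lemma psd_square_multiple:
  assumes "psd \<phi>"
  shows "psd (\<lambda>t. a * cnj a * \<phi> t + a * cnj b * \<phi> (s * t) + b * cnj a * \<phi> (star s * t)
      + b * cnj b * \<phi> (s * star s * t))"
  unfolding positive_semidefinite_def
proof (intro allI)
  fix n :: nat and p :: "nat \<Rightarrow> 'a" and c :: "nat \<Rightarrow> complex"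
  let ?I = "{1..n} \<times> (UNIV :: bool set)"
  let ?c = "\<lambda>(i, e). c i * (if e then b else a)"
  let ?p = "\<lambda>(i, e). if e then s * p i else p i"
  have "(\<Sum>i\<in>?I. \<Sum>j\<in>?I. ?c i * cnj (?c j) * \<phi> (star (?p i) * ?p j)) \<in> \<real>\<^sub>\<ge>\<^sub>0"
    by (rule psd_finite_index[OF assms]) simp
  moreover have "(\<Sum>i\<in>?I. \<Sum>j\<in>?I. ?c i * cnj (?c j) * \<phi> (star (?p i) * ?p j))
    = (\<Sum>i=1..n. \<Sum>j=1..n. c i * cnj (c j) * (a * cnj a * \<phi> (star (p i) * p j)
        + a * cnj b * \<phi> (s * (star (p i) * p j)) + b * cnj a * \<phi> (star s * (star (p i) * p j))
        + b * cnj b * \<phi> (s * star s * (star (p i) * p j))))"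
    by (simp add: sum.cartesian_product' UNIV_bool sum.distrib algebra_simps)
  ultimately show "(\<Sum>j=1..n. \<Sum>k=1..n. c j * cnj (c k) * (a * cnj a * \<phi> (star (p j) * p k)
        + a * cnj b * \<phi> (s * (star (p j) * p k)) + b * cnj a * \<phi> (star s * (star (p j) * p k))
        + b * cnj b * \<phi> (s * star s * (star (p j) * p k)))) \<in> \<real>\<^sub>\<ge>\<^sub>0"
    by simp
qed

section \<open>Exponential growth and boundedness of translations\<close>

text \<open>The condition is linear in \<open>\<phi>\<close> and stable under translation. This is why it, rather than a bound
  on \<open>\<phi> (s ^ n * star s ^ n)\<close> alone, is carried along when new functions are formed out of \<open>\<phi>\<close>.\<close>

definition exp_growth :: "('a \<Rightarrow> real) \<Rightarrow> ('a \<Rightarrow> complex) \<Rightarrow> bool" where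
  "exp_growth \<rho> \<phi> \<longleftrightarrow>
     (\<forall>u s. \<exists>C. \<forall>n. cmod (\<phi> (u * (s * star s) ^ n)) \<le> C * \<rho> s ^ (2 * n))"

lemma exp_growth_add:
  assumes "exp_growth \<rho> \<phi>" "exp_growth \<rho> \<psi>"
  shows "exp_growth \<rho> (\<lambda>t. \<phi> t + \<psi> t)"
  unfolding exp_growth_def
proof (intro allI)
  fix u s
  obtain C D where
    "\<And>n. cmod (\<phi> (u * (s * star s) ^ n)) \<le> C * \<rho> s ^ (2 * n)"
    "\<And>n. cmod (\<psi> (u * (s * star s) ^ n)) \<le> D * \<rho> s ^ (2 * n)"
    using assms unfolding exp_growth_def by metis
  then have "cmod (\<phi> (u * (s * star s) ^ n) + \<psi> (u * (s * star s) ^ n)) \<le> (C + D) * \<rho> s ^ (2 * n)" for n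
    by (simp add: distrib_right) (meson add_mono norm_triangle_ineq order_trans)
  then show "\<exists>C. \<forall>n. cmod (\<phi> (u * (s * star s) ^ n) + \<psi> (u * (s * star s) ^ n)) \<le> C * \<rho> s ^ (2 * n)"
    by blast
qed

lemma exp_growth_scale_shift:
  assumes "exp_growth \<rho> \<phi>"
  shows "exp_growth \<rho> (\<lambda>t. c * \<phi> (v * t))"
  unfolding exp_growth_def
proof (intro allI)
  fix u s
  obtain C where "\<And>n. cmod (\<phi> (v * u * (s * star s) ^ n)) \<le> C * \<rho> s ^ (2 * n)"
    using assms unfolding exp_growth_def by metis
  then have "cmod (c * \<phi> (v * (u * (s * star s) ^ n))) \<le> (cmod c * C) * \<rho> s ^ (2 * n)" for n
    by (simp add: norm_mult mult.assoc mult_left_mono)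
  then show "\<exists>C. \<forall>n. cmod (c * \<phi> (v * (u * (s * star s) ^ n))) \<le> C * \<rho> s ^ (2 * n)"
    by blast
qed

text \<open>For fixed points and coefficients, \<open>u \<mapsto> \<Sum> c\<^sub>i cnj c\<^sub>j \<phi> (p\<^sub>i\<^sup>* p\<^sub>j u)\<close> is positive semidefinite, so its values
  at the powers of \<open>s s\<^sup>*\<close> satisfy the hypotheses of \<open>log_convex_bound\<close>.\<close>

lemma psd_norm_bound:
  assumes psd: "psd \<phi>" and growth: "exp_growth \<rho> \<phi>" and \<rho>: "\<rho> s > 0"
  shows "psd (\<lambda>t. complex_of_real ((\<rho> s)\<^sup>2) * \<phi> t - \<phi> (s * star s * t))"
  unfolding positive_semidefinite_def
proof (intro allI)
  fix n :: nat and p :: "nat \<Rightarrow> 'a" and c :: "nat \<Rightarrow> complex"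
  define g where "g = (\<lambda>u. \<Sum>i=1..n. \<Sum>j=1..n. c i * cnj (c j) * \<phi> (star (p i) * p j * u))"
  have psd_g: "psd g"
    unfolding positive_semidefinite_def
  proof (intro allI)
    fix m :: nat and q :: "nat \<Rightarrow> 'a" and d :: "nat \<Rightarrow> complex"
    let ?I = "{1..m} \<times> {1..n}"
    let ?c = "\<lambda>(a, i). d a * c i"
    let ?p = "\<lambda>(a, i). q a * p i"
    have "(\<Sum>x\<in>?I. \<Sum>y\<in>?I. ?c x * cnj (?c y) * \<phi> (star (?p x) * ?p y)) \<in> \<real>\<^sub>\<ge>\<^sub>0"
      by (rule psd_finite_index[OF psd]) simp
    also have "(\<Sum>x\<in>?I. \<Sum>y\<in>?I. ?c x * cnj (?c y) * \<phi> (star (?p x) * ?p y))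
      = (\<Sum>a=1..m. \<Sum>i=1..n. \<Sum>b=1..m. \<Sum>j=1..n.
          d a * c i * cnj (d b * c j) * \<phi> (star (q a * p i) * (q b * p j)))"
      by (simp only: sum.cartesian_product' case_prod_conv)
    also have "\<dots> = (\<Sum>a=1..m. \<Sum>b=1..m. \<Sum>i=1..n. \<Sum>j=1..n.
          d a * c i * cnj (d b * c j) * \<phi> (star (q a * p i) * (q b * p j)))"
      by (intro sum.cong refl sum.swap)
    also have "\<dots> = (\<Sum>a=1..m. \<Sum>b=1..m. d a * cnj (d b) * g (star (q a) * q b))"
      by (simp add: g_def sum_distrib_left mult_ac)
    finally show "(\<Sum>a=1..m. \<Sum>b=1..m. d a * cnj (d b) * g (star (q a) * q b)) \<in> \<real>\<^sub>\<ge>\<^sub>0" .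
  qed
  define x where "x = s * star s"
  have star_x: "star (x ^ k) = x ^ k" for k by (simp add: x_def mult.commute)
  have g_nn: "g (x ^ k) \<in> \<real>\<^sub>\<ge>\<^sub>0" for k
  proof -
    have "x ^ k = s ^ k * star (s ^ k)" by (simp add: x_def power_mult_distrib)
    then show ?thesis using psd_diagonal[OF psd_g] by metis
  qed
  obtain C where C: "\<And>i j k. cmod (\<phi> (star (p i) * p j * x ^ k)) \<le> C i j * \<rho> s ^ (2 * k)"
  proof -
    have "\<forall>i j. \<exists>C. \<forall>k. cmod (\<phi> (star (p i) * p j * x ^ k)) \<le> C * \<rho> s ^ (2 * k)"
      using growth unfolding exp_growth_def x_def by blast
    then show ?thesis using that by metis
  qed
  define D where "D = (\<Sum>i=1..n. \<Sum>j=1..n. cmod (c i) * cmod (c j) * C i j)"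
  have g_growth: "cmod (g (x ^ k)) \<le> D * \<rho> s ^ (2 * k)" for k
  proof -
    have "cmod (g (x ^ k)) \<le> (\<Sum>i=1..n. \<Sum>j=1..n. cmod (c i * cnj (c j) * \<phi> (star (p i) * p j * x ^ k)))"
      unfolding g_def by (intro order_trans[OF norm_sum] sum_mono norm_sum)
    also have "\<dots> \<le> (\<Sum>i=1..n. \<Sum>j=1..n. cmod (c i) * cmod (c j) * (C i j * \<rho> s ^ (2 * k)))"
      by (intro sum_mono) (simp add: norm_mult mult_left_mono C)
    also have "\<dots> = D * \<rho> s ^ (2 * k)"
      by (simp add: D_def sum_distrib_right mult.assoc)
    finally show ?thesis .
  qed
  have "Re (g (x ^ 1)) \<le> (\<rho> s)\<^sup>2 * Re (g (x ^ 0))"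
  proof (rule log_convex_bound)
    show "0 \<le> Re (g (x ^ k))" for k
      using g_nn by (simp add: complex_nonneg_Reals_iff)
    show "(Re (g (x ^ k)))\<^sup>2 \<le> Re (g (x ^ 0)) * Re (g (x ^ (2 * k)))" for k
    proof -
      have "\<bar>Re (g (x ^ k))\<bar> \<le> cmod (g (x ^ k))" by (rule abs_Re_le_cmod)
      then have "(Re (g (x ^ k)))\<^sup>2 \<le> (cmod (g (x ^ k)))\<^sup>2"
        by (metis norm_ge_zero power2_abs power_mono abs_ge_zero)
      also have "\<dots> \<le> Re (g (x ^ 0)) * Re (g (x ^ (2 * k)))"
        using psd_cauchy_schwarz[OF psd_g, of 1 "x ^ k"] star_x[of k]
        by (simp add: power_add[symmetric] mult_2 del: star_power)
      finally show ?thesis .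
    qed
    show "Re (g (x ^ k)) \<le> D * (\<rho> s)\<^sup>2 ^ k" for k
      using g_growth[of k] complex_Re_le_cmod[of "g (x ^ k)"] by (simp add: power_mult)
    show "0 < (\<rho> s)\<^sup>2" using \<rho> by simp
  qed
  then have ineq: "Re (g x) \<le> (\<rho> s)\<^sup>2 * Re (g 1)" by simp
  have "(\<Sum>j=1..n. \<Sum>k=1..n. c j * cnj (c k) * (complex_of_real ((\<rho> s)\<^sup>2) * \<phi> (star (p j) * p k)
      - \<phi> (s * star s * (star (p j) * p k)))) = complex_of_real ((\<rho> s)\<^sup>2) * g 1 - g x"
    by (simp add: g_def x_def right_diff_distrib sum_subtractf sum_distrib_left mult_ac)
  also have "\<dots> \<in> \<real>\<^sub>\<ge>\<^sub>0"
    using ineq g_nn[of 0] g_nn[of 1]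
    by (simp add: complex_nonneg_Reals_iff flip: of_real_power)
  finally show "(\<Sum>j=1..n. \<Sum>k=1..n. c j * cnj (c k) * (complex_of_real ((\<rho> s)\<^sup>2) * \<phi> (star (p j) * p k)
      - \<phi> (s * star s * (star (p j) * p k)))) \<in> \<real>\<^sub>\<ge>\<^sub>0" .
qed

end


section \<open>Splitting a function by coin flips\<close>

lemma sum_list_refine:
  "sum_list (map g (concat (map h xs))) = (\<Sum>x\<leftarrow>xs. sum_list (map g (h x)))"
  by (induction xs) auto

context commutative_involution
begin

text \<open>The cone in which all splittings take place.\<close>

definition admissible :: "('a \<Rightarrow> real) \<Rightarrow> ('a \<Rightarrow> complex) \<Rightarrow> bool" where
  "admissible \<rho> \<phi> \<longleftrightarrow> psd \<phi> \<and> exp_growth \<rho> \<phi>"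

text \<open>Multiplication by \<open>(1 + h/\<rho>\<^sub>s)/2\<close>, where \<open>h = (c s + cnj c s\<^sup>*)/2\<close> is a self-adjoint element. If \<open>h\<close> were a
  number in \<open>[-\<rho>\<^sub>s, \<rho>\<^sub>s]\<close> this would be the probability of heads of a biased coin; the complementary
  probability belongs to \<open>- c\<close>.\<close>

definition coin :: "('a \<Rightarrow> real) \<Rightarrow> 'a \<Rightarrow> complex \<Rightarrow> ('a \<Rightarrow> complex) \<Rightarrow> 'a \<Rightarrow> complex" where
  "coin \<rho> s c \<phi> = (\<lambda>t. \<phi> t / 2 + (c * \<phi> (s * t) + cnj c * \<phi> (star s * t)) / of_real (4 * \<rho> s))"

lemma coin_complement: "\<phi> t - coin \<rho> s c \<phi> t = coin \<rho> s (- c) \<phi> t"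
  by (simp add: coin_def add_divide_distrib diff_divide_distrib)

text \<open>Positivity rests on the identity
  \<open>2 \<rho>\<^sup>2 + \<rho> (c s + cnj c s\<^sup>*) = (\<rho> + c s) (\<rho> + c s)\<^sup>* + (\<rho>\<^sup>2 - s s\<^sup>*)\<close> for \<open>\<bar>c\<bar> = 1\<close>: the first summand is
  a square, and the second acts positively by \<open>psd_norm_bound\<close>.\<close>

lemma admissible_coin:
  assumes adm: "admissible \<rho> \<phi>" and \<rho>: "\<rho> s > 0" and c: "cmod c = 1"
  shows "admissible \<rho> (coin \<rho> s c \<phi>)"
proof -
  have psd: "psd \<phi>" and gr: "exp_growth \<rho> \<phi>" using adm by (auto simp: admissible_def)
  let ?r = "complex_of_real (\<rho> s)"
  have cc: "c * cnj c = 1" "cnj c * c = 1" using c complex_norm_square[of c] by (auto simp: mult.commute)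
  have r0: "?r \<noteq> 0" using \<rho> by simp
  have "psd (\<lambda>t. complex_of_real (1 / (4 * (\<rho> s)\<^sup>2)) *
      ((?r * cnj ?r * \<phi> t + ?r * cnj (cnj c) * \<phi> (s * t) + cnj c * cnj ?r * \<phi> (star s * t)
        + cnj c * cnj (cnj c) * \<phi> (s * star s * t))
       + (complex_of_real ((\<rho> s)\<^sup>2) * \<phi> t - \<phi> (s * star s * t))))"
    by (intro psd_scale psd_add psd_square_multiple psd_norm_bound psd gr \<rho>) simp
  moreover have "complex_of_real (1 / (4 * (\<rho> s)\<^sup>2)) *
      ((?r * cnj ?r * \<phi> t + ?r * cnj (cnj c) * \<phi> (s * t) + cnj c * cnj ?r * \<phi> (star s * t)
        + cnj c * cnj (cnj c) * \<phi> (s * star s * t))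
       + (complex_of_real ((\<rho> s)\<^sup>2) * \<phi> t - \<phi> (s * star s * t))) = coin \<rho> s c \<phi> t" for t
    using r0 cc by (simp add: coin_def field_simps power2_eq_square)
  ultimately have "psd (coin \<rho> s c \<phi>)" by (simp add: fun_eq_iff)
  moreover have "exp_growth \<rho> (coin \<rho> s c \<phi>)"
  proof -
    have "exp_growth \<rho> (\<lambda>t. 1 / 2 * \<phi> (1 * t) + ((c / of_real (4 * \<rho> s)) * \<phi> (s * t)
        + (cnj c / of_real (4 * \<rho> s)) * \<phi> (star s * t)))"
      by (intro exp_growth_add exp_growth_scale_shift gr)
    then show ?thesis by (simp add: coin_def add_divide_distrib)
  qed
  ultimately show ?thesis by (simp add: admissible_def)
qed

text \<open>The second component of an entry counts the heads. Grouping the entries by this count would give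
  the summands of the Bernstein operator; the recursion on the first flip makes the moments below
  immediate inductions.\<close>

primrec coin_flips ::
  "('a \<Rightarrow> real) \<Rightarrow> 'a \<Rightarrow> complex \<Rightarrow> nat \<Rightarrow> ('a \<Rightarrow> complex) \<Rightarrow> (('a \<Rightarrow> complex) \<times> nat) list" where
  "coin_flips \<rho> s c 0 \<phi> = [(\<phi>, 0)]"
| "coin_flips \<rho> s c (Suc n) \<phi> =
     map (\<lambda>(\<psi>, k). (\<psi>, Suc k)) (coin_flips \<rho> s c n (coin \<rho> s c \<phi>)) @
     coin_flips \<rho> s c n (coin \<rho> s (- c) \<phi>)"

lemma coin_flips_admissible:
  assumes "admissible \<rho> \<phi>" "\<rho> s > 0" "cmod c = 1" "(\<psi>, k) \<in> set (coin_flips \<rho> s c n \<phi>)"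
  shows "admissible \<rho> \<psi>" "k \<le> n"
proof -
  have "admissible \<rho> \<psi> \<and> k \<le> n"
    using assms(1,4)
  proof (induction n arbitrary: \<phi> k)
    case (Suc n)
    have "admissible \<rho> (coin \<rho> s c \<phi>)" "admissible \<rho> (coin \<rho> s (- c) \<phi>)"
      using Suc.prems(1) assms(2,3) by (auto intro: admissible_coin)
    then show ?case using Suc.prems(2) Suc.IH by fastforce
  qed simp
  then show "admissible \<rho> \<psi>" "k \<le> n" by auto
qed

lemma coin_flips_sum: "(\<Sum>(\<psi>, k)\<leftarrow>coin_flips \<rho> s c n \<phi>. \<psi> t) = \<phi> t"
proof (induction n arbitrary: \<phi>)
  case (Suc n)
  then show ?case
    by (simp add: o_def case_prod_unfold coin_complement[symmetric])
qed simp

lemma coin_flips_mean: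
  "(\<Sum>(\<psi>, k)\<leftarrow>coin_flips \<rho> s c n \<phi>. of_nat k * \<psi> t) = of_nat n * coin \<rho> s c \<phi> t"
proof (induction n arbitrary: \<phi>)
  case (Suc n)
  have *: "coin \<rho> s c (coin \<rho> s (- c) \<phi>) t = coin \<rho> s c \<phi> t - coin \<rho> s c (coin \<rho> s c \<phi>) t"
    by (simp add: coin_def algebra_simps add_divide_distrib diff_divide_distrib)
  show ?case
    using Suc[of "coin \<rho> s c \<phi>"] Suc[of "coin \<rho> s (- c) \<phi>"]
      coin_flips_sum[of t \<rho> s c n "coin \<rho> s c \<phi>"]
    by (simp add: o_def case_prod_unfold distrib_right sum_list_addf * algebra_simps)
qed simp

text \<open>This and the two preceding lemmas are the moments of the binomial distribution with the operator
  \<open>coin\<close> in the place of the success probability.\<close>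

lemma coin_flips_second_moment:
  "(\<Sum>(\<psi>, k)\<leftarrow>coin_flips \<rho> s c n \<phi>. (of_nat k)\<^sup>2 * \<psi> t)
    = of_nat n * (of_nat n - 1) * coin \<rho> s c (coin \<rho> s c \<phi>) t + of_nat n * coin \<rho> s c \<phi> t"
proof (induction n arbitrary: \<phi>)
  case (Suc n)
  have *: "coin \<rho> s c (coin \<rho> s (- c) \<phi>) = (\<lambda>t. coin \<rho> s c \<phi> t - coin \<rho> s c (coin \<rho> s c \<phi>) t)" for \<phi>
    by (simp add: coin_def algebra_simps add_divide_distrib diff_divide_distrib)
  have **: "coin \<rho> s c (\<lambda>t. \<phi> t - \<psi> t) t = coin \<rho> s c \<phi> t - coin \<rho> s c \<psi> t" for \<phi> \<psi> t
    by (simp add: coin_def algebra_simps add_divide_distrib diff_divide_distrib)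
  have up: "(\<Sum>p\<leftarrow>ys. (of_nat (Suc (snd p)))\<^sup>2 * fst p t)
     = (\<Sum>p\<leftarrow>ys. (of_nat (snd p))\<^sup>2 * fst p t) + 2 * (\<Sum>p\<leftarrow>ys. of_nat (snd p) * fst p t)
       + (\<Sum>p\<leftarrow>ys. fst p t)" for ys :: "(('a \<Rightarrow> complex) \<times> nat) list"
    by (induction ys) (auto simp: power2_eq_square algebra_simps)
  let ?X = "coin \<rho> s c"
  have "(\<Sum>(\<psi>, k)\<leftarrow>coin_flips \<rho> s c (Suc n) \<phi>. (of_nat k)\<^sup>2 * \<psi> t)
     = (\<Sum>p\<leftarrow>coin_flips \<rho> s c n (?X \<phi>). (of_nat (Suc (snd p)))\<^sup>2 * fst p t)
     + (\<Sum>p\<leftarrow>coin_flips \<rho> s c n (coin \<rho> s (- c) \<phi>). (of_nat (snd p))\<^sup>2 * fst p t)"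
    by (simp add: o_def case_prod_unfold del: of_nat_Suc)
  also have "\<dots> = (of_nat n * (of_nat n - 1) * ?X (?X (?X \<phi>)) t + of_nat n * ?X (?X \<phi>) t)
       + 2 * (of_nat n * ?X (?X \<phi>) t) + ?X \<phi> t
     + (of_nat n * (of_nat n - 1) * (?X (?X \<phi>) t - ?X (?X (?X \<phi>)) t)
       + of_nat n * (?X \<phi> t - ?X (?X \<phi>) t))"
    unfolding up
    using Suc[of "?X \<phi>"] Suc[of "coin \<rho> s (- c) \<phi>"]
      coin_flips_sum[of t \<rho> s c n "?X \<phi>"] coin_flips_mean[of t \<rho> s c n "?X \<phi>"]
    by (simp add: case_prod_unfold * **)
  also have "\<dots> = of_nat (Suc n) * (of_nat (Suc n) - 1) * ?X (?X \<phi>) t + of_nat (Suc n) * ?X \<phi> t"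
    by (simp add: algebra_simps)
  finally show ?case .
qed simp

text \<open>The value of \<open>\<psi>\<close> at \<open>(h - \<tau>)\<^sup>2\<close> with \<open>h = (c s + cnj c s\<^sup>*)/2\<close>: it measures how far \<open>\<psi>\<close> is from being an
  eigenvector of \<open>h\<close> with eigenvalue \<open>\<tau>\<close>.\<close>

definition hdist :: "'a \<Rightarrow> complex \<Rightarrow> real \<Rightarrow> ('a \<Rightarrow> complex) \<Rightarrow> complex" where
  "hdist s c \<tau> \<psi> = (c\<^sup>2 * \<psi> (s * s) + 2 * \<psi> (s * star s) + (cnj c)\<^sup>2 * \<psi> (star s * star s)) / 4
     - of_real \<tau> * (c * \<psi> s + cnj c * \<psi> (star s)) + (of_real \<tau>)\<^sup>2 * \<psi> 1"

text \<open>The value of \<open>\<psi>\<close> at \<open>(s - z) (s - z)\<^sup>*\<close>.\<close>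

definition pdist :: "'a \<Rightarrow> complex \<Rightarrow> ('a \<Rightarrow> complex) \<Rightarrow> complex" where
  "pdist s z \<psi> = \<psi> (s * star s) - cnj z * \<psi> s - z * \<psi> (star s) + z * cnj z * \<psi> 1"

lemma hdist_sum:
  "(\<Sum>x\<leftarrow>xs. hdist s c \<tau> (f x)) = hdist s c \<tau> (\<lambda>t. \<Sum>x\<leftarrow>xs. f x t)"
  by (induction xs) (simp_all add: hdist_def algebra_simps add_divide_distrib)

lemma pdist_sum:
  "(\<Sum>x\<leftarrow>xs. pdist s z (f x)) = pdist s z (\<lambda>t. \<Sum>x\<leftarrow>xs. f x t)"
  by (induction xs) (simp_all add: pdist_def algebra_simps)

text \<open>The element \<open>s\<close> is \<open>h + \<i> g\<close> with commuting self-adjoint \<open>h = (s + s\<^sup>*)/2\<close> and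
  \<open>g = (- \<i> s + \<i> s\<^sup>*)/2\<close>.\<close>

lemma pdist_eq_hdist: "pdist s z \<psi> = hdist s 1 (Re z) \<psi> + hdist s (- \<i>) (Im z) \<psi>"
proof -
  have *: "z * cnj z = (of_real (Re z))\<^sup>2 + (of_real (Im z))\<^sup>2"
    by (simp add: complex_mult_cnj)
  have **: "z = of_real (Re z) + \<i> * of_real (Im z)" "cnj z = of_real (Re z) - \<i> * of_real (Im z)"
    by (simp_all add: complex_eq_iff)
  show ?thesis
    unfolding pdist_def * hdist_def by (subst **(1), subst **(2)) (simp add: field_simps)
qed

text \<open>The point \<open>\<rho> (2 x - 1)\<close> of \<open>[-\<rho>, \<rho>]\<close> corresponds to the head probability \<open>x\<close>.\<close>

lemma hdist_coin:
  assumes \<rho>: "\<rho> s > 0" and c: "cmod c = 1"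
  shows "hdist s c (\<rho> s * (2 * x - 1)) \<psi> = of_real (4 * (\<rho> s)\<^sup>2) *
    (coin \<rho> s c (coin \<rho> s c \<psi>) 1 - 2 * of_real x * coin \<rho> s c \<psi> 1 + (of_real x)\<^sup>2 * \<psi> 1)"
proof -
  have cc: "c * cnj c = 1" "cnj c * c = 1" using c complex_norm_square[of c] by (auto simp: mult.commute)
  have cc': "c * (cnj c * y) = y" "cnj c * (c * y) = y" for y
    by (simp_all add: cc mult.assoc[symmetric])
  define r where "r = complex_of_real (\<rho> s)"
  define X where "X = complex_of_real x"
  have r0: "r \<noteq> 0" using \<rho> by (simp add: r_def)
  have 1: "of_real (\<rho> s * (2 * x - 1)) = r * (2 * X - 1)"
    "of_real (4 * (\<rho> s)\<^sup>2) = 4 * r\<^sup>2" "of_real (4 * \<rho> s) = 4 * r"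
    by (simp_all add: r_def X_def)
  show ?thesis
    unfolding hdist_def coin_def 1 X_def[symmetric] using r0
    by (simp add: field_simps power2_eq_square cc cc')
qed

text \<open>An entry with \<open>k\<close> heads in \<open>n\<close> flips is assigned the point that corresponds to the head
  frequency \<open>k/n\<close>. The total squared deviation is the binomial variance \<open>x (1 - x)/n\<close>, scaled by
  \<open>4 \<rho>\<^sup>2\<close>, hence at most \<open>4 \<rho>\<^sup>2 \<phi>(1)/n\<close>.\<close>

lemma hermitian_split:
  assumes adm: "admissible \<rho> \<phi>" and \<rho>: "\<rho> s > 0" and c: "cmod c = 1" and \<epsilon>: "\<epsilon> > 0"
  shows "\<exists>xs. (\<forall>(\<psi>, \<tau>)\<in>set xs. admissible \<rho> \<psi> \<and> \<bar>\<tau>\<bar> \<le> \<rho> s) \<and> (\<forall>t. (\<Sum>(\<psi>, \<tau>)\<leftarrow>xs. \<psi> t) = \<phi> t)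
    \<and> (\<Sum>(\<psi>, \<tau>)\<leftarrow>xs. Re (hdist s c \<tau> \<psi>)) \<le> \<epsilon> * Re (\<phi> 1)"
proof -
  have cpos: "admissible \<rho> (coin \<rho> s d \<phi>)" if "cmod d = 1" for d
    using admissible_coin[of \<rho> \<phi> s d] adm \<rho> that by blast
  obtain N :: nat where N: "4 * (\<rho> s)\<^sup>2 / \<epsilon> < real N" using reals_Archimedean2 by blast
  define n where "n = Suc N"
  have n: "4 * (\<rho> s)\<^sup>2 / real n \<le> \<epsilon>"
    using N \<epsilon> by (simp add: n_def field_simps)
  define \<theta> where "\<theta> = (\<lambda>k. \<rho> s * (2 * (real k / real n) - 1))"
  define xs where "xs = map (\<lambda>(\<psi>, k). (\<psi>, \<theta> k)) (coin_flips \<rho> s c n \<phi>)"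
  have "\<forall>(\<psi>, \<tau>)\<in>set xs. admissible \<rho> \<psi> \<and> \<bar>\<tau>\<bar> \<le> \<rho> s"
  proof (clarsimp simp: xs_def)
    fix \<psi> k assume *: "(\<psi>, k) \<in> set (coin_flips \<rho> s c n \<phi>)"
    have "k \<le> n" using coin_flips_admissible(2)[OF adm \<rho> c *] .
    then have "\<bar>2 * (real k / real n) - 1\<bar> \<le> 1"
      by (auto simp: n_def field_simps abs_le_iff)
    then have "\<bar>\<theta> k\<bar> \<le> \<rho> s"
      using \<rho> by (simp add: \<theta>_def abs_mult mult_left_le)
    then show "admissible \<rho> \<psi> \<and> \<bar>\<theta> k\<bar> \<le> \<rho> s"
      using coin_flips_admissible(1)[OF adm \<rho> c *] by simp
  qed
  moreover have "(\<Sum>(\<psi>, \<tau>)\<leftarrow>xs. \<psi> t) = \<phi> t" for t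
    using coin_flips_sum[of t \<rho> s c n \<phi>] by (simp add: xs_def o_def case_prod_unfold)
  moreover have "(\<Sum>(\<psi>, \<tau>)\<leftarrow>xs. Re (hdist s c \<tau> \<psi>)) \<le> \<epsilon> * Re (\<phi> 1)"
  proof -
    let ?X = "coin \<rho> s c"
    let ?fl = "coin_flips \<rho> s c n \<phi>"
    have lin: "(\<Sum>p\<leftarrow>ys. w p * ?X (g p) t) = ?X (\<lambda>t. \<Sum>p\<leftarrow>ys. w p * g p t) t"
      for ys :: "(('a \<Rightarrow> complex) \<times> nat) list" and w g t
      by (induction ys) (simp_all add: coin_def algebra_simps add_divide_distrib)
    have X1: "(\<Sum>p\<leftarrow>?fl. of_nat (snd p) * ?X (fst p) 1) = of_nat n * ?X (?X \<phi>) 1"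
    proof -
      have "(\<lambda>t. \<Sum>p\<leftarrow>?fl. of_nat (snd p) * fst p t) = (\<lambda>t. of_nat n * ?X \<phi> t)"
        using coin_flips_mean[of _ \<rho> s c n \<phi>] by (simp add: case_prod_unfold)
      then show ?thesis
        using lin[of "\<lambda>p. of_nat (snd p)" fst 1 ?fl] by (simp add: coin_def algebra_simps)
    qed
    have X2: "(\<Sum>p\<leftarrow>?fl. ?X (?X (fst p)) 1) = ?X (?X \<phi>) 1"
    proof -
      have "(\<lambda>t. \<Sum>p\<leftarrow>?fl. ?X (fst p) t) = ?X \<phi>"
        using lin[of "\<lambda>p. 1" fst _ ?fl] coin_flips_sum[of _ \<rho> s c n \<phi>]
        by (simp add: case_prod_unfold)
      then show ?thesis
        using lin[of "\<lambda>p. 1" "\<lambda>p. ?X (fst p)" 1 ?fl] by simp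
    qed
    have X0: "(\<Sum>p\<leftarrow>?fl. (of_nat (snd p))\<^sup>2 * fst p 1)
        = of_nat n * (of_nat n - 1) * ?X (?X \<phi>) 1 + of_nat n * ?X \<phi> 1"
      using coin_flips_second_moment[of 1 \<rho> s c n \<phi>] by (simp add: case_prod_unfold)
    let ?r = "complex_of_real (4 * (\<rho> s)\<^sup>2)"
    have n0: "(of_nat n :: complex) \<noteq> 0" by (simp add: n_def del: of_nat_Suc)
    have "(\<Sum>p\<leftarrow>?fl. hdist s c (\<theta> (snd p)) (fst p))
      = (\<Sum>p\<leftarrow>?fl. ?r * ?X (?X (fst p)) 1 + (- 2 * ?r / of_nat n) * (of_nat (snd p) * ?X (fst p) 1)
          + (?r / (of_nat n)\<^sup>2) * ((of_nat (snd p))\<^sup>2 * fst p 1))"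
      by (intro arg_cong[where f = sum_list] map_cong refl)
         (simp only: \<theta>_def hdist_coin[of \<rho> s c, OF \<rho> c], simp add: algebra_simps power_divide)
    also have "\<dots> = ?r * ?X (?X \<phi>) 1 + (- 2 * ?r / of_nat n) * (of_nat n * ?X (?X \<phi>) 1)
          + (?r / (of_nat n)\<^sup>2) * (of_nat n * (of_nat n - 1) * ?X (?X \<phi>) 1 + of_nat n * ?X \<phi> 1)"
      by (simp only: sum_list_addf sum_list_const_mult X0 X1 X2)
    also have "\<dots> = of_real (4 * (\<rho> s)\<^sup>2 / real n) * (?X \<phi> 1 - ?X (?X \<phi>) 1)"
      using n0 by (simp add: field_simps power2_eq_square)
    finally have total: "(\<Sum>p\<leftarrow>?fl. hdist s c (\<theta> (snd p)) (fst p))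
      = of_real (4 * (\<rho> s)\<^sup>2 / real n) * (?X \<phi> 1 - ?X (?X \<phi>) 1)" .
    have pos: "0 \<le> Re (\<psi> 1)" if "admissible \<rho> \<psi>" for \<psi>
      using psd_one that by (auto simp: admissible_def complex_nonneg_Reals_iff)
    have "Re (?X \<phi> 1) \<le> Re (\<phi> 1)"
      using pos[OF cpos[of "- c"]] c coin_complement[of \<phi> 1 \<rho> s c, symmetric] by simp
    moreover have "0 \<le> Re (?X (?X \<phi>) 1)"
      by (intro pos admissible_coin cpos \<rho> c)
    ultimately have le: "Re (?X \<phi> 1 - ?X (?X \<phi>) 1) \<le> Re (\<phi> 1)" by simp
    have "(\<Sum>(\<psi>, \<tau>)\<leftarrow>xs. Re (hdist s c \<tau> \<psi>)) = Re (\<Sum>p\<leftarrow>?fl. hdist s c (\<theta> (snd p)) (fst p))"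
    proof -
      have "(\<Sum>(\<psi>, \<tau>)\<leftarrow>map (\<lambda>(\<psi>, k). (\<psi>, \<theta> k)) ys. Re (hdist s c \<tau> \<psi>))
         = Re (\<Sum>p\<leftarrow>ys. hdist s c (\<theta> (snd p)) (fst p))" for ys
        by (induction ys) auto
      then show ?thesis by (simp add: xs_def)
    qed
    also have "\<dots> = 4 * (\<rho> s)\<^sup>2 / real n * Re (?X \<phi> 1 - ?X (?X \<phi>) 1)"
      by (simp only: total Re_complex_of_real times_complex.sel Im_complex_of_real)
    also have "\<dots> \<le> 4 * (\<rho> s)\<^sup>2 / real n * Re (\<phi> 1)"
      using le by (intro mult_left_mono) auto
    also have "\<dots> \<le> \<epsilon> * Re (\<phi> 1)"
      using n pos[OF adm] by (intro mult_right_mono) auto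
    finally show ?thesis .
  qed
  ultimately show ?thesis by blast
qed


section \<open>Approximate characters\<close>

text \<open>Splitting along the real part and then along the imaginary part. The deviation from the real
  part is linear in the function, so the second splitting leaves its total unchanged. The bound is
  relative to \<open>\<phi> 1\<close> in order that bounds for many functions can be added.\<close>

lemma point_split:
  assumes adm: "admissible \<rho> \<phi>" and \<rho>: "\<rho> s > 0" and \<epsilon>: "\<epsilon> > 0"
  shows "\<exists>xs. (\<forall>p\<in>set xs. admissible \<rho> (fst p) \<and> \<bar>Re (snd p)\<bar> \<le> \<rho> s \<and> \<bar>Im (snd p)\<bar> \<le> \<rho> s)
    \<and> (\<forall>t. (\<Sum>p\<leftarrow>xs. fst p t) = \<phi> t)
    \<and> (\<Sum>p\<leftarrow>xs. Re (pdist s (snd p) (fst p))) \<le> \<epsilon> * Re (\<phi> 1)"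
proof -
  obtain xs where xs: "\<forall>(\<psi>, \<tau>)\<in>set xs. admissible \<rho> \<psi> \<and> \<bar>\<tau>\<bar> \<le> \<rho> s"
    "\<forall>t. (\<Sum>(\<psi>, \<tau>)\<leftarrow>xs. \<psi> t) = \<phi> t"
    "(\<Sum>(\<psi>, \<tau>)\<leftarrow>xs. Re (hdist s 1 \<tau> \<psi>)) \<le> \<epsilon> / 2 * Re (\<phi> 1)"
    using hermitian_split[of \<rho> \<phi> s 1 "\<epsilon> / 2"] adm \<rho> \<epsilon> by auto
  have "\<exists>ys. admissible \<rho> \<psi> \<longrightarrow>
      (\<forall>(\<omega>, \<tau>)\<in>set ys. admissible \<rho> \<omega> \<and> \<bar>\<tau>\<bar> \<le> \<rho> s) \<and> (\<forall>t. (\<Sum>(\<omega>, \<tau>)\<leftarrow>ys. \<omega> t) = \<psi> t)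
      \<and> (\<Sum>(\<omega>, \<tau>)\<leftarrow>ys. Re (hdist s (- \<i>) \<tau> \<omega>)) \<le> \<epsilon> / 2 * Re (\<psi> 1)" for \<psi>
    using hermitian_split[of \<rho> \<psi> s "- \<i>" "\<epsilon> / 2"] \<rho> \<epsilon> by auto
  then obtain H where H: "\<And>\<psi>. admissible \<rho> \<psi> \<Longrightarrow>
      (\<forall>(\<omega>, \<tau>)\<in>set (H \<psi>). admissible \<rho> \<omega> \<and> \<bar>\<tau>\<bar> \<le> \<rho> s) \<and> (\<forall>t. (\<Sum>(\<omega>, \<tau>)\<leftarrow>H \<psi>. \<omega> t) = \<psi> t)
      \<and> (\<Sum>(\<omega>, \<tau>)\<leftarrow>H \<psi>. Re (hdist s (- \<i>) \<tau> \<omega>)) \<le> \<epsilon> / 2 * Re (\<psi> 1)"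
    by metis
  define K where "K = (\<lambda>p. map (\<lambda>q. (fst q, Complex (snd p) (snd q))) (H (fst p)))"
  define ys where "ys = concat (map K xs)"
  have Hsum: "(\<Sum>q\<leftarrow>H (fst p). fst q t) = fst p t" if "p \<in> set xs" for p t
    using H[of "fst p"] xs(1) that by (auto simp: case_prod_unfold)
  have "(\<Sum>p\<leftarrow>ys. fst p t) = \<phi> t" for t
  proof -
    have "(\<Sum>p\<leftarrow>ys. fst p t) = (\<Sum>p\<leftarrow>xs. fst p t)"
      unfolding ys_def sum_list_refine
      by (intro arg_cong[where f = sum_list] map_cong refl) (simp add: K_def o_def Hsum)
    then show ?thesis using xs(2) by (simp add: case_prod_unfold)
  qed
  moreover have "\<forall>p\<in>set ys. admissible \<rho> (fst p) \<and> \<bar>Re (snd p)\<bar> \<le> \<rho> s \<and> \<bar>Im (snd p)\<bar> \<le> \<rho> s"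
    using xs(1) H by (fastforce simp: ys_def K_def)
  moreover have "(\<Sum>p\<leftarrow>ys. Re (pdist s (snd p) (fst p))) \<le> \<epsilon> * Re (\<phi> 1)"
  proof -
    have "(\<Sum>p\<leftarrow>ys. Re (pdist s (snd p) (fst p)))
      = (\<Sum>p\<leftarrow>xs. \<Sum>q\<leftarrow>K p. Re (pdist s (snd q) (fst q)))"
      unfolding ys_def sum_list_refine ..
    also have "\<dots> \<le> (\<Sum>p\<leftarrow>xs. Re (hdist s 1 (snd p) (fst p)) + \<epsilon> / 2 * Re (fst p 1))"
    proof (rule sum_list_mono)
      fix p assume p: "p \<in> set xs"
      have "(\<Sum>q\<leftarrow>K p. Re (pdist s (snd q) (fst q)))
         = Re (\<Sum>q\<leftarrow>H (fst p). hdist s 1 (snd p) (fst q)) + (\<Sum>q\<leftarrow>H (fst p). Re (hdist s (- \<i>) (snd q) (fst q)))"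
      proof -
        have "(\<Sum>q\<leftarrow>map (\<lambda>q. (fst q, Complex (snd p) (snd q))) qs. Re (pdist s (snd q) (fst q)))
         = Re (\<Sum>q\<leftarrow>qs. hdist s 1 (snd p) (fst q)) + (\<Sum>q\<leftarrow>qs. Re (hdist s (- \<i>) (snd q) (fst q)))" for qs
          by (induction qs) (simp_all add: pdist_eq_hdist)
        then show ?thesis unfolding K_def .
      qed
      also have "\<dots> \<le> Re (hdist s 1 (snd p) (fst p)) + \<epsilon> / 2 * Re (fst p 1)"
        unfolding hdist_sum using Hsum[OF p] H[of "fst p"] xs(1) p by (auto simp: case_prod_unfold)
      finally show "(\<Sum>q\<leftarrow>K p. Re (pdist s (snd q) (fst q))) \<le> Re (hdist s 1 (snd p) (fst p)) + \<epsilon> / 2 * Re (fst p 1)" .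
    qed
    also have "\<dots> = (\<Sum>p\<leftarrow>xs. Re (hdist s 1 (snd p) (fst p))) + \<epsilon> / 2 * Re (\<Sum>p\<leftarrow>xs. fst p 1)"
      by (induction xs) (simp_all add: algebra_simps)
    also have "\<dots> \<le> \<epsilon> * Re (\<phi> 1)"
      using xs(2,3) by (simp add: case_prod_unfold)
    finally show ?thesis .
  qed
  ultimately show ?thesis by blast
qed

text \<open>Elements of \<open>F\<close> are treated one after another; refining for a new element does not change the
  totals for the old ones, again because \<open>pdist\<close> is linear in the function. Outside \<open>F\<close> the
  points are \<open>0\<close>, which keeps them in the box.\<close>

lemma finite_split:
  assumes adm: "admissible \<rho> \<phi>" and \<rho>: "\<And>s. \<rho> s > 0" and "finite F" and \<epsilon>: "\<epsilon> > 0"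
  shows "\<exists>xs. (\<forall>p\<in>set xs. admissible \<rho> (fst p) \<and> (\<forall>s. \<bar>Re (snd p s)\<bar> \<le> \<rho> s \<and> \<bar>Im (snd p s)\<bar> \<le> \<rho> s))
    \<and> (\<forall>t. (\<Sum>p\<leftarrow>xs. fst p t) = \<phi> t)
    \<and> (\<forall>s\<in>F. (\<Sum>p\<leftarrow>xs. Re (pdist s (snd p s) (fst p))) \<le> \<epsilon>)"
  using \<open>finite F\<close>
proof (induction F rule: finite_induct)
  case empty
  show ?case
  proof (intro exI[of _ "[(\<phi>, \<lambda>_. 0)]"] conjI ballI allI)
    show "\<bar>Re (snd p t)\<bar> \<le> \<rho> t" "\<bar>Im (snd p t)\<bar> \<le> \<rho> t" if "p \<in> set [(\<phi>, \<lambda>_. 0)]" for p t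
      using that less_imp_le[OF \<rho>[of t]] by simp_all
  qed (use adm in auto)
next
  case (insert s F)
  obtain xs where "(\<forall>p\<in>set xs. admissible \<rho> (fst p) \<and> (\<forall>s. \<bar>Re (snd p s)\<bar> \<le> \<rho> s \<and> \<bar>Im (snd p s)\<bar> \<le> \<rho> s))
    \<and> (\<forall>t. (\<Sum>p\<leftarrow>xs. fst p t) = \<phi> t)
    \<and> (\<forall>s\<in>F. (\<Sum>p\<leftarrow>xs. Re (pdist s (snd p s) (fst p))) \<le> \<epsilon>)"
    using insert.IH by (rule exE)
  then have
    xs: "\<And>p. p \<in> set xs \<Longrightarrow> admissible \<rho> (fst p)"
      "\<And>p s. p \<in> set xs \<Longrightarrow> \<bar>Re (snd p s)\<bar> \<le> \<rho> s \<and> \<bar>Im (snd p s)\<bar> \<le> \<rho> s"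
      "\<And>t. (\<Sum>p\<leftarrow>xs. fst p t) = \<phi> t"
      "\<And>s. s \<in> F \<Longrightarrow> (\<Sum>p\<leftarrow>xs. Re (pdist s (snd p s) (fst p))) \<le> \<epsilon>"
    by (elim conjE, blast)+
  have \<phi>1: "Re (\<phi> 1) \<ge> 0"
    using adm psd_one by (auto simp: admissible_def complex_nonneg_Reals_iff)
  define \<delta> where "\<delta> = \<epsilon> / (Re (\<phi> 1) + 1)"
  have \<delta>: "\<delta> > 0" "\<delta> * Re (\<phi> 1) \<le> \<epsilon>"
    using \<epsilon> \<phi>1 by (auto simp: \<delta>_def field_simps)
  define P where "P = (\<lambda>\<psi> ys. (\<forall>q\<in>set ys. admissible \<rho> (fst q) \<and> \<bar>Re (snd q)\<bar> \<le> \<rho> s \<and> \<bar>Im (snd q)\<bar> \<le> \<rho> s)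
      \<and> (\<forall>t. (\<Sum>q\<leftarrow>ys. fst q t) = \<psi> t)
      \<and> (\<Sum>q\<leftarrow>ys. Re (pdist s (snd q) (fst q))) \<le> \<delta> * Re (\<psi> 1))"
  have "\<forall>\<psi>. \<exists>ys. admissible \<rho> \<psi> \<longrightarrow> P \<psi> ys"
    using point_split[of \<rho> _ s \<delta>, OF _ \<rho> \<delta>(1)] unfolding P_def by blast
  then obtain H where PH: "\<forall>\<psi>. admissible \<rho> \<psi> \<longrightarrow> P \<psi> (H \<psi>)"
    by (rule choice[THEN exE])
  have H: "\<And>\<psi> q. admissible \<rho> \<psi> \<Longrightarrow> q \<in> set (H \<psi>) \<Longrightarrow>
        admissible \<rho> (fst q) \<and> \<bar>Re (snd q)\<bar> \<le> \<rho> s \<and> \<bar>Im (snd q)\<bar> \<le> \<rho> s"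
    "\<And>\<psi> t. admissible \<rho> \<psi> \<Longrightarrow> (\<Sum>q\<leftarrow>H \<psi>. fst q t) = \<psi> t"
    "\<And>\<psi>. admissible \<rho> \<psi> \<Longrightarrow> (\<Sum>q\<leftarrow>H \<psi>. Re (pdist s (snd q) (fst q))) \<le> \<delta> * Re (\<psi> 1)"
    using PH unfolding P_def by blast+
  define K where "K = (\<lambda>p :: ('a \<Rightarrow> complex) \<times> ('a \<Rightarrow> complex). map (\<lambda>q. (fst q, (snd p)(s := snd q))) (H (fst p)))"
  define ys where "ys = concat (map K xs)"
  have Hsum: "(\<Sum>q\<leftarrow>H (fst p). fst q t) = fst p t" if "p \<in> set xs" for p t
    by (rule H(2)[OF xs(1)[OF that]])
  have "\<forall>p\<in>set ys. admissible \<rho> (fst p) \<and> (\<forall>s. \<bar>Re (snd p s)\<bar> \<le> \<rho> s \<and> \<bar>Im (snd p s)\<bar> \<le> \<rho> s)"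
  proof (intro ballI)
    fix p assume "p \<in> set ys"
    then obtain p' q where p: "p' \<in> set xs" "q \<in> set (H (fst p'))" "p = (fst q, (snd p')(s := snd q))"
      by (auto simp: ys_def K_def)
    show "admissible \<rho> (fst p) \<and> (\<forall>s. \<bar>Re (snd p s)\<bar> \<le> \<rho> s \<and> \<bar>Im (snd p s)\<bar> \<le> \<rho> s)"
      using H(1)[OF xs(1)[OF p(1)] p(2)] xs(2)[OF p(1)] by (simp add: p(3))
  qed
  moreover have "(\<Sum>p\<leftarrow>ys. fst p t) = \<phi> t" for t
  proof -
    have "(\<Sum>p\<leftarrow>ys. fst p t) = (\<Sum>p\<leftarrow>xs. fst p t)"
      unfolding ys_def sum_list_refine
      by (intro arg_cong[where f = sum_list] map_cong refl) (simp add: K_def o_def Hsum)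
    then show ?thesis using xs(3) by simp
  qed
  moreover have "(\<Sum>p\<leftarrow>ys. Re (pdist s (snd p s) (fst p))) \<le> \<epsilon>"
  proof -
    have "(\<Sum>p\<leftarrow>ys. Re (pdist s (snd p s) (fst p))) \<le> (\<Sum>p\<leftarrow>xs. \<delta> * Re (fst p 1))"
      unfolding ys_def sum_list_refine
      by (intro sum_list_mono) (simp add: K_def o_def H(3) xs(1))
    also have "\<dots> = \<delta> * Re (\<Sum>p\<leftarrow>xs. fst p 1)"
      by (induction xs) (simp_all add: algebra_simps)
    finally show ?thesis using xs(3) \<delta>(2) by simp
  qed
  moreover have "(\<Sum>p\<leftarrow>ys. Re (pdist t (snd p t) (fst p))) \<le> \<epsilon>" if t: "t \<in> F" for t
  proof -
    have ts: "t \<noteq> s" using t insert.hyps by blast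
    have "(\<Sum>q\<leftarrow>K p. Re (pdist t (snd q t) (fst q))) = Re (pdist t (snd p t) (fst p))" if p: "p \<in> set xs" for p
    proof -
      have "(\<Sum>q\<leftarrow>K p. Re (pdist t (snd q t) (fst q))) = Re (\<Sum>q\<leftarrow>H (fst p). pdist t (snd p t) (fst q))"
      proof -
        have "(\<Sum>q\<leftarrow>map (\<lambda>q. (fst q, (snd p)(s := snd q))) qs. Re (pdist t (snd q t) (fst q)))
           = Re (\<Sum>q\<leftarrow>qs. pdist t (snd p t) (fst q))" for qs
          using ts by (induction qs) simp_all
        then show ?thesis unfolding K_def .
      qed
      then show ?thesis unfolding pdist_sum using Hsum[OF p] by simp
    qed
    then have "(\<Sum>p\<leftarrow>ys. Re (pdist t (snd p t) (fst p))) = (\<Sum>p\<leftarrow>xs. Re (pdist t (snd p t) (fst p)))"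
      unfolding ys_def sum_list_refine by (intro arg_cong[where f = sum_list] map_cong refl)
    then show ?thesis using xs(4)[OF t] by simp
  qed
  ultimately show ?case by (intro exI[of _ ys]) simp
qed

text \<open>Cauchy-Schwarz for the vectors \<open>s - z\<close> and \<open>t\<^sup>*\<close>, linearized by the inequality of arithmetic and
  geometric means so that it can be summed over a splitting.\<close>

lemma pdist_estimate:
  assumes "psd \<psi>" and \<delta>: "\<delta> > 0"
  shows "2 * cmod (\<psi> (s * t) - z * \<psi> t) \<le> Re (pdist s z \<psi>) / \<delta> + \<delta> * Re (\<psi> (t * star t))"
proof -
  define B where "B = \<psi> (star s * star t) - cnj z * \<psi> (star t)"
  define B' where "B' = \<psi> (t * s) - z * \<psi> t"
  have "a * cnj a * pdist s z \<psi> + a * cnj b * B + b * cnj a * B' + b * cnj b * \<psi> (t * star t) \<in> \<real>\<^sub>\<ge>\<^sub>0" for a b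
  proof -
    have "(\<Sum>i\<in>{0,1,2::nat}. \<Sum>j\<in>{0,1,2::nat}.
        (case i of 0 \<Rightarrow> a | Suc 0 \<Rightarrow> - a * cnj z | _ \<Rightarrow> b) *
        cnj (case j of 0 \<Rightarrow> a | Suc 0 \<Rightarrow> - a * cnj z | _ \<Rightarrow> b) *
        \<psi> (star (case i of 0 \<Rightarrow> s | Suc 0 \<Rightarrow> 1 | _ \<Rightarrow> star t) * (case j of 0 \<Rightarrow> s | Suc 0 \<Rightarrow> 1 | _ \<Rightarrow> star t)))
        \<in> \<real>\<^sub>\<ge>\<^sub>0"
      by (rule psd_finite_index[OF assms(1)]) simp
    then show ?thesis
      by (simp add: pdist_def B_def B'_def numeral_2_eq_2 algebra_simps)
  qed
  note form = hermitian_form2[OF this]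
  have "(2 * cmod B')\<^sup>2 \<le> 4 * (Re (pdist s z \<psi>) * Re (\<psi> (t * star t)))"
    using form(3,4) by (simp add: power2_eq_square)
  also have "\<dots> \<le> (Re (pdist s z \<psi>) / \<delta> + \<delta> * Re (\<psi> (t * star t)))\<^sup>2"
  proof -
    have "0 \<le> (Re (pdist s z \<psi>) / \<delta> - \<delta> * Re (\<psi> (t * star t)))\<^sup>2" by simp
    then show ?thesis using \<delta> by (simp add: power2_eq_square algebra_simps)
  qed
  finally have "2 * cmod B' \<le> Re (pdist s z \<psi>) / \<delta> + \<delta> * Re (\<psi> (t * star t))"
    using form(1,2) \<delta> by (intro power2_le_imp_le[of "2 * cmod B'"]) (auto simp: complex_nonneg_Reals_iff)
  then show ?thesis by (simp add: B'_def mult.commute)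
qed

text \<open>With \<open>t = 1\<close> the estimate says that \<open>\<psi> s\<close> is close to \<open>z s * \<psi> 1\<close>; together with general \<open>t\<close> this makes
  \<open>z\<close> approximately multiplicative wherever \<open>\<psi> 1\<close> is not negligible.\<close>

lemma approximate_characters:
  assumes adm: "admissible \<rho> \<phi>" and \<rho>: "\<And>s. \<rho> s > 0" and fin: "finite F" and \<eta>: "\<eta> > 0"
  shows "\<exists>xs. (\<forall>p\<in>set xs. psd (fst p) \<and> (\<forall>s. \<bar>Re (snd p s)\<bar> \<le> \<rho> s \<and> \<bar>Im (snd p s)\<bar> \<le> \<rho> s))
    \<and> (\<forall>t. (\<Sum>p\<leftarrow>xs. fst p t) = \<phi> t)
    \<and> (\<forall>s\<in>F. \<forall>t\<in>F. (\<Sum>p\<leftarrow>xs. cmod (fst p (s * t) - snd p s * fst p t)) \<le> \<eta>)"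
proof -
  have psd: "psd \<phi>" using adm by (simp add: admissible_def)
  have nn: "Re (\<phi> (t * star t)) \<ge> 0" for t
    using psd_diagonal[OF psd] by (simp add: complex_nonneg_Reals_iff)
  define M where "M = (\<Sum>t\<in>F. Re (\<phi> (t * star t)))"
  have M: "Re (\<phi> (t * star t)) \<le> M" if "t \<in> F" for t
    unfolding M_def using that fin nn by (intro member_le_sum) auto
  have M0: "M \<ge> 0" unfolding M_def using nn by (intro sum_nonneg) auto
  \<comment> \<open>A total squared deviation of at most \<open>\<eta> \<delta>\<close> makes both terms of \<open>pdist_estimate\<close> at most \<open>\<eta>\<close>.\<close>
  define \<delta> where "\<delta> = \<eta> / (M + 1)"
  have \<delta>: "\<delta> > 0" "\<delta> * M \<le> \<eta>" using \<eta> M0 by (auto simp: \<delta>_def field_simps)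
  obtain xs where "(\<forall>p\<in>set xs. admissible \<rho> (fst p) \<and> (\<forall>s. \<bar>Re (snd p s)\<bar> \<le> \<rho> s \<and> \<bar>Im (snd p s)\<bar> \<le> \<rho> s))
    \<and> (\<forall>t. (\<Sum>p\<leftarrow>xs. fst p t) = \<phi> t)
    \<and> (\<forall>s\<in>F. (\<Sum>p\<leftarrow>xs. Re (pdist s (snd p s) (fst p))) \<le> \<eta> * \<delta>)"
    using finite_split[OF adm \<rho> fin mult_pos_pos[OF \<eta> \<delta>(1)]] by (rule exE)
  then have
    xs: "\<And>p. p \<in> set xs \<Longrightarrow> admissible \<rho> (fst p)"
      "\<And>p s. p \<in> set xs \<Longrightarrow> \<bar>Re (snd p s)\<bar> \<le> \<rho> s \<and> \<bar>Im (snd p s)\<bar> \<le> \<rho> s"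
      "\<And>t. (\<Sum>p\<leftarrow>xs. fst p t) = \<phi> t"
      "\<And>s. s \<in> F \<Longrightarrow> (\<Sum>p\<leftarrow>xs. Re (pdist s (snd p s) (fst p))) \<le> \<eta> * \<delta>"
    by (elim conjE, blast)+
  have "(\<Sum>p\<leftarrow>xs. cmod (fst p (s * t) - snd p s * fst p t)) \<le> \<eta>" if s: "s \<in> F" and t: "t \<in> F" for s t
  proof -
    have "2 * (\<Sum>p\<leftarrow>xs. cmod (fst p (s * t) - snd p s * fst p t))
       = (\<Sum>p\<leftarrow>xs. 2 * cmod (fst p (s * t) - snd p s * fst p t))"
      by (simp add: sum_list_const_mult)
    also have "\<dots> \<le> (\<Sum>p\<leftarrow>xs. Re (pdist s (snd p s) (fst p)) / \<delta> + \<delta> * Re (fst p (t * star t)))"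
      using xs(1) \<delta>(1) by (intro sum_list_mono pdist_estimate) (auto simp: admissible_def)
    also have "\<dots> = (\<Sum>p\<leftarrow>xs. Re (pdist s (snd p s) (fst p))) / \<delta> + \<delta> * Re (\<Sum>p\<leftarrow>xs. fst p (t * star t))"
      by (induction xs) (simp_all add: algebra_simps add_divide_distrib)
    also have "\<dots> \<le> \<eta> + \<delta> * M"
      using xs(4)[OF s] \<delta>(1) M[OF t] by (intro add_mono) (auto simp: xs(3) field_simps)
    finally show ?thesis using \<delta>(2) by simp
  qed
  then show ?thesis using xs(1-3) by (intro exI[of _ xs]) (auto simp: admissible_def)
qed

end

section \<open>Radon measures from finitely additive set functions\<close>


text \<open>The separation axiom is a hypothesis on the topology rather than a class constraint, so that
  the results apply to full function spaces.\<close>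

lemma hausdorff_compact_closed:
  assumes "Hausdorff_space (euclidean :: 'x::topological_space topology)" and "compact (C :: 'x set)"
  shows "closed C"
  using compactin_imp_closedin[of euclidean C] assms by simp

lemma hausdorff_compact_borel:
  assumes "Hausdorff_space (euclidean :: 'x::topological_space topology)" and "compact (C :: 'x set)"
  shows "C \<in> sets borel"
  using hausdorff_compact_closed[OF assms] by simp

text \<open>The disjoint compact sets \<open>C - U\<close> and \<open>C - V\<close> have disjoint open neighbourhoods, and removing
  either of these from \<open>C\<close> leaves one of the two pieces.\<close>

lemma compact_split_open_cover:
  fixes C :: "'x::topological_space set"
  assumes haus: "Hausdorff_space (euclidean :: 'x topology)"
    and C: "compact C" and UV: "open U" "open V" "C \<subseteq> U \<union> V"
  obtains C1 C2 where "compact C1" "compact C2" "C1 \<subseteq> U" "C2 \<subseteq> V" "C = C1 \<union> C2"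
proof -
  have "disjnt (C - U) (C - V)" using UV by (auto simp: disjnt_def)
  then obtain P Q where PQ: "open P" "open Q" "C - U \<subseteq> P" "C - V \<subseteq> Q" "disjnt P Q"
    using Hausdorff_space_compact_separation[OF haus, of "C - U" "C - V"] C UV
    by (auto intro: compact_diff)
  show ?thesis
    by (rule that[of "C - P" "C - Q"]) (use C PQ in \<open>auto simp: disjnt_def intro: compact_diff\<close>)
qed

lemma ennreal_add_SUP_le:
  fixes f :: "'i \<Rightarrow> ennreal"
  assumes "I \<noteq> {}" and "\<And>i. i \<in> I \<Longrightarrow> a + f i \<le> x"
  shows "a + (SUP i\<in>I. f i) \<le> x"
proof (cases "x = top")
  case False
  obtain i0 where i0: "i0 \<in> I" using assms(1) by blast
  have "a \<le> a + f i0" by simp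
  also have "\<dots> \<le> x" by (rule assms(2)[OF i0])
  finally have "a \<le> x" .
  then have a: "a \<noteq> top" using False by (auto simp: top_unique)
  have "f i \<le> x - a" if "i \<in> I" for i
    using assms(2)[OF that] a by (metis add.commute ennreal_le_minus_iff)
  then have "(SUP i\<in>I. f i) \<le> x - a" by (rule SUP_least)
  then have "a + (SUP i\<in>I. f i) \<le> a + (x - a)" by (rule add_left_mono)
  also have "\<dots> = x" using \<open>a \<le> x\<close> by (simp add: add_diff_inverse_ennreal)
  finally show ?thesis .
qed simp

text \<open>A finitely additive set function on all subsets, concentrated on a compact set. In general it is
  far from being regular; only its values on compact sets are kept.\<close>

locale finitely_additive =
  fixes m :: "'x::topological_space set \<Rightarrow> real" and Z :: "'x set"
  assumes hausdorff: "Hausdorff_space (euclidean :: 'x topology)"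
    and compact_Z: "compact Z"
    and nonneg: "\<And>A. 0 \<le> m A"
    and additive: "\<And>A B. A \<inter> B = {} \<Longrightarrow> m (A \<union> B) = m A + m B"
    and outside: "m (- Z) = 0"
begin

lemma content_mono: "A \<subseteq> B \<Longrightarrow> m A \<le> m B"
  using additive[of A "B - A"] nonneg[of "B - A"] by (simp add: Un_absorb1)

lemma subadditive: "m (A \<union> B) \<le> m A + m B"
  using additive[of A "B - A"] content_mono[of "B - A" B] by simp

lemma content_empty: "m {} = 0"
  using additive[of "{}" "{}"] by simp

definition inner_content :: "'x set \<Rightarrow> ennreal" where
  "inner_content U = (SUP C\<in>{C. compact C \<and> C \<subseteq> U}. ennreal (m C))"

definition outer_content :: "'x set \<Rightarrow> ennreal" where
  "outer_content A = (INF U\<in>{U. open U \<and> A \<subseteq> U}. inner_content U)"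

lemma inner_content_upper: "compact C \<Longrightarrow> C \<subseteq> U \<Longrightarrow> ennreal (m C) \<le> inner_content U"
  unfolding inner_content_def by (auto intro!: SUP_upper)

lemma inner_content_mono: "U \<subseteq> V \<Longrightarrow> inner_content U \<le> inner_content V"
  unfolding inner_content_def by (intro SUP_subset_mono) auto

lemma inner_content_le: "inner_content U \<le> ennreal (m U)"
  unfolding inner_content_def by (intro SUP_least) (auto intro!: ennreal_leI content_mono)

lemma outer_content_open: "open U \<Longrightarrow> outer_content U = inner_content U"
  unfolding outer_content_def by (intro antisym INF_lower INF_greatest) (auto intro!: inner_content_mono)

lemma outer_content_mono: "A \<subseteq> B \<Longrightarrow> outer_content A \<le> outer_content B"
  unfolding outer_content_def by (intro INF_superset_mono) auto

lemma outer_content_finite: "outer_content A \<noteq> \<infinity>"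
proof -
  have "outer_content A \<le> ennreal (m UNIV)"
    using outer_content_mono[of A UNIV] outer_content_open[of UNIV] inner_content_le[of UNIV] by simp
  then show ?thesis by (auto simp: top_unique)
qed

lemma outer_content_approx:
  assumes "e > 0"
  shows "\<exists>U. open U \<and> A \<subseteq> U \<and> inner_content U \<le> outer_content A + ennreal e"
proof -
  have "\<exists>U\<in>{U. open U \<and> A \<subseteq> U}. inner_content U < outer_content A + ennreal e"
    by (rule INF_approx_ennreal[OF assms outer_content_def outer_content_finite])
  then show ?thesis by (blast intro: less_imp_le)
qed

lemma inner_content_Un: "open U \<Longrightarrow> open V \<Longrightarrow> inner_content (U \<union> V) \<le> inner_content U + inner_content V"
proof -
  assume UV: "open U" "open V"
  show ?thesis
    unfolding inner_content_def[of "U \<union> V"]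
  proof (intro SUP_least, clarify)
    fix C assume C: "compact C" "C \<subseteq> U \<union> V"
    obtain C1 C2 where *: "compact C1" "compact C2" "C1 \<subseteq> U" "C2 \<subseteq> V" "C = C1 \<union> C2"
      using compact_split_open_cover[OF hausdorff C(1) UV C(2)] .
    have "ennreal (m C) \<le> ennreal (m C1) + ennreal (m C2)"
      using subadditive[of C1 C2] nonneg by (simp add: *(5) flip: ennreal_plus)
    also have "\<dots> \<le> inner_content U + inner_content V"
      using * by (intro add_mono inner_content_upper)
    finally show "ennreal (m C) \<le> inner_content U + inner_content V" .
  qed
qed

lemma inner_content_UN_finite:
  "finite I \<Longrightarrow> (\<And>i. i \<in> I \<Longrightarrow> open (U i)) \<Longrightarrow> inner_content (\<Union>i\<in>I. U i) \<le> (\<Sum>i\<in>I. inner_content (U i))"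
proof (induction I rule: finite_induct)
  case empty
  then show ?case using inner_content_le[of "{}"] by (simp add: content_empty flip: bot_ennreal)
next
  case (insert i I)
  have "inner_content (\<Union>i\<in>insert i I. U i) \<le> inner_content (U i) + inner_content (\<Union>i\<in>I. U i)"
    using inner_content_Un[of "U i" "\<Union>i\<in>I. U i"] insert.prems by auto
  also have "\<dots> \<le> inner_content (U i) + (\<Sum>i\<in>I. inner_content (U i))"
    using insert by (intro add_left_mono) auto
  finally show ?case using insert by simp
qed

text \<open>A compact subset of the union is already covered by finitely many members, which reduces countable
  to finite subadditivity.\<close>

lemma inner_content_UN:
  fixes U :: "nat \<Rightarrow> 'x set"
  assumes "\<And>i. open (U i)"
  shows "inner_content (\<Union>i. U i) \<le> (\<Sum>i. inner_content (U i))"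
  unfolding inner_content_def[of "\<Union>i. U i"]
proof (intro SUP_least, clarify)
  fix C assume C: "compact C" "C \<subseteq> (\<Union>i. U i)"
  obtain I where I: "finite I" "C \<subseteq> (\<Union>i\<in>I. U i)"
    using compactE_image[OF C(1), of UNIV U] assms C(2) by (metis top_greatest)
  have "ennreal (m C) \<le> inner_content (\<Union>i\<in>I. U i)" using C(1) I(2) by (rule inner_content_upper)
  also have "\<dots> \<le> (\<Sum>i\<in>I. inner_content (U i))" using I(1) assms by (intro inner_content_UN_finite) auto
  also have "\<dots> \<le> (\<Sum>i. inner_content (U i))" using I(1) by (intro sum_le_suminf) auto
  finally show "ennreal (m C) \<le> (\<Sum>i. inner_content (U i))" .
qed

lemma outer_measure_outer_content: "outer_measure_space UNIV outer_content"
  unfolding outer_measure_space_def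
proof (intro conjI)
  show "positive UNIV outer_content"
    using outer_content_open[of "{}"] inner_content_le[of "{}"] by (simp add: positive_def content_empty)
  show "increasing UNIV outer_content"
    by (simp add: increasing_def outer_content_mono)
  show "countably_subadditive UNIV outer_content"
    unfolding countably_subadditive_def
  proof (intro allI impI)
    fix A :: "nat \<Rightarrow> 'x set"
    show "outer_content (\<Union>i. A i) \<le> (\<Sum>i. outer_content (A i))"
    proof (rule ennreal_le_epsilon)
      fix e :: real assume e: "e > 0"
      have "\<exists>U. open U \<and> A n \<subseteq> U \<and> inner_content U \<le> outer_content (A n) + ennreal (e * (1/2) ^ Suc n)" for n
        by (rule outer_content_approx) (use e in simp)
      then obtain U where U: "\<And>n. open (U n)" "\<And>n. A n \<subseteq> U n"
        "\<And>n. inner_content (U n) \<le> outer_content (A n) + ennreal (e * (1/2) ^ Suc n)"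
        by metis
      have "outer_content (\<Union>i. A i) \<le> outer_content (\<Union>i. U i)"
        using U(2) by (intro outer_content_mono) blast
      also have "\<dots> = inner_content (\<Union>i. U i)"
        using U(1) by (intro outer_content_open) auto
      also have "\<dots> \<le> (\<Sum>i. inner_content (U i))"
        using U(1) by (rule inner_content_UN)
      also have "\<dots> \<le> (\<Sum>n. outer_content (A n) + ennreal (e * (1/2) ^ Suc n))"
        by (intro suminf_le U(3) summableI)
      also have "\<dots> = (\<Sum>n. outer_content (A n)) + (\<Sum>n. ennreal e * ennreal ((1/2) ^ Suc n))"
        using e by (subst suminf_add[symmetric])
                       (auto simp del: ennreal_suminf_cmult simp add: ennreal_mult[symmetric])
      also have "\<dots> = (\<Sum>n. outer_content (A n)) + ennreal e"
        unfolding ennreal_suminf_cmult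
        by (subst suminf_ennreal_eq[OF zero_le_power power_half_series]) auto
      finally show "outer_content (\<Union>i. A i) \<le> (\<Sum>n. outer_content (A n)) + ennreal e" .
    qed
  qed
qed

text \<open>Caratheodory's criterion for open sets. A compact \<open>C\<close> inside \<open>W \<inter> U\<close> and a compact subset of
  \<open>W - C\<close> are disjoint, so the additivity of \<open>m\<close> applies; and \<open>W - C\<close> is an open set containing
  \<open>W - U\<close>.\<close>

lemma open_outer_split:
  assumes U: "open U"
  shows "outer_content (A \<inter> U) + outer_content (A - U) \<le> outer_content A"
  unfolding outer_content_def[of A]
proof (intro INF_greatest, clarify)
  fix W assume W: "open W" "A \<subseteq> W"
  have 1: "ennreal (m C) + inner_content (W - C) \<le> inner_content W" if C: "compact C" "C \<subseteq> W \<inter> U" for C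
    unfolding inner_content_def[of "W - C"]
  proof (rule ennreal_add_SUP_le)
    fix D assume "D \<in> {D. compact D \<and> D \<subseteq> W - C}"
    then have D: "compact D" "D \<subseteq> W - C" by auto
    have "C \<inter> D = {}" using D by blast
    have "ennreal (m C) + ennreal (m D) = ennreal (m (C \<union> D))"
      using additive[OF \<open>C \<inter> D = {}\<close>] nonneg by (simp flip: ennreal_plus)
    also have "\<dots> \<le> inner_content W" using C D by (intro inner_content_upper) auto
    finally show "ennreal (m C) + ennreal (m D) \<le> inner_content W" .
  qed auto
  have 2: "outer_content (W - U) \<le> inner_content (W - C)" if C: "compact C" "C \<subseteq> W \<inter> U" for C
  proof -
    have "open (W - C)" using W(1) C(1) by (intro open_Diff hausdorff_compact_closed[OF hausdorff])
    then have "outer_content (W - C) = inner_content (W - C)" by (rule outer_content_open)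
    then show ?thesis using outer_content_mono[of "W - U" "W - C"] C by auto
  qed
  have 3: "outer_content (W - U) + ennreal (m C) \<le> inner_content W" if C: "compact C" "C \<subseteq> W \<inter> U" for C
  proof -
    have "outer_content (W - U) + ennreal (m C) \<le> inner_content (W - C) + ennreal (m C)"
      by (intro add_right_mono 2 C)
    also have "\<dots> \<le> inner_content W" using 1[OF C] by (simp add: add.commute)
    finally show ?thesis .
  qed
  have "outer_content (W - U) + inner_content (W \<inter> U) \<le> inner_content W"
    unfolding inner_content_def[of "W \<inter> U"] by (rule ennreal_add_SUP_le) (auto simp: 3)
  moreover have "outer_content (A \<inter> U) \<le> inner_content (W \<inter> U)"
  proof -
    have "outer_content (A \<inter> U) \<le> outer_content (W \<inter> U)"
      using W by (intro outer_content_mono) auto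
    also have "\<dots> = inner_content (W \<inter> U)"
      using W U by (intro outer_content_open open_Int)
    finally show ?thesis .
  qed
  moreover have "outer_content (A - U) \<le> outer_content (W - U)"
    using W by (intro outer_content_mono) auto
  ultimately have "outer_content (A - U) + outer_content (A \<inter> U) \<le> inner_content W"
    by (meson add_mono order_trans)
  then show "outer_content (A \<inter> U) + outer_content (A - U) \<le> inner_content W"
    by (simp add: add.commute)
qed

definition extension :: "'x measure" where
  "extension = measure_of UNIV (sets borel) outer_content"

lemma sets_extension [simp, measurable_cong]: "sets extension = sets borel"
  using sets.sigma_sets_eq[of "borel :: 'x measure"] by (simp add: extension_def)

lemma space_extension [simp]: "space extension = UNIV"
  by (simp add: extension_def)

lemma emeasure_extension:
  assumes "A \<in> sets borel"
  shows "emeasure extension A = outer_content A"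
proof -
  interpret sigma_algebra UNIV "UNIV :: 'x set set"
    using sigma_algebra_Pow[of UNIV] by simp
  let ?L = "lambda_system UNIV UNIV outer_content"
  have ms: "measure_space UNIV ?L outer_content"
    using caratheodory_lemma[OF outer_measure_outer_content] .
  interpret oms: sigma_algebra UNIV ?L
    using ms by (simp add: measure_space_def)
  have "U \<in> ?L" if "open U" for U
  proof -
    have "outer_content (x \<inter> U) + outer_content (x - U) = outer_content x" for x
    proof (rule antisym)
      show "outer_content (x \<inter> U) + outer_content (x - U) \<le> outer_content x" by (rule open_outer_split[OF that])
      have sub: "subadditive UNIV outer_content"
        using outer_measure_outer_content
        by (auto simp: outer_measure_space_def positive_def intro: countably_subadditive_subadditive)
      have "outer_content ((x \<inter> U) \<union> (x - U)) \<le> outer_content (x \<inter> U) + outer_content (x - U)"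
        using sub by (intro subadditiveD) auto
      then show "outer_content x \<le> outer_content (x \<inter> U) + outer_content (x - U)"
        by (simp add: Int_Diff_Un)
    qed
    then show ?thesis by (simp add: lambda_system_eq)
  qed
  then have "sigma_sets UNIV {S. open S} \<subseteq> ?L"
    by (intro oms.sigma_sets_subset) auto
  then have sub: "sets borel \<subseteq> ?L"
    by (simp add: borel_def)
  have "countably_additive ?L outer_content" "positive ?L outer_content"
    using ms by (auto simp: measure_space_def)
  then have "countably_additive (sets borel) outer_content" "positive (sets borel) outer_content"
    using sub by (auto simp: countably_additive_def positive_def subset_eq)
  then show ?thesis
    using assms by (intro emeasure_measure_of[OF extension_def]) auto
qed

lemma emeasure_extension_UNIV: "emeasure extension UNIV = ennreal (m UNIV)"
proof -
  have "m UNIV = m Z"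
    using additive[of Z "- Z"] outside by simp
  then show ?thesis
    using inner_content_upper[OF compact_Z, of UNIV] inner_content_le[of UNIV]
    by (simp add: emeasure_extension outer_content_open)
qed

lemma emeasure_extension_outside: "emeasure extension (- Z) = 0"
  using inner_content_le[of "- Z"] outside hausdorff_compact_closed[OF hausdorff compact_Z]
  by (simp add: emeasure_extension outer_content_open open_Compl)

text \<open>Regularization can only increase the value at a compact set. Since the total mass is preserved,
  this one-sided comparison determines the integrals of continuous functions.\<close>

lemma content_le_emeasure_extension:
  assumes "compact K"
  shows "ennreal (m K) \<le> emeasure extension K"
  using assms
  by (auto simp: emeasure_extension hausdorff_compact_borel[OF hausdorff] outer_content_def intro!: INF_greatest inner_content_upper)

lemma finite_measure_extension: "finite_measure extension"
  by (rule finite_measureI) (simp add: emeasure_extension_UNIV)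

text \<open>Outer regularity, which holds by construction, is applied to the complement in \<open>Z\<close>.\<close>

lemma inner_regular_extension:
  assumes B: "B \<in> sets borel"
  shows "emeasure extension B = (SUP K\<in>{K. compact K \<and> K \<subseteq> B}. emeasure extension K)"
proof (rule ennreal_approx_SUP[where f = "emeasure extension" and x = "emeasure extension B" and A = "{K. compact K \<and> K \<subseteq> B}"])
  show "emeasure extension K \<le> emeasure extension B" if "K \<in> {K. compact K \<and> K \<subseteq> B}" for K
    using that B by (auto intro: emeasure_mono)
next
  fix e :: real assume e: "e > 0"
  interpret finite_measure extension by (rule finite_measure_extension)
  have Zb: "Z \<in> sets borel" using compact_Z by (rule hausdorff_compact_borel[OF hausdorff])
  obtain U where U: "open U" "Z - B \<subseteq> U" "inner_content U \<le> outer_content (Z - B) + ennreal e"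
    using outer_content_approx[OF e] by blast
  have K: "compact (Z - U)" "Z - U \<subseteq> B" using compact_Z U by (auto intro: compact_diff)
  have Kb: "Z - U \<in> sets borel" using K(1) by (rule hausdorff_compact_borel[OF hausdorff])
  have "emeasure extension (Z - B) + emeasure extension (B \<inter> Z) = emeasure extension Z"
    using B Zb by (subst plus_emeasure) (auto intro!: arg_cong[where f = "emeasure extension"])
  also have "\<dots> \<le> emeasure extension ((Z - U) \<union> U)"
    using Zb U(1) by (intro emeasure_mono) auto
  also have "\<dots> \<le> emeasure extension (Z - U) + emeasure extension U"
    using Kb U(1) by (intro emeasure_subadditive) auto
  also have "emeasure extension U \<le> emeasure extension (Z - B) + ennreal e"
    using U B Zb by (simp add: emeasure_extension outer_content_open)
  finally have "emeasure extension (Z - B) + emeasure extension (B \<inter> Z)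
      \<le> emeasure extension (Z - B) + (emeasure extension (Z - U) + ennreal e)"
    by (simp add: ac_simps)
  then have *: "emeasure extension (B \<inter> Z) \<le> emeasure extension (Z - U) + ennreal e"
    by (simp add: ennreal_add_left_cancel_le)
  have "emeasure extension B \<le> emeasure extension ((B \<inter> Z) \<union> - Z)"
    using B Zb by (intro emeasure_mono) auto
  also have "\<dots> \<le> emeasure extension (B \<inter> Z) + emeasure extension (- Z)"
    using B Zb by (intro emeasure_subadditive) auto
  finally show "\<exists>K\<in>{K. compact K \<and> K \<subseteq> B}. emeasure extension B \<le> emeasure extension K + ennreal e"
    using K * by (intro bexI[of _ "Z - U"]) (auto simp: emeasure_extension_outside)
qed

end

section \<open>Positive functionals on bounded functions\<close>


definition positive_functional :: "'x set \<Rightarrow> (('x \<Rightarrow> real) \<Rightarrow> real) \<Rightarrow> bool" where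
  "positive_functional Z \<Lambda> \<longleftrightarrow>
     (\<forall>g h. bounded (g ` Z) \<longrightarrow> bounded (h ` Z) \<longrightarrow> \<Lambda> (\<lambda>x. g x + h x) = \<Lambda> g + \<Lambda> h) \<and>
     (\<forall>c g. bounded (g ` Z) \<longrightarrow> \<Lambda> (\<lambda>x. c * g x) = c * \<Lambda> g) \<and>
     (\<forall>g. bounded (g ` Z) \<longrightarrow> (\<forall>z\<in>Z. 0 \<le> g z) \<longrightarrow> 0 \<le> \<Lambda> g)"

lemma positive_functionalD:
  assumes "positive_functional Z \<Lambda>"
  shows "bounded (g ` Z) \<Longrightarrow> bounded (h ` Z) \<Longrightarrow> \<Lambda> (\<lambda>x. g x + h x) = \<Lambda> g + \<Lambda> h"
    and "bounded (g ` Z) \<Longrightarrow> \<Lambda> (\<lambda>x. c * g x) = c * \<Lambda> g"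
    and "bounded (g ` Z) \<Longrightarrow> (\<And>z. z \<in> Z \<Longrightarrow> 0 \<le> g z) \<Longrightarrow> 0 \<le> \<Lambda> g"
  using assms unfolding positive_functional_def by blast+

lemma bounded_image_add:
  fixes g h :: "'x \<Rightarrow> real"
  assumes "bounded (g ` Z)" "bounded (h ` Z)"
  shows "bounded ((\<lambda>x. g x + h x) ` Z)"
  using assms by (rule bounded_plus_comp)

lemma bounded_image_cmult:
  fixes g :: "'x \<Rightarrow> real"
  assumes "bounded (g ` Z)"
  shows "bounded ((\<lambda>x. c * g x) ` Z)"
proof -
  have "bounded ((\<lambda>y. c * y) ` g ` Z)"
    by (intro bounded_linear_image[OF assms] bounded_linear_mult_right)
  then show ?thesis by (simp add: image_image)
qed

lemma bounded_image_const: "bounded ((\<lambda>x. c :: real) ` Z)"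
  by (rule boundedI[of _ "\<bar>c\<bar>"]) auto

lemma bounded_image_indicator: "bounded ((indicator A :: 'x \<Rightarrow> real) ` Z)"
  by (rule boundedI[of _ 1]) (auto simp: indicator_def)

lemma bounded_image_sum:
  fixes g :: "'i \<Rightarrow> 'x \<Rightarrow> real"
  assumes "\<And>i. i \<in> I \<Longrightarrow> bounded (g i ` Z)"
  shows "bounded ((\<lambda>x. \<Sum>i\<in>I. g i x) ` Z)"
  using assms
proof (induction I rule: infinite_finite_induct)
  case (insert i I)
  then show ?case using bounded_image_add[of "g i" Z "\<lambda>x. \<Sum>i\<in>I. g i x"] by simp
qed (auto simp: bounded_image_const)

lemma positive_functional_sum:
  assumes \<Lambda>: "positive_functional Z \<Lambda>" and "\<And>i. i \<in> I \<Longrightarrow> bounded (g i ` Z)"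
  shows "\<Lambda> (\<lambda>x. \<Sum>i\<in>I. g i x) = (\<Sum>i\<in>I. \<Lambda> (g i))"
proof -
  have 0: "\<Lambda> (\<lambda>x. 0) = 0"
    using positive_functionalD(2)[OF \<Lambda>, of "\<lambda>x. 0" 0] by (simp add: bounded_image_const)
  show ?thesis
    using assms(2)
  proof (induction I rule: infinite_finite_induct)
    case (insert i I)
    then show ?case
      using positive_functionalD(1)[OF \<Lambda>, of "g i" "\<lambda>x. \<Sum>i\<in>I. g i x"] bounded_image_sum[of I g Z] by simp
  qed (simp_all add: 0)
qed

lemma positive_functional_mono:
  assumes \<Lambda>: "positive_functional Z \<Lambda>" and "bounded (g ` Z)" "bounded (h ` Z)"
    and "\<And>z. z \<in> Z \<Longrightarrow> g z \<le> h z"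
  shows "\<Lambda> g \<le> \<Lambda> h"
proof -
  have b: "bounded ((\<lambda>x. - 1 * g x) ` Z)" by (rule bounded_image_cmult[OF assms(2)])
  have "0 \<le> \<Lambda> (\<lambda>x. h x + - 1 * g x)"
    using assms(4) by (intro positive_functionalD(3)[OF \<Lambda>] bounded_image_add b assms(3)) auto
  also have "\<dots> = \<Lambda> h + - 1 * \<Lambda> g"
    using positive_functionalD(1)[OF \<Lambda> assms(3) b] positive_functionalD(2)[OF \<Lambda> assms(2), of "- 1"] by simp
  finally show ?thesis by simp
qed

text \<open>A number in the unit interval is approximated from below by the number of thresholds \<open>k/n\<close> that it
  reaches. For a function this expresses it by indicators of its superlevel sets.\<close>

lemma staircase_bounds:
  fixes y :: real
  assumes "0 \<le> y" "y \<le> 1" "n > 0"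
  shows "(\<Sum>k=1..n. of_bool (real k / real n \<le> y)) / real n \<le> y"
    and "y \<le> (\<Sum>k=1..n. of_bool (real k / real n \<le> y)) / real n + 1 / real n"
proof -
  have "{k \<in> {1..n}. real k / real n \<le> y} = {1..nat \<lfloor>real n * y\<rfloor>}"
  proof -
    have "k \<le> n" if "real k \<le> real n * y" for k
    proof -
      have "real n * y \<le> real n" using assms by (simp add: mult_left_le)
      then show ?thesis using that by linarith
    qed
    moreover have "real k / real n \<le> y \<longleftrightarrow> k \<le> nat \<lfloor>real n * y\<rfloor>" for k
    proof -
      have "0 \<le> real n * y" using assms by simp
      then have "real k \<le> real n * y \<longleftrightarrow> k \<le> nat \<lfloor>real n * y\<rfloor>" by linarith
      then show ?thesis using assms by (simp add: field_simps)
    qed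
    moreover have "real k / real n \<le> y \<longleftrightarrow> real k \<le> real n * y" for k
      using assms by (simp add: field_simps)
    ultimately show ?thesis by auto
  qed
  then have "(\<Sum>k=1..n. of_bool (real k / real n \<le> y)) = real (nat \<lfloor>real n * y\<rfloor>)"
    by (simp add: sum_of_bool_eq Int_def flip: Collect_conj_eq)
  moreover have "real (nat \<lfloor>real n * y\<rfloor>) \<le> real n * y" "real n * y \<le> real (nat \<lfloor>real n * y\<rfloor>) + 1"
    using assms by (simp_all add: of_nat_nat)
  ultimately show "(\<Sum>k=1..n. of_bool (real k / real n \<le> y)) / real n \<le> y"
    "y \<le> (\<Sum>k=1..n. of_bool (real k / real n \<le> y)) / real n + 1 / real n"
    using assms by (simp_all add: field_simps)
qed

text \<open>For a continuous function with values in the unit interval, the staircase approximation involves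
  only compact superlevel sets, at which the measure dominates the functional; thus the functional
  is at most the integral. Applying this to \<open>1/2 + a g\<close> and \<open>1/2 - a g\<close> for a small \<open>a\<close> gives
  equality for \<open>g\<close>.\<close>

theorem positive_functional_representation:
  fixes Z :: "'x::topological_space set"
  assumes haus: "Hausdorff_space (euclidean :: 'x topology)" and Z: "compact Z" and \<Lambda>: "positive_functional Z \<Lambda>"
  obtains M where "radon_measure euclidean M" "emeasure M (- Z) = 0"
    "\<And>g. continuous_on UNIV g \<Longrightarrow> integrable M g \<and> integral\<^sup>L M g = \<Lambda> g"
proof -
  define m where "m = (\<lambda>A. \<Lambda> (indicator A))"
  interpret finitely_additive m Z
  proof
    show "0 \<le> m A" for A
      unfolding m_def by (intro positive_functionalD(3)[OF \<Lambda>] bounded_image_indicator) simp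
    show "m (A \<union> B) = m A + m B" if "A \<inter> B = {}" for A B
    proof -
      have "(indicator (A \<union> B) :: 'x \<Rightarrow> real) = (\<lambda>x. indicator A x + indicator B x)"
        by (intro ext) (use that in \<open>auto simp: indicator_def\<close>)
      then show ?thesis
        unfolding m_def using positive_functionalD(1)[OF \<Lambda>] bounded_image_indicator by metis
    qed
    have "\<Lambda> (indicator (- Z)) \<le> \<Lambda> (\<lambda>x. 0 * 1)" "\<Lambda> (\<lambda>x. 0 * 1) \<le> \<Lambda> (indicator (- Z))"
      by (intro positive_functional_mono[OF \<Lambda>] bounded_image_indicator bounded_image_const; simp)+
    then show "m (- Z) = 0"
      using positive_functionalD(2)[OF \<Lambda>, of "\<lambda>x. 1" 0] by (simp add: m_def bounded_image_const)
  qed (rule haus, rule Z)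
  let ?M = extension
  interpret M: finite_measure ?M by (rule finite_measure_extension)
  have AE_Z: "AE x in ?M. x \<in> Z"
    by (rule AE_I[of _ _ "- Z"])
       (use hausdorff_compact_closed[OF haus Z] emeasure_extension_outside in \<open>auto simp: open_Compl\<close>)
  have meas: "g \<in> borel_measurable ?M" if "continuous_on UNIV g" for g :: "'x \<Rightarrow> real"
    using borel_measurable_continuous_onI[OF that] by (simp add: measurable_cong_sets[OF sets_extension refl])
  have bdd: "\<exists>B. B > 0 \<and> (\<forall>z\<in>Z. \<bar>g z\<bar> \<le> B)" if "continuous_on UNIV g" for g :: "'x \<Rightarrow> real"
  proof -
    have "bounded (g ` Z)"
      using compact_continuous_image[OF continuous_on_subset[OF that subset_UNIV] Z] by (rule compact_imp_bounded)
    then show ?thesis using bounded_pos[of "g ` Z"] by auto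
  qed
  have int: "integrable ?M g" if g: "continuous_on UNIV g" for g :: "'x \<Rightarrow> real"
  proof -
    obtain B where "B > 0" "\<forall>z\<in>Z. \<bar>g z\<bar> \<le> B" using bdd[OF g] by blast
    then show ?thesis
      using AE_Z meas[OF g] by (intro M.integrable_const_bound[of _ B]) auto
  qed
  have lower: "\<Lambda> g \<le> integral\<^sup>L ?M g"
    if g: "continuous_on UNIV g" and g01: "\<And>z. z \<in> Z \<Longrightarrow> 0 \<le> g z \<and> g z \<le> 1" for g
  proof -
    have gb: "bounded (g ` Z)" by (rule boundedI[of _ 1]) (use g01 in auto)
    have step: "\<Lambda> g \<le> integral\<^sup>L ?M g + \<Lambda> (\<lambda>x. 1) / real n" if n: "n > 0" for n :: nat
    proof -
      define K where "K = (\<lambda>k. Z \<inter> {x. real k / real n \<le> g x})"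
      have "closed {x. real k / real n \<le> g x}" for k
        by (intro closed_Collect_le g continuous_on_const)
      then have K: "compact (K k)" for k
        unfolding K_def using Z by (intro compact_Int_closed)
      define S where "S = (\<lambda>x. (\<Sum>k=1..n. 1 / real n * indicator (K k) x))"
      have Sb: "bounded (S ` Z)"
        unfolding S_def by (intro bounded_image_sum bounded_image_cmult bounded_image_indicator)
      have S_eq: "S z = (\<Sum>k=1..n. of_bool (real k / real n \<le> g z)) / real n" if "z \<in> Z" for z
        using that by (simp add: S_def K_def indicator_def sum_divide_distrib of_bool_def
            cong: if_cong)
      have "\<Lambda> g \<le> \<Lambda> (\<lambda>x. S x + 1 / real n * 1)"
        using staircase_bounds(2)[OF _ _ n] g01
        by (intro positive_functional_mono[OF \<Lambda>] gb bounded_image_add Sb bounded_image_const) (simp add: S_eq)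
      also have "\<dots> = \<Lambda> S + 1 / real n * \<Lambda> (\<lambda>x. 1)"
        using positive_functionalD(1)[OF \<Lambda> Sb bounded_image_const, of "1 / real n * 1"]
          positive_functionalD(2)[OF \<Lambda> bounded_image_const, of "1 / real n" 1] by simp
      also have "\<Lambda> S = (\<Sum>k=1..n. 1 / real n * m (K k))"
        unfolding S_def m_def
        by (simp only: positive_functional_sum[OF \<Lambda> bounded_image_cmult[OF bounded_image_indicator]]
            positive_functionalD(2)[OF \<Lambda> bounded_image_indicator])
      also have "\<dots> \<le> (\<Sum>k=1..n. 1 / real n * measure ?M (K k))"
      proof (intro sum_mono mult_left_mono)
        show "m (K k) \<le> measure ?M (K k)" for k
          using content_le_emeasure_extension[OF K[of k]] nonneg
          by (simp add: M.emeasure_eq_measure)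
      qed auto
      also have "\<dots> = integral\<^sup>L ?M S"
        unfolding S_def using hausdorff_compact_borel[OF haus K]
        by (subst Bochner_Integration.integral_sum)
           (auto intro!: integrable_mult_right integrable_real_indicator simp: M.emeasure_finite less_top[symmetric] M.emeasure_eq_measure)
      also have "\<dots> \<le> integral\<^sup>L ?M g"
      proof (rule integral_mono_AE)
        show "integrable ?M S"
          unfolding S_def using hausdorff_compact_borel[OF haus K]
          by (auto intro!: Bochner_Integration.integrable_sum integrable_mult_right integrable_real_indicator simp: M.emeasure_eq_measure)
        show "AE x in ?M. S x \<le> g x"
          using AE_Z by eventually_elim (use staircase_bounds(1)[OF _ _ n] g01 in \<open>simp add: S_eq\<close>)
      qed (rule int[OF g])
      finally show ?thesis by simp
    qed
    have "(\<lambda>n. integral\<^sup>L ?M g + \<Lambda> (\<lambda>x. 1) / real n) \<longlonglongrightarrow> integral\<^sup>L ?M g + 0"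
      by (intro tendsto_intros lim_const_over_n)
    then have "(\<lambda>n. integral\<^sup>L ?M g + \<Lambda> (\<lambda>x. 1) / real n) \<longlonglongrightarrow> integral\<^sup>L ?M g" by simp
    then show ?thesis
      by (rule LIMSEQ_le_const) (use step in \<open>auto intro!: exI[of _ 1]\<close>)
  qed
  have mass: "integral\<^sup>L ?M (\<lambda>x. 1) = \<Lambda> (\<lambda>x. 1)"
  proof -
    have "(indicator UNIV :: 'x \<Rightarrow> real) = (\<lambda>x. 1)" by auto
    then have "m UNIV = \<Lambda> (\<lambda>x. 1)" by (simp add: m_def)
    moreover have "measure ?M UNIV = m UNIV"
      using emeasure_extension_UNIV nonneg[of UNIV] by (simp add: measure_def)
    ultimately show ?thesis by simp
  qed
  have eq: "integral\<^sup>L ?M g = \<Lambda> g" if g: "continuous_on UNIV g" for g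
  proof -
    obtain B where B: "B > 0" "\<And>z. z \<in> Z \<Longrightarrow> \<bar>g z\<bar> \<le> B" using bdd[OF g] by blast
    have gb: "bounded (g ` Z)" by (rule boundedI[of _ B]) (use B in auto)
    have half: "\<Lambda> (\<lambda>x. 1 / 2 + a * g x) \<le> integral\<^sup>L ?M (\<lambda>x. 1 / 2 + a * g x)" if a: "\<bar>a\<bar> * B = 1 / 2" for a
    proof (rule lower)
      show "continuous_on UNIV (\<lambda>x. 1 / 2 + a * g x)" by (intro continuous_intros g)
      fix z assume "z \<in> Z"
      have "\<bar>a * g z\<bar> \<le> \<bar>a\<bar> * B" using B(2)[OF \<open>z \<in> Z\<close>] by (simp add: abs_mult mult_left_mono)
      then show "0 \<le> 1 / 2 + a * g z \<and> 1 / 2 + a * g z \<le> 1" using a by linarith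
    qed
    have lin: "\<Lambda> (\<lambda>x. 1 / 2 + a * g x) = 1 / 2 * \<Lambda> (\<lambda>x. 1) + a * \<Lambda> g" for a
      using positive_functionalD(1)[OF \<Lambda> bounded_image_const bounded_image_cmult[OF gb], of "1 / 2" a]
        positive_functionalD(2)[OF \<Lambda> gb] positive_functionalD(2)[OF \<Lambda> bounded_image_const, of "1 / 2" 1] by simp
    have lin': "integral\<^sup>L ?M (\<lambda>x. 1 / 2 + a * g x) = 1 / 2 * \<Lambda> (\<lambda>x. 1) + a * integral\<^sup>L ?M g" for a
      using int[OF g] mass by simp
    have "a * \<Lambda> g \<le> a * integral\<^sup>L ?M g" if "\<bar>a\<bar> * B = 1 / 2" for a
      using half[OF that] unfolding lin lin' by simp
    from this[of "1 / (2 * B)"] this[of "- 1 / (2 * B)"] show ?thesis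
      using B(1) by (simp add: field_simps)
  qed
  have "radon_measure euclidean ?M"
    unfolding radon_measure_def
  proof (intro conjI ballI allI impI)
    show "sets ?M = sigma_sets (topspace euclidean) {U. openin euclidean U}"
      by (simp add: borel_def)
    show "emeasure ?M B = (SUP K\<in>{K. compactin euclidean K \<and> K \<subseteq> B}. emeasure ?M K)" if "B \<in> sets ?M" for B
      using inner_regular_extension[of B] that by simp
  qed (simp_all add: M.emeasure_finite less_top[symmetric])
  then show ?thesis
    by (rule that) (use emeasure_extension_outside int eq in auto)
qed

section \<open>Cluster points of positive functionals\<close>


lemma Hausdorff_euclidean_fun:
  "Hausdorff_space (euclidean :: ('i \<Rightarrow> 'b::metric_space) topology)"
  using Hausdorff_space_product_topology[of "\<lambda>_. euclidean :: 'b topology" "UNIV :: 'i set"]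
  by (simp add: euclidean_product_topology)

lemma compact_coordinate_box:
  fixes K :: "'i \<Rightarrow> 'b::topological_space set"
  assumes "\<And>i. compact (K i)"
  shows "compact {z. \<forall>i. z i \<in> K i}"
proof -
  have "compactin (product_topology (\<lambda>i. euclidean) UNIV) (PiE UNIV K)"
    using assms by (simp add: compactin_PiE)
  then show ?thesis by (simp add: euclidean_product_topology PiE_UNIV_domain Pi_def)
qed

text \<open>For a bounded function \<open>h\<close> the values \<open>\<Lambda> h\<close> stay in a compact interval, and all conditions on
  \<open>\<Lambda>\<close> are closed in the topology of pointwise convergence; Tychonoff's theorem and the finite
  intersection property apply. At unbounded functions
  the value is set to \<open>0\<close> to keep \<open>\<Lambda>\<close> in a compact product.\<close>

lemma positive_functional_compactness:
  fixes g :: "'j \<Rightarrow> 'x \<Rightarrow> real" and l e :: "'j \<Rightarrow> real" and Z :: "'x set"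
  assumes gb: "\<And>j. bounded (g j ` Z)"
    and approx: "\<And>J. finite J \<Longrightarrow>
      \<exists>\<Lambda>. positive_functional Z \<Lambda> \<and> \<Lambda> (\<lambda>x. 1) = c \<and> (\<forall>j\<in>J. \<bar>\<Lambda> (g j) - l j\<bar> \<le> e j)"
  obtains \<Lambda> where "positive_functional Z \<Lambda>" "\<And>j. \<bar>\<Lambda> (g j) - l j\<bar> \<le> e j"
proof -
  have "\<forall>h :: 'x \<Rightarrow> real. \<exists>B. bounded (h ` Z) \<longrightarrow> (\<forall>z\<in>Z. \<bar>h z\<bar> \<le> B)"
    unfolding bounded_iff by auto
  then obtain B where "\<forall>h :: 'x \<Rightarrow> real. bounded (h ` Z) \<longrightarrow> (\<forall>z\<in>Z. \<bar>h z\<bar> \<le> B h)"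
    by (rule choice[THEN exE])
  then have B: "\<bar>h z\<bar> \<le> B h" if "bounded (h ` Z)" "z \<in> Z" for h :: "'x \<Rightarrow> real" and z
    using that by blast
  define b where "b = (\<lambda>h :: 'x \<Rightarrow> real. if bounded (h ` Z) then B h * c else 0)"
  define P where "P = {\<Lambda>. \<forall>h. \<Lambda> h \<in> {- b h..b h}}"
  define f where "f = (\<lambda>j. {\<Lambda>. positive_functional Z \<Lambda> \<and> \<bar>\<Lambda> (g j) - l j\<bar> \<le> e j})"
  have "P \<inter> (\<Inter>j\<in>UNIV. f j) \<noteq> {}"
  proof (rule compact_imp_fip_image)
    show "compact P" unfolding P_def by (rule compact_coordinate_box) simp
    show "closed (f j)" for j
      unfolding f_def positive_functional_def
      by (intro closed_Collect_conj closed_Collect_all closed_Collect_imp open_Collect_const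
          closed_Collect_eq closed_Collect_le continuous_intros continuous_on_product_coordinates)
    fix J :: "'j set" assume "finite J"
    then obtain \<Lambda> where \<Lambda>: "positive_functional Z \<Lambda>" "\<Lambda> (\<lambda>x. 1) = c" "\<And>j. j \<in> J \<Longrightarrow> \<bar>\<Lambda> (g j) - l j\<bar> \<le> e j"
      using approx[of J] by blast
    define \<Lambda>' where "\<Lambda>' = (\<lambda>h. if bounded (h ` Z) then \<Lambda> h else 0)"
    have "positive_functional Z \<Lambda>'"
      unfolding positive_functional_def \<Lambda>'_def
      using positive_functionalD[OF \<Lambda>(1)] by (simp add: bounded_image_add bounded_image_cmult)
    moreover have "\<Lambda>' \<in> P"
    proof -
      have "- b h \<le> \<Lambda>' h \<and> \<Lambda>' h \<le> b h" for h
      proof (cases "bounded (h ` Z)")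
        case True
        have scale: "\<Lambda> (\<lambda>x. a * 1) = a * c" for a
          using positive_functionalD(2)[OF \<Lambda>(1) bounded_image_const, of a 1] \<Lambda>(2) by simp
        have "\<Lambda> h \<le> \<Lambda> (\<lambda>x. B h * 1)" "\<Lambda> (\<lambda>x. (- B h) * 1) \<le> \<Lambda> h"
          using B[OF True]
          by (intro positive_functional_mono[OF \<Lambda>(1)] True bounded_image_const; fastforce simp: abs_le_iff)+
        then show ?thesis unfolding scale by (simp add: b_def \<Lambda>'_def True)
      qed (simp add: b_def \<Lambda>'_def)
      then show ?thesis by (simp add: P_def)
    qed
    ultimately show "P \<inter> (\<Inter>j\<in>J. f j) \<noteq> {}"
      using \<Lambda>(3) gb by (intro ex_in_conv[THEN iffD1] exI[of _ \<Lambda>']) (auto simp: f_def \<Lambda>'_def)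
  qed
  then show ?thesis using that by (auto simp: f_def)
qed

section \<open>Radon measures and their supports\<close>

lemma radon_measurable_openin:
  assumes "radon_measure T M" "openin T U"
  shows "U \<in> sets M"
  using assms by (auto simp: radon_measure_def)

text \<open>Inner regularity replaces countability of the family: every compact subset of the union is covered
  by finitely many members.\<close>

lemma radon_null_Union:
  assumes M: "radon_measure T M" and U: "\<And>U. U \<in> \<U> \<Longrightarrow> openin T U \<and> emeasure M U = 0"
  shows "emeasure M (\<Union>\<U>) = 0"
proof -
  have "openin T (\<Union>\<U>)" using U by blast
  then have "emeasure M (\<Union>\<U>) = (SUP K\<in>{K. compactin T K \<and> K \<subseteq> \<Union>\<U>}. emeasure M K)"
    using M radon_measurable_openin[OF M] by (simp add: radon_measure_def)
  also have "\<dots> \<le> 0"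
  proof (rule SUP_least, clarify)
    fix K assume K: "compactin T K" "K \<subseteq> \<Union>\<U>"
    then obtain \<F> where F: "finite \<F>" "\<F> \<subseteq> \<U>" "K \<subseteq> \<Union>\<F>"
      using U unfolding compactin_def by metis
    have "emeasure M K \<le> emeasure M (\<Union>\<F>)"
    proof (rule emeasure_mono[OF F(3)])
      have "openin T (\<Union>\<F>)" using F(2) U by (intro openin_Union) blast
      then show "\<Union>\<F> \<in> sets M" by (rule radon_measurable_openin[OF M])
    qed
    also have "\<dots> = 0"
      using F(1,2) U radon_measurable_openin[OF M]
      by (intro null_setsD1 null_sets_UN'[of \<F> id M, simplified]) (auto simp: countable_finite null_sets_def)
    finally show "emeasure M K \<le> 0" by simp
  qed
  finally show ?thesis by simp
qed

lemma openin_support_complement: "openin T (topspace T - measure_support T M)"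
proof -
  have "topspace T - measure_support T M = \<Union>{U. openin T U \<and> emeasure M U = 0}"
    by (auto simp: measure_support_def zero_less_iff_neq_zero dest: openin_subset)
  moreover have "openin T (\<Union>{U. openin T U \<and> emeasure M U = 0})"
    by (rule openin_Union) simp
  ultimately show ?thesis by simp
qed

lemma radon_support_null:
  assumes "radon_measure T M"
  shows "emeasure M (topspace T - measure_support T M) = 0"
proof -
  have "topspace T - measure_support T M = \<Union>{U. openin T U \<and> emeasure M U = 0}"
    by (auto simp: measure_support_def zero_less_iff_neq_zero dest: openin_subset)
  then show ?thesis using radon_null_Union[OF assms, of "{U. openin T U \<and> emeasure M U = 0}"] by simp
qed

lemma radon_measure_restrict:
  fixes M :: "'x::topological_space measure"
  assumes M: "radon_measure euclidean M" and A: "closed A"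
  shows "radon_measure (top_of_set A) (restrict_space M A)"
proof -
  have sets_M: "sets M = sigma_sets UNIV {U. open U}" and space_M: "space M = UNIV"
    using M by (auto simp: radon_measure_def)
  have "UNIV - (- A) \<in> sigma_sets UNIV {U. open U}"
    using A by (intro sigma_sets.Compl sigma_sets.Basic) (simp add: open_Compl)
  then have A_M: "A \<in> sets M" by (simp add: sets_M Compl_eq_Diff_UNIV[symmetric])
  have compact: "compactin (top_of_set A) K \<longleftrightarrow> compact K \<and> K \<subseteq> A" for K
    by (simp add: compactin_subtopology)
  have em: "emeasure (restrict_space M A) K = emeasure M K" if "K \<subseteq> A" for K
    using that A_M by (intro emeasure_restrict_space) auto
  show ?thesis
    unfolding radon_measure_def
  proof (intro conjI ballI allI impI)
    show "space (restrict_space M A) = topspace (top_of_set A)"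
      by (simp add: space_restrict_space space_M)
    have "sets (restrict_space M A) = sigma_sets A ((\<inter>) A ` {U. open U})"
      unfolding sets_restrict_space sets_M
      by (rule sigma_sets_Int) (use A_M in \<open>simp_all add: sets_M\<close>)
    also have "(\<inter>) A ` {U. open U} = {U. openin (top_of_set A) U}"
      by (auto simp: openin_open)
    finally show "sets (restrict_space M A) = sigma_sets (topspace (top_of_set A)) {U. openin (top_of_set A) U}"
      by simp
    show "emeasure (restrict_space M A) K < \<infinity>" if "compactin (top_of_set A) K" for K
      using that M by (auto simp: compact em radon_measure_def)
    fix B assume "B \<in> sets (restrict_space M A)"
    then have B: "B \<subseteq> A" "B \<in> sets M"
      using A_M by (auto simp: sets_restrict_space_iff)
    then have "emeasure M B = (SUP K\<in>{K. compact K \<and> K \<subseteq> B}. emeasure M K)"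
      using M by (simp add: radon_measure_def)
    also have "\<dots> = (SUP K\<in>{K. compactin (top_of_set A) K \<and> K \<subseteq> B}. emeasure (restrict_space M A) K)"
      using B(1) by (intro SUP_cong) (auto simp: compact em)
    finally show "emeasure (restrict_space M A) B = (SUP K\<in>{K. compactin (top_of_set A) K \<and> K \<subseteq> B}. emeasure (restrict_space M A) K)"
      using B(1) by (simp add: em)
  qed
qed

lemma character_space_eq: "character_space star = top_of_set (characters star)"
  by (simp add: character_space_def euclidean_product_topology)

lemma closed_characters: "closed (characters star)"
  unfolding characters_def
  by (intro closed_Collect_conj closed_Collect_all closed_Collect_eq continuous_intros continuous_on_product_coordinates)

section \<open>A representing measure on the space of all points\<close>


lemma norm_eq_add_le:
  fixes x :: "'b::real_normed_vector"
  shows "x = y + z \<Longrightarrow> norm x \<le> norm y + norm z"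
  by (simp add: norm_triangle_ineq)

context commutative_involution
begin

text \<open>The defect vanishes for all \<open>s\<close> and \<open>t\<close> exactly at the characters. It is continuous in \<open>z\<close>, hence its
  integral passes to cluster points of functionals.\<close>

definition character_defect :: "'a \<Rightarrow> 'a \<Rightarrow> ('a \<Rightarrow> complex) \<Rightarrow> real" where
  "character_defect s t z = cmod (z (s * t) - z s * z t) + cmod (z (star s) - cnj (z s)) + cmod (z 1 - 1)"

lemma character_defect_nonneg: "character_defect s t z \<ge> 0"
  by (simp add: character_defect_def)

lemma characters_iff_defect: "z \<in> characters star \<longleftrightarrow> (\<forall>s t. character_defect s t z = 0)"
  by (simp add: characters_def character_defect_def add_nonneg_eq_0_iff) blast

lemma psd_one_eq:
  assumes "psd \<psi>"
  shows "\<psi> 1 = complex_of_real (Re (\<psi> 1))" "Re (\<psi> 1) \<ge> 0"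
  using psd_one[OF assms] by (auto simp: complex_nonneg_Reals_iff complex_eq_iff)

text \<open>Replacing \<open>z (s * t)\<close>, \<open>z s\<close> and \<open>z t\<close> by quotients of values of \<open>\<psi>\<close> one at a time gives the first three
  terms. The terms for \<open>star s\<close> use that \<open>\<psi>\<close> is Hermitian.\<close>

lemma weighted_defect_le:
  assumes psd: "psd \<psi>" and r: "cmod (z s) \<le> r"
  shows "Re (\<psi> 1) * character_defect s t z
    \<le> cmod (\<psi> (s * t * 1) - z (s * t) * \<psi> 1) + cmod (\<psi> (s * t) - z s * \<psi> t)
      + r * cmod (\<psi> (t * 1) - z t * \<psi> 1) + cmod (\<psi> (star s * 1) - z (star s) * \<psi> 1)
      + cmod (\<psi> (s * 1) - z s * \<psi> 1) + cmod (\<psi> (1 * 1) - z 1 * \<psi> 1)"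
proof -
  define w where "w = Re (\<psi> 1)"
  have w: "\<psi> 1 = complex_of_real w" "w \<ge> 0" using psd_one_eq[OF psd] by (simp_all add: w_def)
  have wnorm: "w * cmod x = cmod (complex_of_real w * x)" for x using w(2) by (simp add: norm_mult)
  have "complex_of_real w * (z (s * t) - z s * z t)
      = - (\<psi> (s * t) - z (s * t) * \<psi> 1) + (\<psi> (s * t) - z s * \<psi> t) + z s * (\<psi> t - z t * \<psi> 1)"
    by (simp add: w algebra_simps)
  then have "w * cmod (z (s * t) - z s * z t)
      \<le> cmod (\<psi> (s * t) - z (s * t) * \<psi> 1) + cmod (\<psi> (s * t) - z s * \<psi> t) + cmod (z s * (\<psi> t - z t * \<psi> 1))"
    unfolding wnorm
    by (metis (no_types, lifting) norm_triangle_le add_right_mono norm_minus_cancel norm_triangle_ineq order_trans)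
  also have "cmod (z s * (\<psi> t - z t * \<psi> 1)) \<le> r * cmod (\<psi> t - z t * \<psi> 1)"
    using r by (simp add: norm_mult mult_right_mono)
  finally have 1: "w * cmod (z (s * t) - z s * z t)
      \<le> cmod (\<psi> (s * t) - z (s * t) * \<psi> 1) + cmod (\<psi> (s * t) - z s * \<psi> t) + r * cmod (\<psi> t - z t * \<psi> 1)"
    by simp
  have "complex_of_real w * (z (star s) - cnj (z s))
      = - (\<psi> (star s) - z (star s) * \<psi> 1) + cnj (\<psi> s - z s * \<psi> 1)"
    by (simp add: w psd_hermitian[OF psd] algebra_simps)
  then have "w * cmod (z (star s) - cnj (z s))
      \<le> cmod (- (\<psi> (star s) - z (star s) * \<psi> 1)) + cmod (cnj (\<psi> s - z s * \<psi> 1))"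
    unfolding wnorm by (rule norm_eq_add_le)
  then have 2: "w * cmod (z (star s) - cnj (z s)) \<le> cmod (\<psi> (star s) - z (star s) * \<psi> 1) + cmod (\<psi> s - z s * \<psi> 1)"
    by (simp only: norm_minus_cancel complex_mod_cnj)
  have "complex_of_real w * (z 1 - 1) = - (\<psi> 1 - z 1 * \<psi> 1)" by (simp add: w algebra_simps)
  then have 3: "w * cmod (z 1 - 1) = cmod (\<psi> 1 - z 1 * \<psi> 1)"
    unfolding wnorm by (metis norm_minus_cancel)
  show ?thesis
    using 1 2 3 by (simp add: character_defect_def w_def[symmetric] distrib_left)
qed

text \<open>The weights are the masses \<open>\<psi> 1\<close> of the summands. The closure \<open>G\<close> of \<open>F\<close> under one multiplication and
  the involution is needed because the defect at \<open>(s, t)\<close> involves these coordinates; six estimates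
  of size \<open>\<eta>\<close> enter, one of them weighted by the bound \<open>2 * \<rho> s\<close> for \<open>cmod (z s)\<close>.\<close>

lemma finite_approximation:
  assumes adm: "admissible \<rho> \<phi>" and \<rho>: "\<And>s. \<rho> s > 0" and fin: "finite F" and \<eta>: "\<eta> > 0"
  shows "\<exists>ws :: (real \<times> ('a \<Rightarrow> complex)) list.
      (\<forall>p\<in>set ws. fst p \<ge> 0 \<and> (\<forall>s. \<bar>Re (snd p s)\<bar> \<le> \<rho> s \<and> \<bar>Im (snd p s)\<bar> \<le> \<rho> s))
    \<and> (\<Sum>p\<leftarrow>ws. fst p) = Re (\<phi> 1)
    \<and> (\<forall>s\<in>F. \<bar>(\<Sum>p\<leftarrow>ws. fst p * Re (snd p s)) - Re (\<phi> s)\<bar> \<le> \<eta>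
           \<and> \<bar>(\<Sum>p\<leftarrow>ws. fst p * Im (snd p s)) - Im (\<phi> s)\<bar> \<le> \<eta>)
    \<and> (\<forall>s\<in>F. \<forall>t\<in>F. (\<Sum>p\<leftarrow>ws. fst p * character_defect s t (snd p)) \<le> (5 + 2 * \<rho> s) * \<eta>)"
proof -
  define G where "G = insert 1 (F \<union> star ` F \<union> (\<lambda>(s, t). s * t) ` (F \<times> F))"
  have "finite G" using fin by (simp add: G_def)
  have G: "1 \<in> G" "\<And>s. s \<in> F \<Longrightarrow> s \<in> G" "\<And>s. s \<in> F \<Longrightarrow> star s \<in> G" "\<And>s t. s \<in> F \<Longrightarrow> t \<in> F \<Longrightarrow> s * t \<in> G"
    by (auto simp: G_def)
  obtain xs :: "(('a \<Rightarrow> complex) \<times> ('a \<Rightarrow> complex)) list" where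
    "(\<forall>p\<in>set xs. psd (fst p) \<and> (\<forall>s. \<bar>Re (snd p s)\<bar> \<le> \<rho> s \<and> \<bar>Im (snd p s)\<bar> \<le> \<rho> s))
    \<and> (\<forall>t. (\<Sum>p\<leftarrow>xs. fst p t) = \<phi> t)
    \<and> (\<forall>s\<in>G. \<forall>t\<in>G. (\<Sum>p\<leftarrow>xs. cmod (fst p (s * t) - snd p s * fst p t)) \<le> \<eta>)"
    using approximate_characters[OF adm \<rho> \<open>finite G\<close> \<eta>] by (rule exE)
  then have xs: "\<And>p. p \<in> set xs \<Longrightarrow> psd (fst p)"
      "\<And>p s. p \<in> set xs \<Longrightarrow> \<bar>Re (snd p s)\<bar> \<le> \<rho> s \<and> \<bar>Im (snd p s)\<bar> \<le> \<rho> s"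
      "\<And>t. (\<Sum>p\<leftarrow>xs. fst p t) = \<phi> t"
      "\<And>s t. s \<in> G \<Longrightarrow> t \<in> G \<Longrightarrow> (\<Sum>p\<leftarrow>xs. cmod (fst p (s * t) - snd p s * fst p t)) \<le> \<eta>"
    by (elim conjE, blast)+
  define ws where "ws = map (\<lambda>p. (Re (fst p 1), snd p)) xs"
  have "\<forall>p\<in>set ws. fst p \<ge> 0 \<and> (\<forall>s. \<bar>Re (snd p s)\<bar> \<le> \<rho> s \<and> \<bar>Im (snd p s)\<bar> \<le> \<rho> s)"
    using xs(2) psd_one_eq(2)[OF xs(1)] by (simp add: ws_def)
  moreover have "(\<Sum>p\<leftarrow>ws. fst p) = Re (\<phi> 1)"
  proof -
    have "(\<Sum>p\<leftarrow>xs. Re (fst p 1)) = Re (\<Sum>p\<leftarrow>xs. fst p 1)" by (induction xs) auto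
    then show ?thesis by (simp add: ws_def o_def xs(3))
  qed
  moreover have "\<bar>(\<Sum>p\<leftarrow>ws. fst p * Re (snd p s)) - Re (\<phi> s)\<bar> \<le> \<eta>
           \<and> \<bar>(\<Sum>p\<leftarrow>ws. fst p * Im (snd p s)) - Im (\<phi> s)\<bar> \<le> \<eta>" if s: "s \<in> F" for s
  proof -
    define d where "d = (\<Sum>p\<leftarrow>xs. snd p s * fst p 1) - \<phi> s"
    have "cmod ((\<Sum>p\<leftarrow>ys. snd p s * fst p 1) - (\<Sum>p\<leftarrow>ys. fst p s)) \<le> (\<Sum>p\<leftarrow>ys. cmod (fst p s - snd p s * fst p 1))"
      for ys :: "(('a \<Rightarrow> complex) \<times> ('a \<Rightarrow> complex)) list"
    proof (induction ys)
      case (Cons p ys)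
      have "(\<Sum>p\<leftarrow>p # ys. snd p s * fst p 1) - (\<Sum>p\<leftarrow>p # ys. fst p s)
        = - (fst p s - snd p s * fst p 1) + ((\<Sum>p\<leftarrow>ys. snd p s * fst p 1) - (\<Sum>p\<leftarrow>ys. fst p s))" by simp
      then have "cmod ((\<Sum>p\<leftarrow>p # ys. snd p s * fst p 1) - (\<Sum>p\<leftarrow>p # ys. fst p s))
        \<le> cmod (- (fst p s - snd p s * fst p 1)) + cmod ((\<Sum>p\<leftarrow>ys. snd p s * fst p 1) - (\<Sum>p\<leftarrow>ys. fst p s))"
        by (rule norm_eq_add_le)
      then show ?case using Cons by (simp only: norm_minus_cancel list.map sum_list.Cons)
    qed simp
    from this[of xs] have d: "cmod d \<le> \<eta>"
      using xs(4)[OF G(2)[OF s] G(1)] xs(3) by (simp add: d_def)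
    have "(\<Sum>p\<leftarrow>ws. fst p * Re (snd p s)) = Re (\<Sum>p\<leftarrow>xs. snd p s * fst p 1)"
      "(\<Sum>p\<leftarrow>ws. fst p * Im (snd p s)) = Im (\<Sum>p\<leftarrow>xs. snd p s * fst p 1)"
    proof -
      have im: "Im (fst p 1) = 0" if "p \<in> set xs" for p
        using psd_one[OF xs(1)[OF that]] by (simp add: complex_nonneg_Reals_iff)
      have "(\<Sum>p\<leftarrow>xs. Re (fst p 1) * Re (snd p s)) = (\<Sum>p\<leftarrow>xs. Re (snd p s * fst p 1))"
        "(\<Sum>p\<leftarrow>xs. Re (fst p 1) * Im (snd p s)) = (\<Sum>p\<leftarrow>xs. Im (snd p s * fst p 1))"
        by (intro arg_cong[where f = sum_list] map_cong refl; simp add: im)+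
      moreover have "(\<Sum>p\<leftarrow>xs. Re (snd p s * fst p 1)) = Re (\<Sum>p\<leftarrow>xs. snd p s * fst p 1)"
        "(\<Sum>p\<leftarrow>xs. Im (snd p s * fst p 1)) = Im (\<Sum>p\<leftarrow>xs. snd p s * fst p 1)"
        by (induction xs) auto
      ultimately show "(\<Sum>p\<leftarrow>ws. fst p * Re (snd p s)) = Re (\<Sum>p\<leftarrow>xs. snd p s * fst p 1)"
        "(\<Sum>p\<leftarrow>ws. fst p * Im (snd p s)) = Im (\<Sum>p\<leftarrow>xs. snd p s * fst p 1)"
        by (simp_all add: ws_def o_def)
    qed
    then show ?thesis
      using abs_Re_le_cmod[of d] abs_Im_le_cmod[of d] d by (auto simp: d_def)
  qed
  moreover have "(\<Sum>p\<leftarrow>ws. fst p * character_defect s t (snd p)) \<le> (5 + 2 * \<rho> s) * \<eta>" if s: "s \<in> F" and t: "t \<in> F" for s t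
  proof -
    define E where "E = (\<lambda>s t (p :: ('a \<Rightarrow> complex) \<times> ('a \<Rightarrow> complex)). cmod (fst p (s * t) - snd p s * fst p t))"
    have E: "(\<Sum>p\<leftarrow>xs. E u v p) \<le> \<eta>" if "u \<in> G" "v \<in> G" for u v
      using xs(4)[OF that] by (simp add: E_def)
    have "(\<Sum>p\<leftarrow>ws. fst p * character_defect s t (snd p)) = (\<Sum>p\<leftarrow>xs. Re (fst p 1) * character_defect s t (snd p))"
      by (simp add: ws_def o_def)
    also have "\<dots> \<le> (\<Sum>p\<leftarrow>xs. E (s * t) 1 p + E s t p + 2 * \<rho> s * E t 1 p + E (star s) 1 p + E s 1 p + E 1 1 p)"
    proof (rule sum_list_mono)
      fix p assume p: "p \<in> set xs"
      have "cmod (snd p s) \<le> \<bar>Re (snd p s)\<bar> + \<bar>Im (snd p s)\<bar>" by (rule cmod_le)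
      also have "\<dots> \<le> 2 * \<rho> s" using xs(2)[OF p, of s] by linarith
      finally show "Re (fst p 1) * character_defect s t (snd p)
          \<le> E (s * t) 1 p + E s t p + 2 * \<rho> s * E t 1 p + E (star s) 1 p + E s 1 p + E 1 1 p"
        unfolding E_def by (rule weighted_defect_le[OF xs(1)[OF p]])
    qed
    also have "\<dots> = (\<Sum>p\<leftarrow>xs. E (s * t) 1 p) + (\<Sum>p\<leftarrow>xs. E s t p) + 2 * \<rho> s * (\<Sum>p\<leftarrow>xs. E t 1 p)
        + (\<Sum>p\<leftarrow>xs. E (star s) 1 p) + (\<Sum>p\<leftarrow>xs. E s 1 p) + (\<Sum>p\<leftarrow>xs. E 1 1 p)"
      by (simp add: sum_list_addf sum_list_const_mult)
    also have "\<dots> \<le> \<eta> + \<eta> + 2 * \<rho> s * \<eta> + \<eta> + \<eta> + \<eta>"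
      using less_imp_le[OF \<rho>[of s]] G s t by (intro add_mono mult_left_mono E) auto
    finally show ?thesis by (simp add: algebra_simps)
  qed
  ultimately show ?thesis by (intro exI[of _ ws]) simp
qed

definition bounding_box :: "('a \<Rightarrow> real) \<Rightarrow> ('a \<Rightarrow> complex) set" where
  "bounding_box \<rho> = {z. \<forall>s. \<bar>Re (z s)\<bar> \<le> \<rho> s \<and> \<bar>Im (z s)\<bar> \<le> \<rho> s}"

lemma compact_bounding_box: "compact (bounding_box \<rho>)"
proof -
  have "bounding_box \<rho> = {z. \<forall>s. z s \<in> cbox (Complex (- \<rho> s) (- \<rho> s)) (Complex (\<rho> s) (\<rho> s))}"
    by (auto simp: bounding_box_def in_cbox_complex_iff abs_le_iff) (metis minus_le_iff)+
  then show ?thesis using compact_coordinate_box[of "\<lambda>s. cbox (Complex (- \<rho> s) (- \<rho> s)) (Complex (\<rho> s) (\<rho> s))"] by simp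
qed

text \<open>The last component \<open>n\<close> of the index selects the accuracy \<open>1/(n + 1)\<close> that is demanded when these
  tests serve as constraints on functionals.\<close>

definition moment_test :: "nat \<times> 'a \<times> 'a \<times> nat \<Rightarrow> ('a \<Rightarrow> complex) \<Rightarrow> real" where
  "moment_test = (\<lambda>(k, s, t, n) z. if k = 0 then Re (z s) else if k = 1 then Im (z s) else character_defect s t z)"

lemma continuous_character_defect: "continuous_on A (character_defect s t)"
  unfolding character_defect_def
  by (intro continuous_intros continuous_on_subset[OF continuous_on_product_coordinates] subset_UNIV)

lemma continuous_moment_test: "continuous_on A (moment_test j)"
proof -
  obtain k s t n where j: "j = (k, s, t, n)" by (metis prod_cases4)
  have "continuous_on A (\<lambda>z. Re (z s))" "continuous_on A (\<lambda>z. Im (z s))"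
    by (intro continuous_intros continuous_on_subset[OF continuous_on_product_coordinates] subset_UNIV)+
  then show ?thesis
    using continuous_character_defect[of A s t]
    by (cases "k = 0"; cases "k = 1") (simp_all add: moment_test_def j)
qed

lemma weighted_points_functional:
  assumes "\<And>p. p \<in> set ws \<Longrightarrow> fst p \<ge> 0 \<and> snd p \<in> Z"
  shows "positive_functional Z (\<lambda>h. \<Sum>p\<leftarrow>ws. fst p * h (snd p))"
  unfolding positive_functional_def
proof (intro conjI allI impI)
  show "0 \<le> (\<Sum>p\<leftarrow>ws. fst p * h (snd p))" if "\<forall>z\<in>Z. 0 \<le> h z" for h
    using assms that by (intro sum_list_nonneg) auto
qed (simp_all add: distrib_left sum_list_addf mult.left_commute sum_list_const_mult)

text \<open>A functional satisfying the constraints of all accuracies satisfies them exactly. Its measure then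
  has the prescribed moments, and each defect, being nonnegative with integral \<open>0\<close>, vanishes
  outside an open null set; the union of these sets is still null.\<close>

theorem admissible_representation:
  assumes adm: "admissible \<rho> \<phi>" and \<rho>: "\<And>s. \<rho> s > 0"
  obtains M where "radon_measure euclidean M" "emeasure M (- bounding_box \<rho>) = 0"
    "emeasure M (- characters star) = 0" "\<And>s. integrable M (\<lambda>z. z s) \<and> integral\<^sup>L M (\<lambda>z. z s) = \<phi> s"
proof -
  let ?Z = "bounding_box \<rho>"
  define l where "l = (\<lambda>(k :: nat, s, t :: 'a, n :: nat). if k = 0 then Re (\<phi> s) else if k = 1 then Im (\<phi> s) else 0 :: real)"
  define e where "e = (\<lambda>(k :: nat, s :: 'a, t :: 'a, n :: nat). 1 / (real n + 1))"
  have bdd: "bounded (moment_test j ` ?Z)" for j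
    by (intro compact_imp_bounded compact_continuous_image continuous_moment_test compact_bounding_box)
  have approx: "\<exists>\<Lambda>. positive_functional ?Z \<Lambda> \<and> \<Lambda> (\<lambda>x. 1) = Re (\<phi> 1) \<and> (\<forall>j\<in>J. \<bar>\<Lambda> (moment_test j) - l j\<bar> \<le> e j)"
    if J: "finite J" for J
  proof -
    define F where "F = (\<lambda>(k, s, t, n). s) ` J \<union> (\<lambda>(k, s, t, n). t) ` J"
    define w where "w = (\<lambda>(k :: nat, s, t :: 'a, n :: nat). (real n + 1) * (5 + 2 * \<rho> s))"
    have w0: "w j \<ge> 0" for j
      using less_imp_le[OF \<rho>] by (auto simp: w_def split: prod.split intro!: mult_nonneg_nonneg add_nonneg_nonneg)
    define \<eta> where "\<eta> = 1 / (sum w J + 1)"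
    have W: "sum w J \<ge> 0" using w0 by (intro sum_nonneg) auto
    have \<eta>: "\<eta> > 0" using W by (simp add: \<eta>_def)
    have \<eta>w: "\<eta> * w j \<le> 1" if "j \<in> J" for j
    proof -
      have "w j \<le> sum w J" using that J w0 by (intro member_le_sum) auto
      then show ?thesis using W by (simp add: \<eta>_def)
    qed
    have fin: "finite F" using J by (simp add: F_def)
    obtain ws :: "(real \<times> ('a \<Rightarrow> complex)) list" where
      "(\<forall>p\<in>set ws. fst p \<ge> 0 \<and> (\<forall>s. \<bar>Re (snd p s)\<bar> \<le> \<rho> s \<and> \<bar>Im (snd p s)\<bar> \<le> \<rho> s))
      \<and> (\<Sum>p\<leftarrow>ws. fst p) = Re (\<phi> 1)
      \<and> (\<forall>s\<in>F. \<bar>(\<Sum>p\<leftarrow>ws. fst p * Re (snd p s)) - Re (\<phi> s)\<bar> \<le> \<eta>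
             \<and> \<bar>(\<Sum>p\<leftarrow>ws. fst p * Im (snd p s)) - Im (\<phi> s)\<bar> \<le> \<eta>)
      \<and> (\<forall>s\<in>F. \<forall>t\<in>F. (\<Sum>p\<leftarrow>ws. fst p * character_defect s t (snd p)) \<le> (5 + 2 * \<rho> s) * \<eta>)"
      using finite_approximation[OF adm \<rho> fin \<eta>] by (rule exE)
    then have ws: "\<And>p. p \<in> set ws \<Longrightarrow> fst p \<ge> 0 \<and> snd p \<in> ?Z" "(\<Sum>p\<leftarrow>ws. fst p) = Re (\<phi> 1)"
      "\<And>s. s \<in> F \<Longrightarrow> \<bar>(\<Sum>p\<leftarrow>ws. fst p * Re (snd p s)) - Re (\<phi> s)\<bar> \<le> \<eta>"
      "\<And>s. s \<in> F \<Longrightarrow> \<bar>(\<Sum>p\<leftarrow>ws. fst p * Im (snd p s)) - Im (\<phi> s)\<bar> \<le> \<eta>"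
      "\<And>s t. s \<in> F \<Longrightarrow> t \<in> F \<Longrightarrow> (\<Sum>p\<leftarrow>ws. fst p * character_defect s t (snd p)) \<le> (5 + 2 * \<rho> s) * \<eta>"
      unfolding bounding_box_def by (elim conjE, blast)+
    define \<Lambda> where "\<Lambda> = (\<lambda>h. \<Sum>p\<leftarrow>ws. fst p * h (snd p))"
    have "\<bar>\<Lambda> (moment_test j) - l j\<bar> \<le> e j" if j: "j \<in> J" for j
    proof -
      obtain k s t n where jj: "j = (k, s, t, n)" by (metis prod_cases4)
      have st: "s \<in> F" "t \<in> F" using j jj by (force simp: F_def)+
      have b: "(5 + 2 * \<rho> s) * \<eta> \<le> e j"
        using \<eta>w[OF j] by (simp add: jj w_def e_def field_simps)
      have "\<eta> \<le> (5 + 2 * \<rho> s) * \<eta>" using \<eta> \<rho>[of s] by simp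
      then have b': "\<eta> \<le> e j" using b by linarith
      have nn: "0 \<le> (\<Sum>p\<leftarrow>ws. fst p * character_defect s t (snd p))"
        using ws(1) by (intro sum_list_nonneg) (auto simp: character_defect_nonneg)
      show ?thesis
        using ws(3)[OF st(1)] ws(4)[OF st(1)] ws(5)[OF st] b b' nn
        by (auto simp: \<Lambda>_def moment_test_def l_def jj)
    qed
    moreover have "positive_functional ?Z \<Lambda>"
      unfolding \<Lambda>_def by (rule weighted_points_functional[OF ws(1)])
    ultimately show ?thesis
      using ws(2) by (intro exI[of _ \<Lambda>]) (auto simp: \<Lambda>_def)
  qed
  obtain \<Lambda> where \<Lambda>: "positive_functional ?Z \<Lambda>" and \<Lambda>_close: "\<And>j. \<bar>\<Lambda> (moment_test j) - l j\<bar> \<le> e j"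
    using positive_functional_compactness[OF bdd approx] by blast
  have \<Lambda>_eq: "\<Lambda> (moment_test (k, s, t, 0)) = l (k, s, t, 0)" for k s t
  proof -
    let ?d = "\<bar>\<Lambda> (moment_test (k, s, t, 0)) - l (k, s, t, 0)\<bar>"
    have le: "?d \<le> 1 / (real n + 1)" for n
      using \<Lambda>_close[of "(k, s, t, n)"] by (simp add: moment_test_def l_def e_def)
    have "\<not> 0 < ?d"
    proof
      assume "0 < ?d"
      then obtain n where "inverse (real (Suc n)) < ?d" using reals_Archimedean by blast
      moreover have "inverse (real (Suc n)) = 1 / (real n + 1)" by (simp add: field_simps)
      ultimately show False using le[of n] by linarith
    qed
    then show ?thesis by simp
  qed
  obtain M where M: "radon_measure euclidean M" "emeasure M (- ?Z) = 0"
    "\<And>g. continuous_on UNIV g \<Longrightarrow> integrable M g \<and> integral\<^sup>L M g = \<Lambda> g"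
    using positive_functional_representation[OF Hausdorff_euclidean_fun compact_bounding_box \<Lambda>] by blast
  have test: "integrable M (moment_test j) \<and> integral\<^sup>L M (moment_test j) = \<Lambda> (moment_test j)" for j
    by (rule M(3)) (rule continuous_moment_test)
  have rep: "integrable M (\<lambda>z. z s) \<and> integral\<^sup>L M (\<lambda>z. z s) = \<phi> s" for s
  proof -
    have re: "integrable M (\<lambda>z. Re (z s)) \<and> integral\<^sup>L M (\<lambda>z. Re (z s)) = Re (\<phi> s)"
      using test[of "(0, s, s, 0)"] \<Lambda>_eq[of 0 s s] by (simp add: moment_test_def l_def)
    have im: "integrable M (\<lambda>z. Im (z s)) \<and> integral\<^sup>L M (\<lambda>z. Im (z s)) = Im (\<phi> s)"
      using test[of "(1, s, s, 0)"] \<Lambda>_eq[of 1 s s] by (simp add: moment_test_def l_def)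
    have eq: "(\<lambda>z. z s) = (\<lambda>z. complex_of_real (Re (z s)) + \<i> * complex_of_real (Im (z s)))"
      by (simp add: complex_eq[symmetric])
    have "integrable M (\<lambda>z. complex_of_real (Re (z s)) + \<i> * complex_of_real (Im (z s)))"
      using re im by (intro Bochner_Integration.integrable_add integrable_mult_right integrable_of_real) auto
    moreover have "integral\<^sup>L M (\<lambda>z. complex_of_real (Re (z s)) + \<i> * complex_of_real (Im (z s)))
        = complex_of_real (Re (\<phi> s)) + \<i> * complex_of_real (Im (\<phi> s))"
      using re im by (subst Bochner_Integration.integral_add) (auto intro!: integrable_mult_right integrable_of_real)
    ultimately show ?thesis by (subst (1 2) eq) (simp add: complex_eq[symmetric])
  qed
  have supp: "emeasure M (- characters star) = 0"
  proof -
    have "emeasure M (\<Union>(range (\<lambda>(s, t). {z. 0 < character_defect s t z}))) = 0"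
    proof (rule radon_null_Union[OF M(1)])
      fix U assume "U \<in> range (\<lambda>(s, t). {z. 0 < character_defect s t z})"
      then obtain s t where U: "U = {z. 0 < character_defect s t z}" by auto
      have "integrable M (character_defect s t)" "integral\<^sup>L M (character_defect s t) = 0"
        using test[of "(2, s, t, 0)"] \<Lambda>_eq[of 2 s t] by (simp_all add: moment_test_def l_def)
      then have "AE z in M. character_defect s t z = 0"
        using integral_nonneg_eq_0_iff_AE[of M "character_defect s t"] by (simp add: character_defect_nonneg)
      then have "AE z in M. \<not> 0 < character_defect s t z" by eventually_elim simp
      moreover have "openin euclidean U"
        unfolding U by (simp add: open_Collect_less[OF continuous_on_const continuous_character_defect])
      moreover have "space M = UNIV" using M(1) by (simp add: radon_measure_def)
      ultimately show "openin euclidean U \<and> emeasure M U = 0"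
        using radon_measurable_openin[OF M(1)] AE_iff_measurable[of U M "\<lambda>z. \<not> 0 < character_defect s t z"]
        by (simp add: U)
    qed
    moreover have "\<Union>(range (\<lambda>(s, t). {z. 0 < character_defect s t z})) = - characters star"
      by (auto simp: characters_iff_defect order_less_le character_defect_nonneg)
    ultimately show ?thesis by simp
  qed
  show ?thesis by (rule that[OF M(1,2) supp rep])
qed

end

section \<open>Compactly supported Radon measures\<close>


lemma radon_measure_AE_support:
  assumes M: "radon_measure T M"
  shows "AE x in M. x \<in> measure_support T M"
proof (rule AE_I)
  show "{x \<in> space M. x \<notin> measure_support T M} \<subseteq> topspace T - measure_support T M"
    using M by (auto simp: radon_measure_def)
  show "emeasure M (topspace T - measure_support T M) = 0" by (rule radon_support_null[OF M])
  show "topspace T - measure_support T M \<in> sets M"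
    by (rule radon_measurable_openin[OF M openin_support_complement])
qed

lemma radon_compact_support_finite:
  assumes M: "radon_measure T M" and K: "compactin T (measure_support T M)"
  shows "finite_measure M"
proof (rule finite_measureI)
  let ?S = "measure_support T M"
  have space: "space M = topspace T" using M by (simp add: radon_measure_def)
  have S: "?S = space M - (topspace T - ?S)" by (auto simp: space measure_support_def)
  have null: "topspace T - ?S \<in> null_sets M"
    using radon_support_null[OF M] radon_measurable_openin[OF M openin_support_complement] by (auto simp: null_sets_def)
  have "emeasure M ?S = emeasure M (space M)"
    by (subst S) (rule emeasure_Diff_null_set[OF null sets.top])
  moreover have "emeasure M ?S < \<infinity>" using M K by (simp add: radon_measure_def)
  ultimately show "emeasure M (space M) \<noteq> \<infinity>" by simp
qed

lemma radon_measurable_compactin: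
  assumes T: "Hausdorff_space T" and M: "radon_measure T M" and D: "compactin T D"
  shows "D \<in> sets M"
proof -
  have "openin T (topspace T - D)" using compactin_imp_closedin[OF T D] by blast
  moreover have "D = space M - (topspace T - D)"
    using compactin_subset_topspace[OF D] M by (auto simp: radon_measure_def)
  ultimately show ?thesis by (metis radon_measurable_openin[OF M] sets.compl_sets)
qed

text \<open>Inner regularity of the complement, available because the measure is finite.\<close>

lemma radon_outer_approximation:
  assumes T: "Hausdorff_space T" and M: "radon_measure T M" "finite_measure M"
    and C: "compactin T C" and e: "e > 0"
  obtains U where "openin T U" "C \<subseteq> U" "measure M U \<le> measure M C + e"
proof -
  interpret finite_measure M by fact
  have space: "space M = topspace T" using M by (simp add: radon_measure_def)
  have CT: "C \<subseteq> topspace T" using C by (rule compactin_subset_topspace)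
  have open_compl: "openin T (topspace T - D)" if "compactin T D" for D
    using compactin_imp_closedin[OF T that] by blast
  note sets = radon_measurable_compactin[OF T M(1)]
  have W: "topspace T - C \<in> sets M" by (rule radon_measurable_openin[OF M(1) open_compl[OF C]])
  have sup: "emeasure M (topspace T - C) = (SUP K\<in>{K. compactin T K \<and> K \<subseteq> topspace T - C}. emeasure M K)"
    using M(1) W by (simp add: radon_measure_def)
  have "\<exists>K\<in>{K. compactin T K \<and> K \<subseteq> topspace T - C}. emeasure M (topspace T - C) < emeasure M K + ennreal e"
    by (rule SUP_approx_ennreal[OF e _ sup]) (auto intro!: exI[of _ "{}"])
  then obtain D where D: "compactin T D" "D \<subseteq> topspace T - C"
    and lt: "emeasure M (topspace T - C) < emeasure M D + ennreal e" by blast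
  have "measure M (topspace T - C) \<le> measure M D + e"
    using lt e by (simp add: emeasure_eq_measure ennreal_less_iff flip: ennreal_plus)
  moreover have "measure M (topspace T - C) = measure M (space M) - measure M C"
    "measure M (topspace T - D) = measure M (space M) - measure M D"
    using finite_measure_compl[OF sets[OF C]] finite_measure_compl[OF sets[OF D(1)]] by (simp_all add: space)
  ultimately have "measure M (topspace T - D) \<le> measure M C + e" by simp
  then show ?thesis
    using that[of "topspace T - D"] open_compl[OF D(1)] D(2) CT by blast
qed

lemma Hausdorff_character_space: "Hausdorff_space (character_space star)"
  by (simp add: character_space_eq Hausdorff_space_subtopology Hausdorff_euclidean_fun)

context commutative_involution
begin

lemma finite_radius_power_bound:
  assumes psd: "psd f" and r: "moment_radius star f s = ereal r"
  shows "r \<ge> 0" "n > 0 \<Longrightarrow> Re (f (s ^ n * star s ^ n)) \<le> r ^ (2 * n)"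
proof -
  have nn: "0 \<le> Re (f (s ^ n * star s ^ n))" for n
    using positive_semidefinite_power[OF inv psd, of s n] by (simp add: complex_nonneg_Reals_iff)
  have le: "root (2 * n) (Re (f (s ^ n * star s ^ n))) \<le> r" if "n > 0" for n
  proof -
    have "ereal (root (2 * n) (Re (f (s ^ n * star s ^ n)))) \<le> moment_radius star f s"
      unfolding moment_radius_def using that by (intro SUP_upper) auto
    then show ?thesis by (simp add: r)
  qed
  have "0 \<le> root (2 * 1) (Re (f (s ^ 1 * star s ^ 1)))" using nn[of 1] by (intro real_root_ge_zero)
  then show "r \<ge> 0" using le[of 1] by linarith
  show "Re (f (s ^ n * star s ^ n)) \<le> r ^ (2 * n)" if n: "n > 0"
  proof -
    have "Re (f (s ^ n * star s ^ n)) = root (2 * n) (Re (f (s ^ n * star s ^ n))) ^ (2 * n)"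
      using n nn by (intro real_root_pow_pos2[symmetric]) auto
    also have "\<dots> \<le> r ^ (2 * n)"
      using le[OF n] nn by (intro power_mono real_root_ge_zero)
    finally show ?thesis .
  qed
qed

lemma moment_radius_finite_iff:
  assumes "psd f"
  shows "moment_radius star f s < \<infinity> \<longleftrightarrow> (\<exists>r. moment_radius star f s = ereal r)"
proof -
  have "ereal (root (2 * 1) (Re (f (s ^ 1 * star s ^ 1)))) \<le> moment_radius star f s"
    unfolding moment_radius_def by (intro SUP_upper) auto
  then have "moment_radius star f s \<noteq> - \<infinity>" by auto
  then show ?thesis by (cases "moment_radius star f s") auto
qed

text \<open>The bound on \<open>f (s\<^sup>n s\<^sup>*\<^sup>n)\<close> carries over to \<open>f (u (s s\<^sup>*)\<^sup>n)\<close> by the Cauchy-Schwarz inequality. Adding \<open>1\<close> to the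
  radius makes it positive, as the norm bound requires; the sharp location of the support is
  the separate result \<open>support_bounded\<close>.\<close>

lemma finite_radius_admissible:
  assumes psd: "psd f" and fin: "\<And>s. moment_radius star f s < \<infinity>"
  obtains \<rho> where "admissible \<rho> f" "\<And>s. \<rho> s > 0"
proof -
  have "\<forall>s. \<exists>r. moment_radius star f s = ereal r"
    using fin moment_radius_finite_iff[OF psd] by blast
  then obtain r where r: "\<And>s. moment_radius star f s = ereal (r s)" by metis
  define \<rho> where "\<rho> = (\<lambda>s. r s + 1)"
  have r0: "r s \<ge> 0" for s by (rule finite_radius_power_bound(1)[OF psd r])
  have "exp_growth \<rho> f"
    unfolding exp_growth_def
  proof (intro allI exI)
    fix u s n
    let ?A = "Re (f (star (star u) * star u))"
    have A: "?A \<ge> 0" using psd_diagonal[OF psd, of u] by (simp add: complex_nonneg_Reals_iff)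
    show "cmod (f (u * (s * star s) ^ n)) \<le> (sqrt ?A + cmod (f u)) * \<rho> s ^ (2 * n)"
    proof (cases "n = 0")
      case True
      then show ?thesis using A by simp
    next
      case False
      have "t ^ (2 * n) = t ^ n * t ^ n" for t :: 'a by (simp add: mult_2 power_add)
      then have "star ((s * star s) ^ n) * (s * star s) ^ n = s ^ (2 * n) * star s ^ (2 * n)"
        by (simp only: star_power star_mult star_star power_mult_distrib mult_ac)
      then have "(cmod (f (u * (s * star s) ^ n)))\<^sup>2 \<le> ?A * Re (f (s ^ (2 * n) * star s ^ (2 * n)))"
        using psd_cauchy_schwarz[OF psd, of "star u" "(s * star s) ^ n"] by simp
      also have "\<dots> \<le> ?A * r s ^ (2 * (2 * n))"
        using finite_radius_power_bound(2)[OF psd r, of "2 * n" s] False A by (intro mult_left_mono) auto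
      also have "\<dots> = (sqrt ?A * r s ^ (2 * n))\<^sup>2"
        using A by (simp add: power_mult_distrib power_mult[symmetric] mult.commute)
      finally have "cmod (f (u * (s * star s) ^ n)) \<le> sqrt ?A * r s ^ (2 * n)"
        using A r0 by (rule_tac power2_le_imp_le) auto
      also have "\<dots> \<le> (sqrt ?A + cmod (f u)) * \<rho> s ^ (2 * n)"
        using A r0[of s] by (intro mult_mono power_mono) (auto simp: \<rho>_def)
      finally show ?thesis .
    qed
  qed
  then show ?thesis using that[of \<rho>] psd r0 by (auto simp: admissible_def \<rho>_def add_nonneg_pos)
qed

text \<open>The measure on the full function space is restricted to the characters, a closed set of full
  measure; its support lies in the compact box.\<close>

theorem representation_exists:
  assumes psd: "psd f" and fin: "\<And>s. moment_radius star f s < \<infinity>"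
  obtains \<nu> where "compactly_supported_representing_measure star f \<nu>"
proof -
  obtain \<rho> where \<rho>: "admissible \<rho> f" "\<And>s. \<rho> s > 0"
    using finite_radius_admissible[OF psd fin] by metis
  let ?Z = "bounding_box \<rho>" and ?X = "characters star" and ?T = "character_space star"
  obtain M where M: "radon_measure euclidean M" "emeasure M (- ?Z) = 0" "emeasure M (- ?X) = 0"
    and rep: "\<And>s. integrable M (\<lambda>z. z s) \<and> integral\<^sup>L M (\<lambda>z. z s) = f s"
    using admissible_representation[OF \<rho>] by metis
  have space_M: "space M = UNIV" using M(1) by (simp add: radon_measure_def)
  have nX: "- ?X \<in> sets M"
    using radon_measurable_openin[OF M(1), of "- ?X"] closed_characters[of star] by (simp add: open_Compl)
  then have X: "?X \<in> sets M" using sets.compl_sets[OF nX] by (simp add: space_M Compl_eq_Diff_UNIV double_diff)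
  have nZ: "- ?Z \<in> sets M"
    using radon_measurable_openin[OF M(1), of "- ?Z"] hausdorff_compact_closed[OF Hausdorff_euclidean_fun compact_bounding_box[of \<rho>]]
    by (simp add: open_Compl)
  have AE_X: "AE z in M. z \<in> ?X"
    using M(3) nX by (intro AE_I[of _ _ "- ?X"]) auto
  define \<nu> where "\<nu> = restrict_space M ?X"
  have radon: "radon_measure ?T \<nu>"
    unfolding \<nu>_def character_space_eq by (rule radon_measure_restrict[OF M(1) closed_characters])
  have "integrable \<nu> (\<lambda>\<alpha>. \<alpha> s) \<and> f s = integral\<^sup>L \<nu> (\<lambda>\<alpha>. \<alpha> s)" for s
  proof -
    have int: "integrable M (\<lambda>z. indicat_real ?X z *\<^sub>R z s)"
      using X rep by (intro integrable_mult_indicator) auto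
    have "integral\<^sup>L M (\<lambda>z. indicat_real ?X z *\<^sub>R z s) = integral\<^sup>L M (\<lambda>z. z s)"
      using int rep AE_X by (intro integral_cong_AE) (auto simp: borel_measurable_integrable elim: eventually_mono)
    then show ?thesis
      using int rep X by (simp add: \<nu>_def integrable_restrict_space integral_restrict_space space_M)
  qed
  moreover have "compactin ?T (measure_support ?T \<nu>)"
  proof -
    let ?S = "measure_support ?T \<nu>"
    have "?S \<subseteq> ?Z"
    proof
      fix x assume x: "x \<in> ?S"
      show "x \<in> ?Z"
      proof (rule ccontr)
        assume "x \<notin> ?Z"
        have "openin ?T (?X - ?Z)"
          using hausdorff_compact_closed[OF Hausdorff_euclidean_fun compact_bounding_box[of \<rho>]]
          unfolding character_space_eq by (auto simp: openin_open Diff_eq open_Compl)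
        moreover have "x \<in> ?X - ?Z"
          using x \<open>x \<notin> ?Z\<close> by (simp add: measure_support_def topspace_character_space)
        ultimately have "emeasure \<nu> (?X - ?Z) > 0" using x by (simp add: measure_support_def)
        moreover have "emeasure \<nu> (?X - ?Z) = emeasure M (?X - ?Z)"
          unfolding \<nu>_def using X by (intro emeasure_restrict_space) auto
        moreover have "emeasure M (?X - ?Z) \<le> emeasure M (- ?Z)"
          using nZ by (intro emeasure_mono) auto
        ultimately show False using M(2) by simp
      qed
    qed
    have SX: "?S \<subseteq> ?X" by (auto simp: measure_support_def topspace_character_space)
    have "closedin ?T ?S"
      using openin_support_complement[of ?T \<nu>] SX by (simp add: closedin_def topspace_character_space)
    then have "closed ?S"
      unfolding character_space_eq using closed_characters closedin_closed_trans by blast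
    then have "compact (?S \<inter> ?Z)" using compact_bounding_box by (rule closed_Int_compact)
    then show ?thesis
      using \<open>?S \<subseteq> ?Z\<close> SX unfolding character_space_eq by (simp add: compactin_subtopology Int_absorb2)
  qed
  ultimately have "compactly_supported_representing_measure star f \<nu>"
    unfolding compactly_supported_representing_measure_def representing_measure_def
    using radon by blast
  then show ?thesis by (rule that)
qed

text \<open>On characters \<open>\<alpha> (s\<^sup>n s\<^sup>*\<^sup>n) = \<bar>\<alpha> s\<bar>\<^sup>2\<^sup>n\<close>. Both the finiteness of the radius and the location of the support
  are read off from this.\<close>

lemma representing_power_integral:
  assumes rep: "representing_measure star f \<nu>"
  shows "integrable \<nu> (\<lambda>\<alpha>. cmod (\<alpha> s) ^ (2 * n))"
    and "Re (f (s ^ n * star s ^ n)) = integral\<^sup>L \<nu> (\<lambda>\<alpha>. cmod (\<alpha> s) ^ (2 * n))"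
proof -
  have int: "integrable \<nu> (\<lambda>\<alpha>. \<alpha> (s ^ n * star s ^ n))"
    and f: "f (s ^ n * star s ^ n) = integral\<^sup>L \<nu> (\<lambda>\<alpha>. \<alpha> (s ^ n * star s ^ n))"
    using rep by (auto simp: representing_measure_def)
  have space: "space \<nu> = characters star"
    using rep by (simp add: representing_measure_def radon_measure_def topspace_character_space)
  have eq: "\<alpha> (s ^ n * star s ^ n) = complex_of_real (cmod (\<alpha> s) ^ (2 * n))" if "\<alpha> \<in> space \<nu>" for \<alpha>
  proof -
    have a: "\<alpha> 1 = 1" "\<And>s t. \<alpha> (s * t) = \<alpha> s * \<alpha> t" "\<And>s. \<alpha> (star s) = cnj (\<alpha> s)"
      using that by (auto simp: space characters_def)
    have pow: "\<alpha> (t ^ k) = \<alpha> t ^ k" for t k by (induction k) (simp_all add: a)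
    have "\<alpha> (s ^ n * star s ^ n) = (\<alpha> s * cnj (\<alpha> s)) ^ n"
      by (simp add: a pow power_mult_distrib)
    also have "\<dots> = complex_of_real (cmod (\<alpha> s) ^ (2 * n))"
      by (simp add: complex_norm_square[symmetric] power_mult)
    finally show ?thesis .
  qed
  have "integrable \<nu> (\<lambda>\<alpha>. complex_of_real (cmod (\<alpha> s) ^ (2 * n)))"
    using int by (subst (asm) Bochner_Integration.integrable_cong[OF refl eq])
  then have "integrable \<nu> (\<lambda>\<alpha>. Re (complex_of_real (cmod (\<alpha> s) ^ (2 * n))))" by (rule integrable_Re)
  then show int': "integrable \<nu> (\<lambda>\<alpha>. cmod (\<alpha> s) ^ (2 * n))" by simp
  have "f (s ^ n * star s ^ n) = integral\<^sup>L \<nu> (\<lambda>\<alpha>. complex_of_real (cmod (\<alpha> s) ^ (2 * n)))"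
    unfolding f by (rule Bochner_Integration.integral_cong[OF refl eq])
  also have "\<dots> = complex_of_real (integral\<^sup>L \<nu> (\<lambda>\<alpha>. cmod (\<alpha> s) ^ (2 * n)))"
    by (rule integral_complex_of_real)
  finally show "Re (f (s ^ n * star s ^ n)) = integral\<^sup>L \<nu> (\<lambda>\<alpha>. cmod (\<alpha> s) ^ (2 * n))" by simp
qed

text \<open>If \<open>\<bar>\<alpha> s\<bar> \<le> B\<close> on the support and \<open>c\<close> is the total mass, then the \<open>2n\<close>-th moment is at most \<open>B\<^sup>2\<^sup>n c\<close>, and the
  crude estimate \<open>c \<le> (1 + c)\<^sup>2\<^sup>n\<close> removes the root.\<close>

theorem compact_support_imp_finite_radius:
  assumes "compactly_supported_representing_measure star f \<nu>"
  shows "moment_radius star f s < \<infinity>"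
proof -
  let ?T = "character_space star"
  let ?S = "measure_support ?T \<nu>"
  have rep: "representing_measure star f \<nu>" and K: "compactin ?T ?S" and radon: "radon_measure ?T \<nu>"
    using assms by (auto simp: compactly_supported_representing_measure_def representing_measure_def)
  interpret finite_measure \<nu> by (rule radon_compact_support_finite[OF radon K])
  have "compact ?S" using K unfolding character_space_eq by (simp add: compactin_subtopology)
  then have "bounded ((\<lambda>\<alpha>. \<alpha> s) ` ?S)"
    by (intro compact_imp_bounded compact_continuous_image
        continuous_on_subset[OF continuous_on_product_coordinates] subset_UNIV)
  then obtain B where B: "B > 0" "\<And>\<alpha>. \<alpha> \<in> ?S \<Longrightarrow> cmod (\<alpha> s) \<le> B"
    unfolding bounded_pos by auto
  define c where "c = measure \<nu> (space \<nu>)"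
  have c: "c \<ge> 0" by (simp add: c_def)
  have "root (2 * n) (Re (f (s ^ n * star s ^ n))) \<le> B * (1 + c)" if n: "n > 0" for n
  proof -
    have "Re (f (s ^ n * star s ^ n)) = integral\<^sup>L \<nu> (\<lambda>\<alpha>. cmod (\<alpha> s) ^ (2 * n))"
      by (rule representing_power_integral(2)[OF rep])
    also have "\<dots> \<le> integral\<^sup>L \<nu> (\<lambda>\<alpha>. B ^ (2 * n))"
    proof (rule integral_mono_AE)
      show "AE \<alpha> in \<nu>. cmod (\<alpha> s) ^ (2 * n) \<le> B ^ (2 * n)"
        using radon_measure_AE_support[OF radon] by eventually_elim (auto intro: power_mono B(2))
    qed (use representing_power_integral(1)[OF rep] in auto)
    also have "\<dots> = B ^ (2 * n) * c" by (simp add: c_def)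
    also have "\<dots> \<le> B ^ (2 * n) * (1 + c) ^ (2 * n)"
    proof (rule mult_left_mono)
      have "1 + c \<le> (1 + c) ^ (2 * n)" using c n by (intro self_le_power) auto
      then show "c \<le> (1 + c) ^ (2 * n)" by linarith
    qed (use B(1) in simp)
    finally have "Re (f (s ^ n * star s ^ n)) \<le> (B * (1 + c)) ^ (2 * n)" by (simp add: power_mult_distrib)
    then have "root (2 * n) (Re (f (s ^ n * star s ^ n))) \<le> root (2 * n) ((B * (1 + c)) ^ (2 * n))"
      using n by (intro real_root_le_mono) auto
    also have "\<dots> = B * (1 + c)" using n B(1) c by (intro real_root_power_cancel) auto
    finally show ?thesis .
  qed
  then have "moment_radius star f s \<le> ereal (B * (1 + c))"
    unfolding moment_radius_def by (intro SUP_least) auto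
  then show ?thesis by (rule order_le_less_trans) simp
qed

text \<open>If \<open>\<bar>\<alpha> s\<bar> > r > R\<^sub>s\<close> at a point of the support, then the open set where \<open>\<bar>\<beta> s\<bar> > r\<close> has positive mass \<open>p\<close>, and
  \<open>r\<^sup>2\<^sup>n p \<le> f (s\<^sup>n s\<^sup>*\<^sup>n) \<le> R\<^sub>s\<^sup>2\<^sup>n\<close> is impossible for large \<open>n\<close>.\<close>

theorem support_bounded:
  assumes psd: "psd f" and "compactly_supported_representing_measure star f \<nu>"
  shows "measure_support (character_space star) \<nu> \<subseteq> bounded_characters star f"
proof
  let ?T = "character_space star"
  fix \<alpha> assume \<alpha>: "\<alpha> \<in> measure_support ?T \<nu>"
  have rep: "representing_measure star f \<nu>" and K: "compactin ?T (measure_support ?T \<nu>)" and radon: "radon_measure ?T \<nu>"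
    using assms by (auto simp: compactly_supported_representing_measure_def representing_measure_def)
  interpret finite_measure \<nu> by (rule radon_compact_support_finite[OF radon K])
  have \<alpha>X: "\<alpha> \<in> characters star"
    using \<alpha> by (simp add: measure_support_def topspace_character_space)
  have "ereal (cmod (\<alpha> s)) \<le> moment_radius star f s" for s
  proof (rule ccontr)
    assume "\<not> ?thesis"
    then have lt: "moment_radius star f s < ereal (cmod (\<alpha> s))" by simp
    then have "moment_radius star f s < \<infinity>" by (rule order_less_trans) simp
    then obtain R where R: "moment_radius star f s = ereal R"
      using moment_radius_finite_iff[OF psd] by blast
    have R0: "R \<ge> 0" by (rule finite_radius_power_bound(1)[OF psd R])
    obtain r where r: "R < r" "r < cmod (\<alpha> s)" using lt R dense by auto
    define U where "U = characters star \<inter> {\<beta>. r < cmod (\<beta> s)}"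
    have "open {\<beta> :: 'a \<Rightarrow> complex. r < cmod (\<beta> s)}"
      by (intro open_Collect_less continuous_intros continuous_on_product_coordinates)
    then have openU: "openin ?T U"
      unfolding U_def character_space_eq by (auto simp: openin_open)
    then have "emeasure \<nu> U > 0" using \<alpha> \<alpha>X r by (simp add: measure_support_def U_def)
    then have p: "measure \<nu> U > 0" by (simp add: emeasure_eq_measure)
    have Us: "U \<in> sets \<nu>" by (rule radon_measurable_openin[OF radon openU])
    have bound: "measure \<nu> U \<le> (R / r) ^ (2 * n)" if n: "n > 0" for n
    proof -
      have "r ^ (2 * n) * measure \<nu> U = integral\<^sup>L \<nu> (\<lambda>\<beta>. r ^ (2 * n) * indicator U \<beta>)"
        using Us by simp
      also have "\<dots> \<le> integral\<^sup>L \<nu> (\<lambda>\<beta>. cmod (\<beta> s) ^ (2 * n))"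
      proof (rule integral_mono)
        show "r ^ (2 * n) * indicator U \<beta> \<le> cmod (\<beta> s) ^ (2 * n)" for \<beta>
          using r R0 by (auto simp: indicator_def U_def intro!: power_mono)
        show "integrable \<nu> (\<lambda>\<beta>. r ^ (2 * n) * indicator U \<beta>)"
          using Us by (intro integrable_mult_right integrable_real_indicator) (auto simp: emeasure_eq_measure)
      qed (rule representing_power_integral(1)[OF rep])
      also have "\<dots> = Re (f (s ^ n * star s ^ n))"
        by (rule representing_power_integral(2)[OF rep, symmetric])
      also have "\<dots> \<le> R ^ (2 * n)" by (rule finite_radius_power_bound(2)[OF psd R n])
      finally show ?thesis using r R0 by (simp add: power_divide field_simps)
    qed
    have q: "0 \<le> R / r" "R / r < 1" using r R0 by auto
    obtain n where n: "(R / r) ^ n < measure \<nu> U" using real_arch_pow_inv[OF p q(2)] by blast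
    have "(R / r) ^ (2 * Suc n) \<le> (R / r) ^ n" using q by (intro power_decreasing) auto
    then show False using bound[of "Suc n"] n by linarith
  qed
  then show "\<alpha> \<in> bounded_characters star f" using \<alpha>X by (simp add: bounded_characters_def)
qed

end

section \<open>Uniqueness\<close>


text \<open>A copy of the function space whose product topology belongs to the class of Hausdorff spaces, as
  is required by the locale \<open>function_ring_on\<close>.\<close>

typedef 'a point_copy = "UNIV :: ('a \<Rightarrow> complex) set"
  morphisms point_value Point by simp

lemma point_value_Point [simp]: "point_value (Point z) = z"
  by (simp add: Point_inverse)

instantiation point_copy :: (type) t2_space
begin

definition open_point_copy_def: "open U \<longleftrightarrow> open (Point -` U)"

instance
proof
  fix x y :: "'a point_copy"
  assume "x \<noteq> y"
  then have "point_value x \<noteq> point_value y" by (simp add: point_value_inject)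
  then obtain U V where UV: "open U" "open V" "point_value x \<in> U" "point_value y \<in> V" "U \<inter> V = {}"
    using Hausdorff_euclidean_fun[where 'i = 'a and 'b = complex]
    by (force simp: Hausdorff_space_def disjnt_def)
  then show "\<exists>U V. open U \<and> open V \<and> x \<in> U \<and> y \<in> V \<and> U \<inter> V = {}"
    by (intro exI[of _ "point_value -` U"] exI[of _ "point_value -` V"])
       (auto simp: open_point_copy_def vimage_def)
qed (auto simp: open_point_copy_def vimage_Union)

end

lemma continuous_Point: "continuous_on A Point"
proof -
  have "continuous_on UNIV (Point :: ('a \<Rightarrow> complex) \<Rightarrow> 'a point_copy)"
    by (simp add: continuous_on_open_vimage open_point_copy_def)
  then show ?thesis by (rule continuous_on_subset) simp
qed

lemma continuous_point_value: "continuous_on A (\<lambda>x. point_value x s)"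
proof -
  have "open ((\<lambda>x. point_value x s) -` B)" if "open B" for B
    using open_vimage[OF that continuous_on_product_coordinates[of s]]
    by (simp add: open_point_copy_def vimage_def)
  then have "continuous_on UNIV (\<lambda>x. point_value x s)"
    by (simp add: continuous_on_open_vimage)
  then show ?thesis by (rule continuous_on_subset) simp
qed

inductive_set character_polynomials :: "(('a \<Rightarrow> complex) \<Rightarrow> complex) set" where
  monomial: "(\<lambda>\<alpha>. c * \<alpha> s) \<in> character_polynomials"
| add: "P \<in> character_polynomials \<Longrightarrow> Q \<in> character_polynomials \<Longrightarrow> (\<lambda>\<alpha>. P \<alpha> + Q \<alpha>) \<in> character_polynomials"

lemma character_polynomials_mult:
  assumes "P \<in> character_polynomials" "Q \<in> character_polynomials"
  shows "\<exists>R\<in>character_polynomials. \<forall>\<alpha>\<in>characters star. R \<alpha> = P \<alpha> * Q \<alpha>"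
  using assms
proof (induction P rule: character_polynomials.induct)
  case (monomial c s)
  then show ?case
  proof (induction Q rule: character_polynomials.induct)
    case (monomial d t)
    show ?case
      by (rule bexI[OF _ character_polynomials.monomial[of "c * d" "s * t"]]) (auto simp: characters_def)
  next
    case (add Q Q')
    then obtain R R' where "R \<in> character_polynomials" "\<forall>\<alpha>\<in>characters star. R \<alpha> = c * \<alpha> s * Q \<alpha>"
      "R' \<in> character_polynomials" "\<forall>\<alpha>\<in>characters star. R' \<alpha> = c * \<alpha> s * Q' \<alpha>" by blast
    then show ?case
      by (intro bexI[of _ "\<lambda>\<alpha>. R \<alpha> + R' \<alpha>"] character_polynomials.add) (auto simp: distrib_left)
  qed
next
  case (add P P')
  then obtain R R' where "R \<in> character_polynomials" "\<forall>\<alpha>\<in>characters star. R \<alpha> = P \<alpha> * Q \<alpha>"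
    "R' \<in> character_polynomials" "\<forall>\<alpha>\<in>characters star. R' \<alpha> = P' \<alpha> * Q \<alpha>" by blast
  then show ?case
    by (intro bexI[of _ "\<lambda>\<alpha>. R \<alpha> + R' \<alpha>"] character_polynomials.add) (auto simp: distrib_right)
qed

lemma character_polynomials_integral:
  assumes "representing_measure star f \<nu>1" "representing_measure star f \<nu>2" "P \<in> character_polynomials"
  shows "integrable \<nu>1 P \<and> integrable \<nu>2 P \<and> integral\<^sup>L \<nu>1 P = integral\<^sup>L \<nu>2 P"
  using assms(3)
proof induction
  case (monomial c s)
  have "integrable \<nu>1 (\<lambda>\<alpha>. \<alpha> s)" "integrable \<nu>2 (\<lambda>\<alpha>. \<alpha> s)"
    "integral\<^sup>L \<nu>1 (\<lambda>\<alpha>. \<alpha> s) = f s" "integral\<^sup>L \<nu>2 (\<lambda>\<alpha>. \<alpha> s) = f s"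
    using assms(1,2) by (simp_all add: representing_measure_def)
  then show ?case by simp
qed simp

text \<open>The real-valued functions on \<open>K\<close> that are given by polynomials form a function ring. It separates
  points because on characters \<open>Re (\<alpha> s) = (\<alpha> s + \<alpha> (s\<^sup>*))/2\<close>, and similarly for the imaginary part. The
  separation of closed sets is the first half of the Stone-Weierstrass theorem.\<close>

lemma polynomial_separation:
  assumes K: "compact K" "K \<subseteq> characters star"
    and A: "compact A" "A \<subseteq> K" and B: "compact B" "B \<subseteq> K" and disj: "A \<inter> B = {}"
    and e: "0 < e" "e < 1"
  obtains P where "P \<in> character_polynomials" "\<And>\<alpha>. \<alpha> \<in> K \<Longrightarrow> 0 \<le> Re (P \<alpha>) \<and> Re (P \<alpha>) \<le> 1"
    "\<And>\<alpha>. \<alpha> \<in> A \<Longrightarrow> Re (P \<alpha>) < e" "\<And>\<alpha>. \<alpha> \<in> B \<Longrightarrow> Re (P \<alpha>) > 1 - e"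
proof -
  let ?K = "Point ` K"
  define R where "R = {h :: 'a point_copy \<Rightarrow> real. continuous_on ?K h \<and>
      (\<exists>P\<in>character_polynomials. \<forall>\<alpha>\<in>K. complex_of_real (h (Point \<alpha>)) = P \<alpha>)}"
  interpret function_ring_on R ?K
  proof
    show "compact ?K" by (rule compact_continuous_image[OF continuous_Point K(1)])
    show "continuous_on ?K h" if "h \<in> R" for h using that by (simp add: R_def)
    show "(\<lambda>x. h x + k x) \<in> R" if hk: "h \<in> R" "k \<in> R" for h k
    proof -
      obtain P Q where "P \<in> character_polynomials" "\<forall>\<alpha>\<in>K. complex_of_real (h (Point \<alpha>)) = P \<alpha>"
        "Q \<in> character_polynomials" "\<forall>\<alpha>\<in>K. complex_of_real (k (Point \<alpha>)) = Q \<alpha>"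
        using hk by (auto simp: R_def)
      then show ?thesis
        using hk by (auto simp: R_def intro!: continuous_intros bexI[of _ "\<lambda>\<alpha>. P \<alpha> + Q \<alpha>"] character_polynomials.add)
    qed
    show "(\<lambda>x. h x * k x) \<in> R" if hk: "h \<in> R" "k \<in> R" for h k
    proof -
      obtain P Q where PQ: "P \<in> character_polynomials" "\<forall>\<alpha>\<in>K. complex_of_real (h (Point \<alpha>)) = P \<alpha>"
        "Q \<in> character_polynomials" "\<forall>\<alpha>\<in>K. complex_of_real (k (Point \<alpha>)) = Q \<alpha>"
        using hk by (auto simp: R_def)
      obtain S where "S \<in> character_polynomials" "\<forall>\<alpha>\<in>characters star. S \<alpha> = P \<alpha> * Q \<alpha>"
        using character_polynomials_mult[OF PQ(1,3)] by blast
      then show ?thesis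
        using hk PQ(2,4) K(2) by (auto simp: R_def intro!: continuous_intros bexI[of _ S])
    qed
    show "(\<lambda>_. c) \<in> R" for c
      using K(2) by (auto simp: R_def characters_def
          intro!: bexI[OF _ character_polynomials.monomial[of "complex_of_real c" 1]])
    fix x y assume xy: "x \<in> ?K" "y \<in> ?K" "x \<noteq> y"
    then obtain \<alpha> \<beta> where ab: "\<alpha> \<in> K" "\<beta> \<in> K" "x = Point \<alpha>" "y = Point \<beta>" "\<alpha> \<noteq> \<beta>" by auto
    then obtain s where s: "\<alpha> s \<noteq> \<beta> s" by auto
    have star: "\<gamma> (star s) = cnj (\<gamma> s)" if "\<gamma> \<in> K" for \<gamma>
      using that K(2) by (auto simp: characters_def)
    have "(\<lambda>\<gamma>. 1 / 2 * \<gamma> s + 1 / 2 * \<gamma> (star s)) \<in> character_polynomials"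
      "(\<lambda>\<gamma>. (- \<i> / 2) * \<gamma> s + (\<i> / 2) * \<gamma> (star s)) \<in> character_polynomials"
      by (intro character_polynomials.intros)+
    moreover have "complex_of_real (Re (\<gamma> s)) = 1 / 2 * \<gamma> s + 1 / 2 * \<gamma> (star s)"
      "complex_of_real (Im (\<gamma> s)) = (- \<i> / 2) * \<gamma> s + (\<i> / 2) * \<gamma> (star s)" if "\<gamma> \<in> K" for \<gamma>
      by (simp_all add: star[OF that] complex_eq_iff)
    ultimately have ReIm: "(\<lambda>x. Re (point_value x s)) \<in> R" "(\<lambda>x. Im (point_value x s)) \<in> R"
      unfolding R_def by (auto intro!: continuous_intros continuous_point_value)
    have "Re (\<alpha> s) \<noteq> Re (\<beta> s) \<or> Im (\<alpha> s) \<noteq> Im (\<beta> s)"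
      using s by (auto simp: complex_eq_iff)
    then show "\<exists>h\<in>R. h x \<noteq> h y"
    proof
      assume "Re (\<alpha> s) \<noteq> Re (\<beta> s)"
      then show ?thesis by (intro bexI[OF _ ReIm(1)]) (simp add: ab)
    next
      assume "Im (\<alpha> s) \<noteq> Im (\<beta> s)"
      then show ?thesis by (intro bexI[OF _ ReIm(2)]) (simp add: ab)
    qed
  qed
  have closed: "closed (Point ` C)" if "compact C" for C :: "('a \<Rightarrow> complex) set"
    by (intro compact_imp_closed compact_continuous_image[OF continuous_Point that])
  have "Point ` A \<inter> Point ` B = {}"
    using disj by (auto simp: Point_inject)
  then obtain h where h: "h \<in> R" "h ` ?K \<subseteq> {0..1}" "\<forall>x\<in>Point ` A. h x < e" "\<forall>x\<in>Point ` B. h x > 1 - e"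
    using two[OF closed[OF A(1)] image_mono[OF A(2)] closed[OF B(1)] image_mono[OF B(2)] _ e] by blast
  then obtain P where P: "P \<in> character_polynomials" "\<forall>\<alpha>\<in>K. complex_of_real (h (Point \<alpha>)) = P \<alpha>"
    by (auto simp: R_def)
  have Re: "Re (P \<alpha>) = h (Point \<alpha>)" if "\<alpha> \<in> K" for \<alpha>
    using P(2) that by (metis Re_complex_of_real)
  show ?thesis
  proof (rule that[OF P(1)])
    show "0 \<le> Re (P \<alpha>) \<and> Re (P \<alpha>) \<le> 1" if "\<alpha> \<in> K" for \<alpha>
      using h(2) that by (force simp: Re)
    show "Re (P \<alpha>) < e" if "\<alpha> \<in> A" for \<alpha> using h(3) that A(2) by (force simp: Re)
    show "Re (P \<alpha>) > 1 - e" if "\<alpha> \<in> B" for \<alpha> using h(4) that B(2) by (force simp: Re)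
  qed
qed

text \<open>A polynomial close to \<open>1\<close> on \<open>C\<close> and close to \<open>0\<close> outside a neighbourhood \<open>U\<close> of \<open>C\<close> has the same integral
  for both measures; this bounds the first measure of \<open>C\<close> by the second measure of \<open>U\<close>, up to
  \<open>e\<close> times a constant.\<close>

lemma measure_compact_le:
  assumes 1: "compactly_supported_representing_measure star f \<nu>1"
    and 2: "compactly_supported_representing_measure star f \<nu>2"
    and C: "compactin (character_space star) C"
  shows "measure \<nu>1 C \<le> measure \<nu>2 C"
proof -
  let ?T = "character_space star"
  have rep: "representing_measure star f \<nu>1" "representing_measure star f \<nu>2"
    and radon: "radon_measure ?T \<nu>1" "radon_measure ?T \<nu>2"
    and K12: "compactin ?T (measure_support ?T \<nu>1)" "compactin ?T (measure_support ?T \<nu>2)"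
    using 1 2 by (auto simp: compactly_supported_representing_measure_def representing_measure_def)
  interpret n1: finite_measure \<nu>1 by (rule radon_compact_support_finite[OF radon(1) K12(1)])
  interpret n2: finite_measure \<nu>2 by (rule radon_compact_support_finite[OF radon(2) K12(2)])
  define K where "K = measure_support ?T \<nu>1 \<union> measure_support ?T \<nu>2"
  have "compactin ?T K" unfolding K_def using K12 by (rule compactin_Un)
  then have K: "compact K" "K \<subseteq> characters star"
    by (simp_all add: character_space_eq compactin_subtopology)
  have AE1: "AE \<alpha> in \<nu>1. \<alpha> \<in> K" and AE2: "AE \<alpha> in \<nu>2. \<alpha> \<in> K"
    using radon_measure_AE_support[OF radon(1)] radon_measure_AE_support[OF radon(2)]
    by (auto simp: K_def elim: eventually_mono)
  have sets: "U \<in> sets \<nu>1" "U \<in> sets \<nu>2" if "openin ?T U" for U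
    using that radon radon_measurable_openin by blast+
  have C_sets: "C \<in> sets \<nu>1"
    by (rule radon_measurable_compactin[OF Hausdorff_character_space radon(1) C])
  let ?a = "measure \<nu>1 C" and ?b = "measure \<nu>2 C" and ?c = "measure \<nu>2 (space \<nu>2)"
  have step: "(1 - e) * ?a \<le> ?b + e + e * ?c" if e: "0 < e" "e < 1" for e :: real
  proof -
    obtain U where U: "openin ?T U" "C \<subseteq> U" "measure \<nu>2 U \<le> ?b + e"
      using radon_outer_approximation[OF Hausdorff_character_space radon(2) n2.finite_measure_axioms C e(1)] .
    obtain W where W: "open W" "U = characters star \<inter> W"
      using U(1) by (auto simp: character_space_eq openin_open)
    have cA: "compact (K - U)"
    proof -
      have "K - U = K - W" using K(2) W(2) by auto
      then show ?thesis using compact_diff[OF K(1) W(1)] by simp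
    qed
    have cB: "compact (K \<inter> C)"
      using C K(1) hausdorff_compact_closed[OF Hausdorff_euclidean_fun]
      by (auto simp: character_space_eq compactin_subtopology intro!: compact_Int_closed)
    obtain P where P: "P \<in> character_polynomials" "\<And>\<alpha>. \<alpha> \<in> K \<Longrightarrow> 0 \<le> Re (P \<alpha>) \<and> Re (P \<alpha>) \<le> 1"
      "\<And>\<alpha>. \<alpha> \<in> K - U \<Longrightarrow> Re (P \<alpha>) < e" "\<And>\<alpha>. \<alpha> \<in> K \<inter> C \<Longrightarrow> Re (P \<alpha>) > 1 - e"
      using polynomial_separation[OF K cA _ cB _ _ e] U(2) by blast
    note int = character_polynomials_integral[OF rep P(1)]
    have "(1 - e) * ?a = integral\<^sup>L \<nu>1 (\<lambda>\<alpha>. (1 - e) * indicator C \<alpha>)"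
      using C_sets by simp
    also have "\<dots> \<le> integral\<^sup>L \<nu>1 (\<lambda>\<alpha>. Re (P \<alpha>))"
    proof (rule integral_mono_AE)
      show "AE \<alpha> in \<nu>1. (1 - e) * indicator C \<alpha> \<le> Re (P \<alpha>)"
        using AE1 by eventually_elim (use P(2,4) in \<open>force simp: indicator_def intro: less_imp_le\<close>)
      show "integrable \<nu>1 (\<lambda>\<alpha>. (1 - e) * indicator C \<alpha>)"
        using C_sets by (intro integrable_mult_right integrable_real_indicator) (auto simp: n1.emeasure_eq_measure)
    qed (use int in auto)
    also have "\<dots> = integral\<^sup>L \<nu>2 (\<lambda>\<alpha>. Re (P \<alpha>))" using int by simp
    also have "\<dots> \<le> integral\<^sup>L \<nu>2 (\<lambda>\<alpha>. indicator U \<alpha> + e)"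
    proof (rule integral_mono_AE)
      show "AE \<alpha> in \<nu>2. Re (P \<alpha>) \<le> indicator U \<alpha> + e"
        using AE2
      proof eventually_elim
        case (elim \<alpha>)
        then show ?case using P(2)[OF elim] P(3)[of \<alpha>] e(1) by (cases "\<alpha> \<in> U") auto
      qed
      show "integrable \<nu>2 (\<lambda>\<alpha>. indicator U \<alpha> + e)"
        using sets(2)[OF U(1)] by (auto simp: n2.emeasure_eq_measure)
    qed (use int in auto)
    also have "\<dots> = measure \<nu>2 U + e * ?c"
      using sets(2)[OF U(1)] by (subst Bochner_Integration.integral_add) (auto simp: n2.emeasure_eq_measure mult.commute)
    finally show ?thesis using U(3) by linarith
  qed
  show ?thesis
  proof (rule ccontr)
    assume "\<not> ?thesis"
    then have ab: "?b < ?a" by simp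
    define D where "D = 1 + ?c + ?a"
    have D: "D \<ge> 1" by (simp add: D_def)
    define e where "e = min (1 / 2) ((?a - ?b) / (2 * D))"
    have e: "0 < e" "e < 1" using ab D by (auto simp: e_def)
    have "e * D \<le> (?a - ?b) / (2 * D) * D" using D by (intro mult_right_mono) (auto simp: e_def)
    also have "\<dots> = (?a - ?b) / 2" using D by simp
    finally have "e * D < ?a - ?b" using ab by simp
    then show False using step[OF e] by (simp add: D_def algebra_simps)
  qed
qed

theorem representing_measure_unique:
  assumes 1: "compactly_supported_representing_measure star f \<nu>1"
    and 2: "compactly_supported_representing_measure star f \<nu>2"
  shows "\<nu>1 = \<nu>2"
proof (rule measure_eqI)
  let ?T = "character_space star"
  have radon: "radon_measure ?T \<nu>1" "radon_measure ?T \<nu>2"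
    and K: "compactin ?T (measure_support ?T \<nu>1)" "compactin ?T (measure_support ?T \<nu>2)"
    using 1 2 by (auto simp: compactly_supported_representing_measure_def representing_measure_def)
  interpret n1: finite_measure \<nu>1 by (rule radon_compact_support_finite[OF radon(1) K(1)])
  interpret n2: finite_measure \<nu>2 by (rule radon_compact_support_finite[OF radon(2) K(2)])
  show sets: "sets \<nu>1 = sets \<nu>2" using radon by (simp add: radon_measure_def)
  fix B assume B: "B \<in> sets \<nu>1"
  have eq: "emeasure \<nu>1 C = emeasure \<nu>2 C" if "compactin ?T C" for C
    using measure_compact_le[OF 1 2 that] measure_compact_le[OF 2 1 that]
    by (simp add: n1.emeasure_eq_measure n2.emeasure_eq_measure)
  have "emeasure \<nu>1 B = (SUP K\<in>{K. compactin ?T K \<and> K \<subseteq> B}. emeasure \<nu>1 K)"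
    using radon(1) B unfolding radon_measure_def by blast
  also have "\<dots> = (SUP K\<in>{K. compactin ?T K \<and> K \<subseteq> B}. emeasure \<nu>2 K)"
    by (intro SUP_cong) (auto simp: eq)
  also have "\<dots> = emeasure \<nu>2 B"
    using radon(2) B unfolding radon_measure_def sets by simp
  finally show "emeasure \<nu>1 B = emeasure \<nu>2 B" .
qed

section \<open>The characterization\<close>

theorem theorem5p4:
  fixes star :: "'a::comm_monoid_mult \<Rightarrow> 'a" and f :: "'a \<Rightarrow> complex"
  assumes "involution star"
    and "positive_semidefinite star f"
  shows "((\<exists>!\<nu>. compactly_supported_representing_measure star f \<nu>) \<longleftrightarrow>
            (\<forall>s. moment_radius star f s < \<infinity>)) \<and>
         ((\<forall>s. moment_radius star f s < \<infinity>) \<longrightarrow>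
            (\<forall>\<nu>. compactly_supported_representing_measure star f \<nu> \<longrightarrow>
               measure_support (character_space star) \<nu> \<subseteq> bounded_characters star f))"
proof -
  interpret commutative_involution star by standard (rule assms(1))
  have "\<exists>!\<nu>. compactly_supported_representing_measure star f \<nu>" if fin: "\<forall>s. moment_radius star f s < \<infinity>"
  proof -
    obtain \<nu> where "compactly_supported_representing_measure star f \<nu>"
      using representation_exists[OF assms(2)] fin by blast
    then show ?thesis using representing_measure_unique by blast
  qed
  moreover have "moment_radius star f s < \<infinity>" if "\<exists>!\<nu>. compactly_supported_representing_measure star f \<nu>" for s
    using that compact_support_imp_finite_radius by blast
  ultimately show ?thesis using support_bounded[OF assms(2)] by blast
qed

end
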